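(* Let $n\ge 1$, let $U\subset\mathbb{R}^n$ be an open, bounded, connected set with Lipschitz boundary, and let $u\in W^{1,\infty}(U,\mathbb{R}^n)$ be essentially injective with $\operatorname{diam}(u(U))\le d$ and $0<\lambda\le\det Du(x)$ for a.e. $x\in U$. Then there exists $S\in W^{1,\infty}(U,\mathbb{R}^n)$ essentially injective and measure preserving such that $$\int_U |u-S|\,dx\le C\int_U|1-\det Du|\,dx,\qquad C=10\,\frac{d}{\lambda^{1/n}}\left(1+\frac1\lambda\right).$$
   Context: Functions in $W^{1,\infty}(U,\mathbb{R}^n)$ are identified with their continuous representatives. A map $u:U\to\mathbb{R}^n$ is essentially injective if the multiplicity function $y\mapsto \mathcal{H}^0(U\cap u^{-1}\{y\})\in[0,\infty]$ has $L^\infty(\mathbb{R}^n)$-norm equal to $1$. For $A\subset\mathbb{R}^n$ measurable, a map $s\in L^\infty(A,\mathbb{R}^n)$ is measure preserving if there exists a measurable set $B\subset\mathbb{R}^n$ such that the push-forward satisfies $s_\#(\mathcal{H}^n\llcorner A)=\mathcal{H}^n\llcorner B$, where $\mathcal{H}^n\llcorner A$ is $n$-dimensional Hausdorff (Lebesgue) measure restricted to $A$. *)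

theory Defs
  imports "HOL-Analysis.Analysis" "HOL-Probability.Essential_Supremum"
begin

definition Linf :: "'a::euclidean_space set \<Rightarrow> ('a \<Rightarrow> 'b::euclidean_space) set" where
  "Linf A = {f. f \<in> borel_measurable (lebesgue_on A) \<and>
                (\<exists>C. AE x in lebesgue_on A. norm (f x) \<le> C)}"

definition partial :: "'n \<Rightarrow> (real^'n::finite \<Rightarrow> real) \<Rightarrow> real^'n \<Rightarrow> real" where
  "partial j f x = frechet_derivative f (at x) (axis j 1)"

primrec Ck :: "nat \<Rightarrow> (real^'n::finite \<Rightarrow> real) \<Rightarrow> bool" where
  "Ck 0 f \<longleftrightarrow> continuous_on UNIV f"
| "Ck (Suc k) f \<longleftrightarrow> (\<forall>x. f differentiable (at x)) \<and> (\<forall>j. Ck k (partial j f))"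

definition test_functions :: "(real^'n::finite) set \<Rightarrow> (real^'n \<Rightarrow> real) set" where
  "test_functions U = {\<phi>. (\<forall>k. Ck k \<phi>) \<and>
     compact (closure {x. \<phi> x \<noteq> 0}) \<and> closure {x. \<phi> x \<noteq> 0} \<subseteq> U}"

definition locally_integrable_on ::
    "(real^'n::finite \<Rightarrow> 'b::euclidean_space) \<Rightarrow> (real^'n) set \<Rightarrow> bool" where
  "locally_integrable_on f U \<longleftrightarrow>
     (\<forall>K. compact K \<and> K \<subseteq> U \<longrightarrow> integrable (lebesgue_on K) f)"

text \<open>\<open>G\<close> is (a representative of) the distributional derivative \<open>Du\<close> of \<open>u\<close> on \<open>U\<close>;
  row \<open>i\<close>, column \<open>j\<close> is the partial derivative of the \<open>i\<close>-th component of \<open>u\<close> in direction \<open>j\<close>.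
  It is determined up to null sets of \<open>U\<close>.\<close>
definition has_weak_jacobian ::
    "(real^'n::finite \<Rightarrow> real^'n) \<Rightarrow> (real^'n \<Rightarrow> real^'n^'n) \<Rightarrow> (real^'n) set \<Rightarrow> bool" where
  "has_weak_jacobian u G U \<longleftrightarrow>
     locally_integrable_on u U \<and> locally_integrable_on G U \<and>
     (\<forall>\<phi>\<in>test_functions U. \<forall>i j.
        (LINT x|lebesgue_on U. u x $ i * partial j \<phi> x) =
        - (LINT x|lebesgue_on U. G x $ i $ j * \<phi> x))"

text \<open>Elements are the continuous representatives; values outside \<open>U\<close> are irrelevant.\<close>
definition W1inf :: "(real^'n::finite) set \<Rightarrow> (real^'n \<Rightarrow> real^'n) set" where
  "W1inf U = {u. continuous_on U u \<and> u \<in> Linf U \<and> (\<exists>G\<in>Linf U. has_weak_jacobian u G U)}"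

text \<open>Near each boundary point \<open>U\<close> is the region strictly above the graph, in some direction \<open>e\<close>,
  of a Lipschitz function \<open>\<gamma>\<close> on the hyperplane orthogonal to \<open>e\<close> (which plays the role of
  \<open>(n - 1)\<close>-dimensional space).\<close>
definition lipschitz_boundary :: "(real^'n::finite) set \<Rightarrow> bool" where
  "lipschitz_boundary U \<longleftrightarrow>
     (\<forall>x\<in>frontier U. \<exists>r>0. \<exists>e \<gamma> L. norm e = 1 \<and> L-lipschitz_on {v. e \<bullet> v = 0} \<gamma> \<and>
        U \<inter> ball x r = {y \<in> ball x r. (\<gamma> (y - (e \<bullet> y) *\<^sub>R e) :: real) < e \<bullet> y})"

definition multiplicity_fun :: "('a \<Rightarrow> 'b) \<Rightarrow> 'a set \<Rightarrow> 'b \<Rightarrow> ennreal" where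
  "multiplicity_fun u U y = emeasure (count_space UNIV) (U \<inter> u -` {y})"

definition essentially_injective :: "(real^'n::finite) set \<Rightarrow> (real^'n \<Rightarrow> real^'n) \<Rightarrow> bool" where
  "essentially_injective U u \<longleftrightarrow> esssup lebesgue (multiplicity_fun u U) = 1"

text \<open>As a Borel measure on the whole space, the restriction of Lebesgue measure to \<open>B\<close> is the
  image of \<^term>\<open>lebesgue_on B\<close> under the inclusion.\<close>
definition measure_preserving :: "(real^'n::finite) set \<Rightarrow> (real^'n \<Rightarrow> real^'n) \<Rightarrow> bool" where
  "measure_preserving A s \<longleftrightarrow> A \<in> sets lebesgue \<and> s \<in> Linf A \<and>
     (\<exists>B\<in>sets lebesgue.
        distr (lebesgue_on A) borel s = distr (lebesgue_on B) borel (\<lambda>y. y))"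

end

theory Submission
  imports Defs
begin

text \<open>
  If \<open>det Du = 1\<close> almost everywhere, \<open>S = u\<close> works, by the area formula. Otherwise the right-hand
  side is positive, and it suffices to come close enough to it. Pushing Lebesgue measure on \<open>U\<close>
  forward by \<open>u\<close> gives a measure whose excess over Lebesgue measure has mass at most
  \<open>e = \<integral> max 0 (1 - det Du)\<close>. Hence, for \<open>n \<ge> 2\<close>, all but a volume slightly above \<open>e\<close> of
  the small cubes that fill \<open>U\<close> can be assigned, injectively, to cubes of the same size close to
  their image under \<open>u\<close>; the remaining ones are sent to free cubes in a ball of radius
  \<open>d / \<lambda>\<^sup>1\<^sup>/\<^sup>n\<close>, which has at least the volume of \<open>U\<close>. Every injective assignment of cubes of a
  grid is a composition of translations of the grid lines, and these are approximated by smooth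
  shears; so the assignment is realised, up to small measure, by a volume-preserving diffeomorphism
  of the whole space. For \<open>n = 1\<close> a translation works.

  The area formula needs differentiability almost everywhere. Convolving \<open>u\<close> with a bump of radius
  \<open>\<delta> r\<close> moves it by \<open>O(\<delta> r)\<close>, and at a Lebesgue point \<open>x\<close> of \<open>Du\<close> the gradient of the convolution
  is \<open>Du x + o(1)\<close> on the ball of radius \<open>r\<close> around \<open>x\<close>.
\<close>

section \<open>Compactly supported smooth bumps\<close>

text \<open>The obstacle is that \<open>S\<close> has to be continuous, while rearranging mass tears
  \<open>U\<close> apart. Translating cubes separately tears it only along thin layers at the faces.
  There the diffeomorphism is controlled by nothing but a bound on its displacement; this bound does
  not depend on the thickness \<delta> of the layers, so \<delta> is chosen last and the layers cost
  as little as desired. Two grids are needed because the excess is a statement about volumes: a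
  coarse cube of side \<open>H\<close> offers as many slots as it has fine subcubes, and a surplus
  of fine cubes heading for the same coarse cubes is paid for by the excess. A fine cube without a
  slot near its image is sent close to the ball of radius \<open>R = d / lam powr (1 / n)\<close>
  around a point of the image, so it costs about \<open>d + R\<close> per unit of volume. This gives
  the shape of the constant. Shifting grid lines requires a second direction on which the shift
  depends, and on the line a homeomorphism cannot reorder intervals. There \<open>u\<close> minus
  the identity varies by at most the integral of \<open>\<bar>1 - det Du\<bar>\<close>, so no
  rearrangement is necessary.\<close>

definition flat_exp :: "nat \<Rightarrow> real \<Rightarrow> real" where
  "flat_exp k t = (if t \<le> 0 then 0 else exp (- (1 / t)) / t ^ k)"

lemma flat_exp_nonneg: "0 \<le> flat_exp k t"
  by (simp add: flat_exp_def)

lemma flat_exp_tendsto_0: "(flat_exp k \<longlongrightarrow> 0) (at_right 0)"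
proof -
  have 1: "((\<lambda>x::real. x ^ k / exp x) \<longlongrightarrow> 0) at_top"
    by (rule tendsto_power_div_exp_0)
  have 2: "((\<lambda>t::real. inverse t ^ k / exp (inverse t)) \<longlongrightarrow> 0) (at_right 0)"
    using filterlim_compose[OF 1 filterlim_inverse_at_top_right] by simp
  show ?thesis
    by (rule Lim_transform_eventually[OF 2])
      (auto simp: flat_exp_def eventually_at_filter exp_minus field_simps intro!: always_eventually)
qed

text \<open>The powers in the denominator make the span of the \<open>flat_exp k\<close> closed
  under differentiation, so smoothness of all orders rests on this one computation.\<close>

lemma has_real_derivative_flat_exp:
  "(flat_exp k has_real_derivative (flat_exp (k + 2) t - real k * flat_exp (k + 1) t)) (at t)"
proof -
  consider "t < 0" | "t = 0" | "t > 0" by linarith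
  then show ?thesis
  proof cases
    case 1
    have "((\<lambda>_. 0::real) has_real_derivative 0) (at t)" by simp
    then have "(flat_exp k has_real_derivative 0) (at t)"
      by (rule has_field_derivative_transform_within_open[where S="{..<0}"])
        (use 1 in \<open>auto simp: flat_exp_def\<close>)
    then show ?thesis using 1 by (simp add: flat_exp_def)
  next
    case 3
    have "((\<lambda>t. exp (- (1 / t)) / t ^ k) has_real_derivative
        (exp (- (1 / t)) * (1 / t^2) * t ^ k - exp (- (1 / t)) * (real k * t ^ (k - 1))) / (t ^ k * t ^ k)) (at t)"
      using 3 by (auto intro!: derivative_eq_intros simp: power2_eq_square divide_simps)
    moreover have "(exp (- (1 / t)) * (1 / t^2) * t ^ k - exp (- (1 / t)) * (real k * t ^ (k - 1))) / (t ^ k * t ^ k)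
        = flat_exp (k + 2) t - real k * flat_exp (k + 1) t"
      using 3 by (cases k) (auto simp: flat_exp_def field_simps power2_eq_square)
    ultimately have "((\<lambda>t. exp (- (1 / t)) / t ^ k) has_real_derivative
        flat_exp (k + 2) t - real k * flat_exp (k + 1) t) (at t)" by simp
    then show ?thesis
      by (rule has_field_derivative_transform_within_open[where S="{0<..}"])
        (use 3 in \<open>auto simp: flat_exp_def\<close>)
  next
    case 2
    \<comment> \<open>From the right the difference quotient of \<open>flat_exp k\<close> at 0 is
      \<open>flat_exp (Suc k)\<close>, which tends to 0; from the left it vanishes.\<close>
    have r: "((\<lambda>y. (flat_exp k y - flat_exp k 0) / (y - 0)) \<longlongrightarrow> 0) (at_right 0)"
      by (rule Lim_transform_eventually[OF flat_exp_tendsto_0[of "Suc k"]])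
        (auto simp: flat_exp_def eventually_at_filter field_simps intro!: always_eventually)
    have l: "((\<lambda>y. (flat_exp k y - flat_exp k 0) / (y - 0)) \<longlongrightarrow> 0) (at_left 0)"
      by (rule Lim_transform_eventually[OF tendsto_const])
        (auto simp: flat_exp_def eventually_at_filter intro!: always_eventually)
    have "(flat_exp k has_real_derivative 0) (at 0)"
      unfolding has_field_derivative_iff using filterlim_split_at[OF l r] by simp
    then show ?thesis using 2 by (simp add: flat_exp_def)
  qed
qed

lemma flat_exp_mono: assumes "s \<le> t" shows "flat_exp 0 s \<le> flat_exp 0 t"
  using assms by (auto simp: flat_exp_def frac_le)

lemma flat_exp_le_1: "flat_exp 0 t \<le> 1"
  by (auto simp: flat_exp_def)

text \<open>A class of functions that contains the bump, is stable under partial derivatives and,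
  for positive \<eta>, vanishes outside the ball. The factors \<open>(y - c) $ j\<close> are those
  that the chain rule produces from the squared distance. Membership gives derivatives of every
  order without writing them down.\<close>

inductive_set bump_space :: "real^'n::finite \<Rightarrow> real \<Rightarrow> (real^'n \<Rightarrow> real) set" for c \<eta> where
  base: "(\<lambda>y. flat_exp k (1 - ((y - c) \<bullet> (y - c)) / \<eta>\<^sup>2)) \<in> bump_space c \<eta>"
| coord: "f \<in> bump_space c \<eta> \<Longrightarrow> (\<lambda>y. (y - c) $ j * f y) \<in> bump_space c \<eta>"
| scale: "f \<in> bump_space c \<eta> \<Longrightarrow> (\<lambda>y. a * f y) \<in> bump_space c \<eta>"
| add: "f \<in> bump_space c \<eta> \<Longrightarrow> g \<in> bump_space c \<eta> \<Longrightarrow> (\<lambda>y. f y + g y) \<in> bump_space c \<eta>"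

lemma bump_space_derivative:
  assumes "f \<in> bump_space c \<eta>"
  shows "\<exists>f'. (\<forall>x. (f has_derivative f' x) (at x)) \<and> (\<forall>j. (\<lambda>x. f' x (axis j 1)) \<in> bump_space c \<eta>)"
  using assms
proof induction
  case (base k)
  let ?q = "\<lambda>y. 1 - ((y - c) \<bullet> (y - c)) / \<eta>\<^sup>2"
  let ?d = "\<lambda>x. flat_exp (k + 2) (?q x) - real k * flat_exp (k + 1) (?q x)"
  have q: "(?q has_derivative (\<lambda>v. - (2 * ((x - c) \<bullet> v)) / \<eta>\<^sup>2)) (at x)" for x
  proof -
    have "((\<lambda>y. 1 - inverse (\<eta>\<^sup>2) * ((y - c) \<bullet> (y - c))) has_derivative
        (\<lambda>v. - (inverse (\<eta>\<^sup>2) * (2 * ((x - c) \<bullet> v))))) (at x)"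
      by (auto intro!: derivative_eq_intros simp: inner_commute algebra_simps)
    then show ?thesis by (simp add: field_class.field_divide_inverse mult_ac)
  qed
  have "((\<lambda>y. flat_exp k (?q y)) has_derivative (\<lambda>v. (- (2 * ((x - c) \<bullet> v)) / \<eta>\<^sup>2) * ?d x)) (at x)" for x
    using has_derivative_compose[OF q has_field_derivative_imp_has_derivative[OF has_real_derivative_flat_exp]]
    by (simp add: mult.commute)
  moreover have "(\<lambda>x. (- (2 * ((x - c) \<bullet> axis j 1)) / \<eta>\<^sup>2) * ?d x) \<in> bump_space c \<eta>" for j
  proof -
    have "(\<lambda>x. flat_exp (k + 2) (?q x) + (- real k) * flat_exp (k + 1) (?q x)) \<in> bump_space c \<eta>"
      by (intro bump_space.intros)
    then have "(\<lambda>x. (- 2 / \<eta>\<^sup>2) * ((x - c) $ j * (flat_exp (k + 2) (?q x) + (- real k) * flat_exp (k + 1) (?q x)))) \<in> bump_space c \<eta>"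
      by (intro bump_space.scale bump_space.coord)
    moreover have "(\<lambda>x. (- 2 / \<eta>\<^sup>2) * ((x - c) $ j * (flat_exp (k + 2) (?q x) + (- real k) * flat_exp (k + 1) (?q x))))
        = (\<lambda>x. (- (2 * ((x - c) \<bullet> axis j 1)) / \<eta>\<^sup>2) * ?d x)"
      by (rule ext) (simp add: inner_axis divide_inverse algebra_simps)
    ultimately show ?thesis by simp
  qed
  ultimately show ?case
    by (intro exI[of _ "\<lambda>x v. (- (2 * ((x - c) \<bullet> v)) / \<eta>\<^sup>2) * ?d x"] conjI allI)
next
  case (coord f i)
  then obtain f' where f': "\<And>x. (f has_derivative f' x) (at x)"
    "\<And>j. (\<lambda>x. f' x (axis j 1)) \<in> bump_space c \<eta>" by blast
  have "((\<lambda>y. (y - c) $ i * f y) has_derivative (\<lambda>v. (x - c) $ i * f' x v + v $ i * f x)) (at x)" for x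
    by (auto intro!: derivative_eq_intros f'(1) bounded_linear.has_derivative[OF bounded_linear_vec_nth])
  moreover have "(\<lambda>x. (x - c) $ i * f' x (axis j 1) + axis j 1 $ i * f x) \<in> bump_space c \<eta>" for j
    by (intro bump_space.add bump_space.coord bump_space.scale f' coord)
  ultimately show ?case
    by (intro exI[of _ "\<lambda>x v. (x - c) $ i * f' x v + v $ i * f x"] conjI allI)
next
  case (scale f a)
  then obtain f' where f': "\<And>x. (f has_derivative f' x) (at x)"
    "\<And>j. (\<lambda>x. f' x (axis j 1)) \<in> bump_space c \<eta>" by blast
  have "((\<lambda>y. a * f y) has_derivative (\<lambda>v. a * f' x v)) (at x)" for x
    by (auto intro!: derivative_eq_intros f'(1))
  then show ?case using bump_space.scale[OF f'(2), of a]
    by (intro exI[of _ "\<lambda>x v. a * f' x v"] conjI allI)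
next
  case (add f g)
  then obtain f' g' where f': "\<And>x. (f has_derivative f' x) (at x)"
    "\<And>j. (\<lambda>x. f' x (axis j 1)) \<in> bump_space c \<eta>"
    and g': "\<And>x. (g has_derivative g' x) (at x)"
    "\<And>j. (\<lambda>x. g' x (axis j 1)) \<in> bump_space c \<eta>" by blast
  have "((\<lambda>y. f y + g y) has_derivative (\<lambda>v. f' x v + g' x v)) (at x)" for x
    by (auto intro!: derivative_eq_intros f'(1) g'(1))
  then show ?case using bump_space.add[OF f'(2) g'(2)]
    by (intro exI[of _ "\<lambda>x v. f' x v + g' x v"] conjI allI)
qed

lemma partial_eqI:
  assumes "(f has_derivative f') (at x)"
  shows "partial j f x = f' (axis j 1)"
  using frechet_derivative_at[OF assms] by (simp add: partial_def)

lemma bump_space_partial: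
  assumes "f \<in> bump_space c \<eta>" shows "partial j f \<in> bump_space c \<eta>"
proof -
  obtain f' where f': "\<And>x. (f has_derivative f' x) (at x)"
    "\<And>j. (\<lambda>x. f' x (axis j 1)) \<in> bump_space c \<eta>"
    using bump_space_derivative[OF assms] by blast
  have "partial j f = (\<lambda>x. f' x (axis j 1))"
    using partial_eqI[OF f'(1)] by blast
  then show ?thesis using f'(2) by simp
qed

lemma bump_space_differentiable:
  assumes "f \<in> bump_space c \<eta>" shows "f differentiable (at x)"
  using bump_space_derivative[OF assms] by (auto simp: differentiable_def)

lemma bump_space_continuous:
  assumes "f \<in> bump_space c \<eta>" shows "continuous_on S f"
  using bump_space_differentiable[OF assms]
  by (meson continuous_at_imp_continuous_on differentiable_imp_continuous_within)

lemma bump_space_Ck: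
  assumes "f \<in> bump_space c \<eta>" shows "Ck k f"
  using assms
proof (induction k arbitrary: f)
  case (Suc k)
  then show ?case by (simp add: bump_space_differentiable bump_space_partial)
qed (simp add: bump_space_continuous)

lemma bump_space_eq_0:
  assumes "f \<in> bump_space c \<eta>" "\<eta> > 0" "dist y c \<ge> \<eta>" shows "f y = 0"
  using assms
proof induction
  case (base k)
  have "\<eta>\<^sup>2 \<le> (norm (y - c))\<^sup>2"
    using base by (intro power_mono) (auto simp: dist_norm)
  then show ?case using base
    by (simp add: flat_exp_def dot_square_norm)
qed auto

lemma bump_space_test_function:
  assumes "f \<in> bump_space c \<eta>" "\<eta> > 0" "cball c \<eta> \<subseteq> U"
  shows "f \<in> test_functions U"
proof -
  have "{x. f x \<noteq> 0} \<subseteq> cball c \<eta>"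
    using bump_space_eq_0[OF assms(1,2)] by (force simp: dist_commute)
  then have "closure {x. f x \<noteq> 0} \<subseteq> cball c \<eta>"
    by (simp add: closure_minimal)
  moreover from this have "bounded {x. f x \<noteq> 0}"
    by (meson bounded_cball bounded_subset closure_subset)
  ultimately show ?thesis
    using assms bump_space_Ck[OF assms(1)] by (auto simp: test_functions_def compact_closure)
qed

definition bump :: "real^'n::finite \<Rightarrow> real \<Rightarrow> real^'n \<Rightarrow> real" where
  "bump c \<eta> y = flat_exp 0 (1 - ((y - c) \<bullet> (y - c)) / \<eta>\<^sup>2)"

lemma bump_in_bump_space: "bump c \<eta> \<in> bump_space c \<eta>"
  using bump_space.base[of 0 c \<eta>] unfolding bump_def[abs_def] .

lemma bump_nonneg: "0 \<le> bump c \<eta> y" and bump_le_1: "bump c \<eta> y \<le> 1"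
  by (simp_all add: bump_def flat_exp_nonneg flat_exp_le_1)

lemmas bump_eq_0 = bump_space_eq_0[OF bump_in_bump_space]
lemmas continuous_on_bump = bump_space_continuous[OF bump_in_bump_space]

lemma bump_lower:
  assumes "\<eta> > 0" "dist y c \<le> \<eta> / 2"
  shows "exp (- 2) \<le> bump c \<eta> y"
proof -
  have "(norm (y - c))\<^sup>2 \<le> (\<eta> / 2)\<^sup>2"
    using assms by (intro power_mono) (auto simp: dist_norm)
  then have "((y - c) \<bullet> (y - c)) / \<eta>\<^sup>2 \<le> (\<eta> / 2)\<^sup>2 / \<eta>\<^sup>2"
    by (intro divide_right_mono) (auto simp: dot_square_norm)
  \<comment> \<open>The quotient is 1/4. The cruder 1/2 leads to the lower bound
    \<open>flat_exp 0 (1 / 2) = exp (- 2)\<close>.\<close>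
  also have "\<dots> \<le> 1 / 2" using assms by (simp add: power_divide)
  finally have "1 / 2 \<le> 1 - ((y - c) \<bullet> (y - c)) / \<eta>\<^sup>2" by linarith
  from flat_exp_mono[OF this] show ?thesis
    by (simp add: bump_def flat_exp_def)
qed

lemma bump_integrable: 
  fixes c :: "real^'n::finite"
  assumes "\<eta> > 0" shows "integrable lebesgue (bump c \<eta>)"
proof -
  have "integrable lborel (\<lambda>x. indicator (cball c \<eta>) x *\<^sub>R bump c \<eta> x)"
    by (rule borel_integrable_compact[OF compact_cball continuous_on_bump])
  moreover have "(\<lambda>x. indicator (cball c \<eta>) x *\<^sub>R bump c \<eta> x) = bump c \<eta>"
    using bump_eq_0[OF assms] by (force simp: indicator_def dist_commute)
  ultimately show ?thesis
    using integrable_completion[of "bump c \<eta>" lborel] by auto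
qed

text \<open>The dimension enters only through the type, hence the argument of type
  \<open>itself\<close>. The bump is left unnormalised; its mass is carried along as a factor and
  cancelled at the end of each estimate.\<close>

definition bump_mass :: "'n::finite itself \<Rightarrow> real \<Rightarrow> real" where
  "bump_mass _ \<eta> = (LINT y|lebesgue. bump (0::real^'n) \<eta> y)"

lemma integral_bump:
  fixes c :: "real^'n::finite"
  shows "(LINT y|lebesgue. bump c \<eta> y) = bump_mass TYPE('n) \<eta>"
proof -
  have m[measurable]: "bump c \<eta> \<in> borel_measurable borel" for c :: "real^'n"
    by (intro borel_measurable_continuous_onI continuous_on_bump)
  have "(LINT y|lebesgue. bump c \<eta> y) = (LINT y|lborel. bump c \<eta> y)"
    by (rule integral_completion) simp
  also have "\<dots> = (LINT y|distr lborel borel ((+) c). bump c \<eta> y)"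
    by (simp add: lborel_distr_plus)
  also have "\<dots> = (LINT y|lborel. bump (0::real^'n) \<eta> y)"
  proof -
    have "bump c \<eta> (c + x) = bump 0 \<eta> x" for x by (simp add: bump_def)
    then show ?thesis by (subst integral_distr) simp_all
  qed
  also have "\<dots> = bump_mass TYPE('n) \<eta>"
    unfolding bump_mass_def by (rule integral_completion[symmetric]) simp
  finally show ?thesis .
qed

text \<open>The bump is at least \<open>exp (- 2)\<close> on the ball of radius \<eta> / 2. The
  differentiability proof needs such an explicit fraction of a ball's volume, since it compares an
  integral over a ball of comparable radius with this mass.\<close>

lemma bump_mass_lower:
  assumes "\<eta> > 0"
  shows "exp (- 2) * measure lborel (ball (0::real^'n::finite) 1) * (\<eta> / 2) ^ CARD('n) \<le> bump_mass TYPE('n) \<eta>"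
proof -
  have "exp (- 2) * measure lborel (ball (0::real^'n) (\<eta>/2)) = (LINT y|lebesgue. exp (- 2) * indicator (ball (0::real^'n) (\<eta>/2)) y)"
    by simp
  also have "\<dots> \<le> (LINT y|lebesgue. bump (0::real^'n) \<eta> y)"
  proof (rule integral_mono)
    show "integrable lebesgue (bump (0::real^'n) \<eta>)" by (rule bump_integrable[OF assms])
    show "integrable lebesgue (\<lambda>y. exp (- 2) * indicator (ball (0::real^'n) (\<eta>/2)) y :: real)"
      by (intro integrable_mult_right integrable_real_indicator) (use emeasure_lborel_ball_finite[of "0::real^'n"] in \<open>auto simp: top_unique less_top\<close>)
    show "exp (- 2) * indicator (ball (0::real^'n) (\<eta>/2)) y \<le> bump 0 \<eta> y" for y
      using bump_lower[OF assms, of y 0] bump_nonneg[of 0 \<eta> y]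
      by (auto simp: indicator_def dist_commute)
  qed
  finally show ?thesis
    using assms by (subst (asm) content_ball_conv_unit_ball) (auto simp: bump_mass_def mult_ac)
qed

lemma bump_mass_pos: "\<eta> > 0 \<Longrightarrow> bump_mass TYPE('n::finite) \<eta> > 0"
  by (rule less_le_trans[OF _ bump_mass_lower]) (auto intro!: mult_pos_pos content_ball_pos)

section \<open>Lebesgue points\<close>

lemma negligible_small_cover:
  assumes "\<And>e. e > 0 \<Longrightarrow> \<exists>T. S \<subseteq> T \<and> T \<in> sets lebesgue \<and> emeasure lebesgue T \<le> ennreal e"
  shows "negligible S"
proof (rule negligible_outer_le[THEN iffD2], intro allI impI)
  fix e :: real assume "e > 0"
  then obtain T where T: "S \<subseteq> T" "T \<in> sets lebesgue" "emeasure lebesgue T \<le> ennreal e"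
    using assms by blast
  then have "T \<in> lmeasurable"
    by (simp add: fmeasurable_def le_less_trans)
  moreover have "measure lebesgue T \<le> e"
    using T(3) \<open>e > 0\<close> by (simp add: measure_def enn2real_leI)
  ultimately show "\<exists>T. S \<subseteq> T \<and> T \<in> lmeasurable \<and> measure lebesgue T \<le> e"
    using T by blast
qed

text \<open>Absolute continuity of the integral, by truncation: \<open>F\<close> is at most
  \<open>max 0 (F - n) + n\<close>. The first summand has a small integral for large
  \<open>n\<close> by dominated convergence, the second is small on sets of small measure.\<close>

lemma integral_small_on_small_sets:
  fixes F :: "'a \<Rightarrow> real"
  assumes F: "integrable M F" and nn: "\<And>x. 0 \<le> F x" and "e > 0"
  obtains \<delta> where "\<delta> > 0" "\<And>E. E \<in> fmeasurable M \<Longrightarrow> measure M E < \<delta> \<Longrightarrow> (LINT x:E|M. F x) \<le> e"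
proof -
  have [measurable]: "F \<in> borel_measurable M" using F by auto
  have "(\<lambda>n. LINT x|M. max 0 (F x - real n)) \<longlonglongrightarrow> (LINT x|M. 0)"
  proof (rule integral_dominated_convergence[where w=F])
    show "AE x in M. (\<lambda>n. max 0 (F x - real n)) \<longlonglongrightarrow> 0"
    proof (rule AE_I2, rule tendsto_eventually)
      fix x
      obtain N where "F x \<le> real N" using real_arch_simple by blast
      then show "\<forall>\<^sub>F n in sequentially. max 0 (F x - real n) = 0"
        by (intro eventually_sequentiallyI[of N]) (simp add: max_def)
    qed
  qed (use F nn in auto)
  then have "\<forall>\<^sub>F n in sequentially. (LINT x|M. max 0 (F x - real n)) < e / 2"
    by (rule order_tendstoD) (use \<open>e > 0\<close> in simp)
  then obtain n where n: "(LINT x|M. max 0 (F x - real n)) < e / 2"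
    by (auto simp: eventually_sequentially)
  have int: "integrable M (\<lambda>x. max 0 (F x - real n))"
    by (rule Bochner_Integration.integrable_bound[OF F]) (use nn in \<open>auto simp: abs_if max_def\<close>)
  show thesis
  proof
    show "e / (2 * (real n + 1)) > 0" using \<open>e > 0\<close> by simp
    fix E assume E: "E \<in> fmeasurable M" "measure M E < e / (2 * (real n + 1))"
    have iE: "integrable M (\<lambda>x. indicator E x * real n)"
      using E by (auto simp: fmeasurable_def)
    have "(LINT x:E|M. F x) \<le> (LINT x|M. max 0 (F x - real n) + indicator E x * real n)"
      unfolding set_lebesgue_integral_def
    proof (rule integral_mono)
      show "integrable M (\<lambda>x. indicator E x *\<^sub>R F x)"
        using E F by (intro integrable_mult_indicator) auto
      show "integrable M (\<lambda>x. max 0 (F x - real n) + indicator E x * real n)"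
        using int iE by simp
    qed (auto simp: indicator_def)
    also have "\<dots> = (LINT x|M. max 0 (F x - real n)) + measure M E * real n"
      using int iE E by (subst Bochner_Integration.integral_add) (auto simp: fmeasurable_def)
    also have "measure M E * real n \<le> e / (2 * (real n + 1)) * (real n + 1)"
      using E \<open>e > 0\<close> by (intro mult_mono) auto
    also have "e / (2 * (real n + 1)) * (real n + 1) = e / 2" by (simp add: field_simps)
    finally show "(LINT x:E|M. F x) \<le> e" using n by simp
  qed
qed

text \<open>An open set \<open>T\<close> around the part of the ball where \<open>F < a\<close>
  exceeds it by so little that \<open>F\<close> has integral at most \<delta>' on the difference. By
  Vitali, disjoint balls inside \<open>T\<close> on which the average exceeds \<open>b\<close> cover
  almost all of the bad set. For the union D of finitely many of them, b |D| is at most a |D| +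
  \<delta>', so |D| is at most e / 2.\<close>

lemma Lebesgue_average_limsup_aux:
  fixes F :: "'a::euclidean_space \<Rightarrow> real"
  assumes F: "integrable lebesgue F" and nn: "\<And>x. 0 \<le> F x" and "a < b" "0 \<le> a"
  shows "negligible {x \<in> ball 0 R. F x < a \<and>
     (\<forall>d>0. \<exists>r. 0 < r \<and> r < d \<and> b * measure lebesgue (cball x r) < (LINT y:cball x r|lebesgue. F y))}"
    (is "negligible ?S")
proof (rule negligible_small_cover)
  fix e :: real assume "e > 0"
  define A where "A = {x \<in> ball 0 R. F x < a}"
  have [measurable]: "F \<in> borel_measurable lebesgue" using F by auto
  have A: "A \<in> sets lebesgue"
  proof -
    have "A = {x \<in> space lebesgue. F x < a} \<inter> ball 0 R" by (auto simp: A_def)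
    moreover have "{x \<in> space lebesgue. F x < a} \<in> sets lebesgue" by measurable
    moreover have "ball (0::'a) R \<in> sets lebesgue" by simp
    ultimately show ?thesis by (metis sets.Int)
  qed
  define \<delta>' where "\<delta>' = (b - a) * e / 2"
  have "\<delta>' > 0" using \<open>a < b\<close> \<open>e > 0\<close> by (simp add: \<delta>'_def)
  obtain \<delta> where "\<delta> > 0" and \<delta>: "\<And>E. E \<in> lmeasurable \<Longrightarrow> measure lebesgue E < \<delta> \<Longrightarrow>
      (LINT x:E|lebesgue. F x) \<le> \<delta>'"
    using integral_small_on_small_sets[OF F nn \<open>\<delta>' > 0\<close>] by blast
  define \<epsilon> where "\<epsilon> = min (\<delta> / 2) (e / 2)"
  have "\<epsilon> > 0" using \<open>\<delta> > 0\<close> \<open>e > 0\<close> by (simp add: \<epsilon>_def)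
  obtain T where T: "open T" "A \<subseteq> T" "T - A \<in> lmeasurable" "measure lebesgue (T - A) < \<epsilon>"
  proof -
    obtain T where "open T" "A \<subseteq> T" "T - A \<in> lmeasurable" "emeasure lebesgue (T - A) < ennreal \<epsilon>"
      using sets_lebesgue_outer_open[OF A \<open>\<epsilon> > 0\<close>] by blast
    then show thesis
      by (intro that[of T]) (auto simp: emeasure_eq_measure2 ennreal_less_iff)
  qed
  let ?K = "{(x, r). 0 < r \<and> cball x r \<subseteq> T \<and> b * measure lebesgue (cball x r) < (LINT y:cball x r|lebesgue. F y)}"
  obtain C where C: "countable C" "C \<subseteq> ?K"
    "pairwise (\<lambda>i j. disjnt (cball (fst i) (snd i)) (cball (fst j) (snd j))) C"
    "negligible (?S - (\<Union>i\<in>C. cball (fst i) (snd i)))"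
  proof (rule Vitali_covering_theorem_cballs[of ?K snd ?S fst])
    show "\<And>i. i \<in> ?K \<Longrightarrow> 0 < snd i" by auto
    fix x d assume x: "x \<in> ?S" and "0 < (d::real)"
    then have "x \<in> T" using T(2) by (auto simp: A_def)
    then obtain d' where d': "d' > 0" "cball x d' \<subseteq> T"
      using T(1) open_contains_cball by blast
    with x \<open>0 < d\<close> obtain r where "0 < r" "r < min d d'" "b * measure lebesgue (cball x r) < (LINT y:cball x r|lebesgue. F y)"
    proof -
      have "\<exists>r. 0 < r \<and> r < min d d' \<and> b * measure lebesgue (cball x r) < (LINT y:cball x r|lebesgue. F y)"
      proof -
        have "min d d' > 0" using \<open>0 < d\<close> d'(1) by simp
        with x show ?thesis by blast
      qed
      then show thesis using that by blast
    qed
    moreover from this have "cball x r \<subseteq> T" using d' by (meson less_imp_le min_less_iff_conj order_trans subset_cball)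
    ultimately show "\<exists>i. i \<in> ?K \<and> x \<in> cball (fst i) (snd i) \<and> snd i < d"
      by (intro exI[of _ "(x, r)"]) auto
  qed
  let ?B = "\<Union>i\<in>C. cball (fst i) (snd i)"
  have bound: "measure lebesgue (\<Union>i\<in>C'. cball (fst i) (snd i)) \<le> e" if C': "finite C'" "C' \<subseteq> C" for C'
  proof -
    let ?D = "\<Union>i\<in>C'. cball (fst i) (snd i)"
    have D: "?D \<in> lmeasurable" using C' by (intro fmeasurable.finite_UN) auto
    have dj: "disjoint_family_on (\<lambda>i. cball (fst i) (snd i)) C'"
      unfolding disjoint_family_on_def using C(3) C'(2) by (meson disjnt_def pairwiseD subsetD)
    have mD: "measure lebesgue ?D = (\<Sum>i\<in>C'. measure lebesgue (cball (fst i) (snd i)))"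
      using C'(1) dj by (intro measure_finite_Union) (auto simp: less_imp_neq[OF emeasure_lborel_cball_finite, unfolded infinity_ennreal_def])
    have si: "set_integrable lebesgue E F" if "E \<in> sets lebesgue" for E
      unfolding set_integrable_def by (rule integrable_mult_indicator[OF that F])
    have "b * measure lebesgue ?D = (\<Sum>i\<in>C'. b * measure lebesgue (cball (fst i) (snd i)))"
      by (simp add: mD sum_distrib_left)
    also have "\<dots> \<le> (\<Sum>i\<in>C'. (LINT y:cball (fst i) (snd i)|lebesgue. F y))"
      using C(2) C'(2) by (intro sum_mono) (auto intro: less_imp_le)
    also have "\<dots> = (LINT y:?D|lebesgue. F y)"
      using C'(1) dj by (subst set_integral_finite_Union) (auto intro: si)
    also have "\<dots> \<le> (LINT y:?D \<inter> A|lebesgue. F y) + (LINT y:T - A|lebesgue. F y)"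
    proof -
      have "cball (fst i) (snd i) \<subseteq> T" if "i \<in> C'" for i
      proof -
        have "i \<in> ?K" using C(2) C'(2) that by blast
        then show ?thesis by (simp add: case_prod_beta)
      qed
      then have "?D \<subseteq> T" by blast
      have "(LINT y:?D|lebesgue. F y) \<le> (LINT y:(?D \<inter> A) \<union> (T - A)|lebesgue. F y)"
        unfolding set_lebesgue_integral_def
      proof (rule integral_mono)
        show "integrable lebesgue (\<lambda>x. indicator ?D x *\<^sub>R F x)"
          using si[of ?D] D by (simp only: set_integrable_def fmeasurableD)
        have "?D \<inter> A \<union> (T - A) \<in> sets lebesgue" using D A T(3) by (intro sets.Un sets.Int) auto
        then show "integrable lebesgue (\<lambda>x. indicator (?D \<inter> A \<union> (T - A)) x *\<^sub>R F x)"
          using si by (simp only: set_integrable_def)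
        show "indicator ?D x *\<^sub>R F x \<le> indicator (?D \<inter> A \<union> (T - A)) x *\<^sub>R F x" for x
          using nn[of x] subsetD[OF \<open>?D \<subseteq> T\<close>, of x] by (intro scaleR_right_mono) (auto simp: indicator_def)
      qed
      also have "\<dots> = (LINT y:?D \<inter> A|lebesgue. F y) + (LINT y:T - A|lebesgue. F y)"
        using D A T(3) by (intro set_integral_Un si) auto
      finally show ?thesis .
    qed
    also have "(LINT y:?D \<inter> A|lebesgue. F y) \<le> a * measure lebesgue ?D"
    proof -
      have fin: "?D \<inter> A \<in> lmeasurable" using D A by (intro fmeasurableI2[OF D]) auto
      have "(LINT y:?D \<inter> A|lebesgue. F y) \<le> (LINT y:?D \<inter> A|lebesgue. a)"
        unfolding set_lebesgue_integral_def
      proof (rule integral_mono)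
        show "integrable lebesgue (\<lambda>x. indicator (?D \<inter> A) x *\<^sub>R F x)"
          using si[of "?D \<inter> A"] fin by (simp only: set_integrable_def fmeasurableD)
        show "integrable lebesgue (\<lambda>x. indicator (?D \<inter> A) x *\<^sub>R a)"
          using fin by (intro integrable_scaleR_left) (auto simp: fmeasurable_def)
      qed (auto simp: indicator_def A_def)
      also have "\<dots> = a * measure lebesgue (?D \<inter> A)"
        using fin by (simp add: set_lebesgue_integral_def)
      also have "\<dots> \<le> a * measure lebesgue ?D"
        using D A \<open>0 \<le> a\<close> by (intro mult_left_mono measure_mono_fmeasurable) auto
      finally show ?thesis .
    qed
    also have "(LINT y:T - A|lebesgue. F y) \<le> \<delta>'"
      using \<delta>[of "T - A"] T \<epsilon>_def \<open>\<delta> > 0\<close> by (force simp: fmeasurable_def)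
    finally have "b * measure lebesgue ?D \<le> a * measure lebesgue ?D + \<delta>'" by simp
    moreover have "(b - a) * (e / 2) = \<delta>'" by (simp add: \<delta>'_def)
    ultimately have "(b - a) * measure lebesgue ?D \<le> (b - a) * (e / 2)"
      unfolding left_diff_distrib[of b a "measure lebesgue ?D"] by linarith
    then show ?thesis using \<open>a < b\<close> \<open>e > 0\<close> by simp
  qed
  have "?B \<in> lmeasurable" "measure lebesgue ?B \<le> e"
    using fmeasurable_UN_bound[of C "\<lambda>i. cball (fst i) (snd i)" lebesgue e]
      measure_UN_bound[of C "\<lambda>i. cball (fst i) (snd i)" lebesgue e] bound C(1) by auto
  then have "emeasure lebesgue ?B \<le> ennreal e"
    by (simp add: emeasure_eq_measure2 ennreal_leI)
  moreover have "emeasure lebesgue (?B \<union> (?S - ?B)) \<le> emeasure lebesgue ?B + 0"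
    using C(4) \<open>?B \<in> lmeasurable\<close>
    by (intro order_trans[OF emeasure_subadditive] add_mono) (auto simp: negligible_iff_null_sets)
  moreover have "?B \<union> (?S - ?B) \<in> sets lebesgue"
    using C(4) \<open>?B \<in> lmeasurable\<close> by (intro sets.Un) (auto simp: negligible_iff_null_sets)
  ultimately show "\<exists>T. ?S \<subseteq> T \<and> T \<in> sets lebesgue \<and> emeasure lebesgue T \<le> ennreal e"
    by (intro exI[of _ "?B \<union> (?S - ?B)"]) auto
qed

text \<open>The averages of \<open>norm (g y - q)\<close> are treated for \<open>q\<close> in a
  countable dense set and rational \<open>a < b\<close>, so the exceptional set is a countable union
  of null sets. Given \<open>x\<close>, choose \<open>q\<close> close to \<open>g x\<close>;
  replacing \<open>g x\<close> by \<open>q\<close> costs at most \<open>e / 4\<close>. The cut-off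
  to radius \<open>R + 1\<close> is not seen by balls of radius below 1 around points of the ball of
  radius \<open>R\<close>.\<close>

lemma Lebesgue_points_integrable:
  fixes g :: "'a::euclidean_space \<Rightarrow> 'b::euclidean_space"
  assumes g: "integrable lebesgue g"
  shows "AE x in lebesgue. \<forall>e>0. \<exists>d>0. \<forall>r. 0 < r \<and> r < d \<longrightarrow>
           (LINT y:cball x r|lebesgue. norm (g y - g x)) \<le> e * measure lebesgue (cball x r)"
proof -
  obtain D :: "'b set" where D: "countable D" "\<And>S. open S \<Longrightarrow> S \<noteq> {} \<Longrightarrow> \<exists>q\<in>D. q \<in> S"
    using countable_dense_exists by blast
  have [measurable]: "g \<in> borel_measurable lebesgue" using g by auto
  define F where "F q R y = norm (g y - q) * indicator (ball 0 (real R + 1)) y" for q R and y :: 'a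
  define bad where "bad q R a b = {x \<in> ball 0 (real R). F q R x < a \<and>
     (\<forall>d>0. \<exists>r. 0 < r \<and> r < d \<and> b * measure lebesgue (cball x r) < (LINT y:cball x r|lebesgue. F q R y))}" for q R a b
  have ball_m[measurable]: "ball (0::'a) r \<in> sets lebesgue" for r by auto
  have fin: "integrable lebesgue (\<lambda>y. indicator S y *\<^sub>R q)" if "S \<in> lmeasurable" for S and q :: 'b
    using that by (intro integrable_scaleR_left) (auto simp: fmeasurable_def)
  have intF: "integrable lebesgue (F q R)" for q R
  proof -
    have "integrable lebesgue (\<lambda>y. indicator (ball 0 (real R + 1)) y *\<^sub>R g y - indicator (ball 0 (real R + 1)) y *\<^sub>R q)"
      by (intro Bochner_Integration.integrable_diff integrable_mult_indicator g fin) auto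
    from integrable_norm[OF this] show ?thesis
      by (rule Bochner_Integration.integrable_cong[THEN iffD1, rotated -1]) (auto simp: F_def indicator_def)
  qed
  have "negligible (bad q R a b)" if "0 \<le> a" "a < b" for q R a b
    unfolding bad_def by (rule Lebesgue_average_limsup_aux[OF intF]) (use that in \<open>auto simp: F_def\<close>)
  then have "negligible (\<Union>(q, R, a, b) \<in> D \<times> (UNIV::nat set) \<times> (SIGMA a:\<rat> \<inter> {0..}. \<rat> \<inter> {a<..}). bad q R a b)"
    using D(1) by (intro negligible_countable_Union countable_image countable_SIGMA)
      (auto intro: countable_subset[OF _ countable_rat])
  then have N: "AE x in lebesgue. x \<notin> (\<Union>(q, R, a, b) \<in> D \<times> (UNIV::nat set) \<times> (SIGMA a:\<rat> \<inter> {0..}. \<rat> \<inter> {a<..}). bad q R a b)"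
    unfolding negligible_iff_null_sets by (rule AE_not_in)
  show ?thesis
  proof (rule AE_mp[OF N], rule AE_I2, intro impI allI)
    fix x e assume x: "x \<notin> (\<Union>(q, R, a, b) \<in> D \<times> (UNIV::nat set) \<times> (SIGMA a:\<rat> \<inter> {0..}. \<rat> \<inter> {a<..}). bad q R a b)"
      and "(e::real) > 0"
    obtain q where q: "q \<in> D" "norm (g x - q) < e / 4"
      using D(2)[of "ball (g x) (e / 4)"] \<open>e > 0\<close> by (auto simp: dist_norm)
    obtain a where a: "a \<in> \<rat>" "norm (g x - q) < a" "a < e / 4"
      using Rats_dense_in_real[OF q(2)] by blast
    obtain b where b: "b \<in> \<rat>" "a < b" "b < e / 2"
      using Rats_dense_in_real[of a "e / 2"] a \<open>e > 0\<close> by auto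
    obtain R :: nat where R: "norm x < R" using reals_Archimedean2 by blast
    have "0 \<le> a" using a(2) norm_ge_zero[of "g x - q"] by linarith
    then have "x \<notin> bad q R a b" using x q a b by blast
    moreover have "F q R x < a" using a R by (simp add: F_def indicator_def)
    ultimately obtain d where d: "d > 0"
      "\<And>r. 0 < r \<Longrightarrow> r < d \<Longrightarrow> (LINT y:cball x r|lebesgue. F q R y) \<le> b * measure lebesgue (cball x r)"
      using R unfolding bad_def by (force simp: not_less)
    show "\<exists>d>0. \<forall>r. 0 < r \<and> r < d \<longrightarrow>
           (LINT y:cball x r|lebesgue. norm (g y - g x)) \<le> e * measure lebesgue (cball x r)"
    proof (intro exI[of _ "min d 1"] conjI allI impI)
      show "min d 1 > 0" using d by simp
      fix r assume r: "0 < r \<and> r < min d 1"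
      have sub: "cball x r \<subseteq> ball 0 (real R + 1)"
      proof
        fix y assume "y \<in> cball x r"
        then have "norm (y - x) \<le> r" by (simp add: dist_norm norm_minus_commute)
        then show "y \<in> ball 0 (real R + 1)"
          using norm_triangle_sub[of y x] R r by simp
      qed
      have i0: "integrable lebesgue (\<lambda>y. indicator (cball x r) y *\<^sub>R norm (g y - g x))"
      proof -
        have "integrable lebesgue (\<lambda>y. indicator (cball x r) y *\<^sub>R g y - indicator (cball x r) y *\<^sub>R g x)"
          by (intro Bochner_Integration.integrable_diff integrable_mult_indicator g fin) auto
        from integrable_norm[OF this] show ?thesis
          by (rule Bochner_Integration.integrable_cong[THEN iffD1, rotated -1]) (auto simp: indicator_def)
      qed
      have i1: "integrable lebesgue (\<lambda>y. indicator (cball x r) y *\<^sub>R F q R y)"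
        by (intro integrable_mult_indicator intF) auto
      have i2: "integrable lebesgue (\<lambda>y. indicator (cball x r) y * norm (g x - q))"
        using lmeasurable_cball[of x r] by (auto simp: fmeasurable_def)
      have "(LINT y:cball x r|lebesgue. norm (g y - g x)) \<le>
          (LINT y|lebesgue. indicator (cball x r) y *\<^sub>R F q R y + indicator (cball x r) y * norm (g x - q))"
        unfolding set_lebesgue_integral_def
      proof (rule integral_mono[OF i0])
        show "integrable lebesgue (\<lambda>y. indicator (cball x r) y *\<^sub>R F q R y + indicator (cball x r) y * norm (g x - q))"
          by (rule Bochner_Integration.integrable_add[OF i1 i2])
        show "indicator (cball x r) y *\<^sub>R norm (g y - g x) \<le> indicator (cball x r) y *\<^sub>R F q R y + indicator (cball x r) y * norm (g x - q)" for y
          using sub norm_triangle_ineq4[of "g y - q" "g x - q"] by (auto simp: indicator_def F_def)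
      qed
      also have "\<dots> = (LINT y:cball x r|lebesgue. F q R y) + measure lebesgue (cball x r) * norm (g x - q)"
        unfolding set_lebesgue_integral_def using i1 i2 by simp
      also have "\<dots> \<le> b * measure lebesgue (cball x r) + measure lebesgue (cball x r) * (e / 4)"
        using d(2)[of r] r q(2) by (intro add_mono mult_left_mono) auto
      also have "\<dots> = (b + e / 4) * measure lebesgue (cball x r)" by (simp add: algebra_simps)
      also have "\<dots> \<le> e * measure lebesgue (cball x r)"
        using b \<open>e > 0\<close> by (intro mult_right_mono) auto
      finally show "(LINT y:cball x r|lebesgue. norm (g y - g x)) \<le> e * measure lebesgue (cball x r)" .
    qed
  qed
qed

text \<open>Integrability on small balls is part of the notion because a non-integrable function has
  integral 0 by convention; the bound on the mean oscillation would then say nothing.\<close>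

definition Lebesgue_point :: "'a::euclidean_space set \<Rightarrow> ('a \<Rightarrow> 'b::euclidean_space) \<Rightarrow> 'a \<Rightarrow> bool" where
  "Lebesgue_point U g x \<longleftrightarrow> (\<forall>e>0. \<exists>d>0. \<forall>r. 0 < r \<and> r < d \<longrightarrow>
     cball x r \<subseteq> U \<and> set_integrable lebesgue (cball x r) g \<and>
     (LINT y:cball x r|lebesgue. norm (g y - g x)) \<le> e * measure lebesgue (cball x r))"

text \<open>Near each point of \<open>U\<close> the function agrees with its cut-off to some member
  of a compact exhaustion, and the cut-off is integrable on the whole space.\<close>

lemma Lebesgue_points_locally_integrable:
  fixes g :: "real^'n::finite \<Rightarrow> 'b::euclidean_space"
  assumes U: "open U" and g: "locally_integrable_on g U"
  shows "AE x in lebesgue. x \<in> U \<longrightarrow> Lebesgue_point U g x"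
proof -
  obtain C where C: "\<And>n. compact (C n)" "\<And>n. C n \<subseteq> U" "\<Union>(range C) = U" "\<And>n. C n \<subseteq> interior (C (Suc n))"
    using open_Union_compact_subsets[OF U] by metis
  have i: "integrable lebesgue (\<lambda>x. indicator (C n) x *\<^sub>R g x)" for n
    using g C(1,2) by (subst integrable_restrict_space[symmetric])
      (auto simp: locally_integrable_on_def intro!: fmeasurableD lmeasurable_compact)
  have "AE x in lebesgue. \<forall>n. \<forall>e>0. \<exists>d>0. \<forall>r. 0 < r \<and> r < d \<longrightarrow>
           (LINT y:cball x r|lebesgue. norm (indicator (C n) y *\<^sub>R g y - indicator (C n) x *\<^sub>R g x)) \<le> e * measure lebesgue (cball x r)"
    unfolding AE_all_countable by (intro allI Lebesgue_points_integrable i)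
  then show ?thesis
    unfolding Lebesgue_point_def
  proof (rule AE_mp, intro AE_I2 impI allI)
    fix x e
    assume *: "\<forall>n. \<forall>e>0. \<exists>d>0. \<forall>r. 0 < r \<and> r < d \<longrightarrow>
           (LINT y:cball x r|lebesgue. norm (indicator (C n) y *\<^sub>R g y - indicator (C n) x *\<^sub>R g x)) \<le> e * measure lebesgue (cball x r)"
      and x: "x \<in> U" and e: "(e::real) > 0"
    obtain n where n: "x \<in> interior (C n)" using C(3,4) x by blast
    then obtain d1 where d1: "d1 > 0" "cball x d1 \<subseteq> C n"
      by (meson mem_interior_cball)
    obtain d where d: "d > 0" "\<And>r. 0 < r \<Longrightarrow> r < d \<Longrightarrow>
           (LINT y:cball x r|lebesgue. norm (indicator (C n) y *\<^sub>R g y - indicator (C n) x *\<^sub>R g x)) \<le> e * measure lebesgue (cball x r)"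
      using * e by meson
    show "\<exists>d>0. \<forall>r. 0 < r \<and> r < d \<longrightarrow> cball x r \<subseteq> U \<and> set_integrable lebesgue (cball x r) g \<and>
           (LINT y:cball x r|lebesgue. norm (g y - g x)) \<le> e * measure lebesgue (cball x r)"
    proof (intro exI[of _ "min d d1"] conjI allI impI)
      show "min d d1 > 0" using d d1 by simp
      fix r assume r: "0 < r \<and> r < min d d1"
      then have sub: "cball x r \<subseteq> C n" using d1 by (meson less_imp_le min_less_iff_conj order_trans subset_cball)
      then show "cball x r \<subseteq> U" using C(2) by blast
      have "set_integrable lebesgue (C n) g" using i by (simp add: set_integrable_def)
      then show "set_integrable lebesgue (cball x r) g"
        by (rule set_integrable_subset) (use sub in auto)
      have "(LINT y:cball x r|lebesgue. norm (g y - g x)) =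
          (LINT y:cball x r|lebesgue. norm (indicator (C n) y *\<^sub>R g y - indicator (C n) x *\<^sub>R g x))"
        using sub r by (intro set_lebesgue_integral_cong) (auto simp: subset_iff)
      also have "\<dots> \<le> e * measure lebesgue (cball x r)"
        using d(2)[of r] r by simp
      finally show "(LINT y:cball x r|lebesgue. norm (g y - g x)) \<le> e * measure lebesgue (cball x r)" .
    qed
  qed
qed

section \<open>Smoothing a function with a weak gradient\<close>

text \<open>One row of \<open>has_weak_jacobian\<close>. The function itself is continuous wherever
  increments are estimated, so only the gradient carries an integrability condition.\<close>

definition weak_gradient :: "(real^'n::finite \<Rightarrow> real) \<Rightarrow> (real^'n \<Rightarrow> real^'n) \<Rightarrow> (real^'n) set \<Rightarrow> bool" where
  "weak_gradient f g U \<longleftrightarrow> locally_integrable_on g U \<and>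
     (\<forall>\<phi>\<in>test_functions U. \<forall>j.
        (LINT x|lebesgue_on U. f x * partial j \<phi> x) = - (LINT x|lebesgue_on U. g x $ j * \<phi> x))"

lemma weak_gradient_component:
  assumes "has_weak_jacobian u G U"
  shows "weak_gradient (\<lambda>x. u x $ i) (\<lambda>x. G x $ i) U"
proof -
  have "locally_integrable_on (\<lambda>x. G x $ i) U"
    using assms unfolding has_weak_jacobian_def locally_integrable_on_def
    by (auto intro: integrable_bounded_linear[OF bounded_linear_vec_nth])
  then show ?thesis
    using assms by (auto simp: has_weak_jacobian_def weak_gradient_def)
qed

lemma integral_lebesgue_on_support:
  fixes h :: "'a::euclidean_space \<Rightarrow> real"
  assumes "U \<in> sets lebesgue" "S \<subseteq> U" "\<And>x. x \<notin> S \<Longrightarrow> h x = 0"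
  shows "(LINT x|lebesgue_on U. h x) = (LINT x:S|lebesgue. h x)"
  using assms(2,3) unfolding set_lebesgue_integral_def
  by (subst integral_restrict_space) (auto simp: assms(1) indicator_def intro!: Bochner_Integration.integral_cong)

lemma set_integrable_continuous_compact:
  fixes h :: "'a::euclidean_space \<Rightarrow> 'b::euclidean_space"
  assumes "compact S" "continuous_on S h"
  shows "set_integrable lebesgue S h"
proof -
  have "integrable lborel (\<lambda>x. indicator S x *\<^sub>R h x)"
    by (rule borel_integrable_compact[OF assms])
  then show ?thesis
    using integrable_completion[of "\<lambda>x. indicator S x *\<^sub>R h x" lborel] by (auto simp: set_integrable_def)
qed

lemma locally_integrable_on_compact:
  assumes "locally_integrable_on g U" "compact K" "K \<subseteq> U"
  shows "set_integrable lebesgue K g"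
  using assms unfolding locally_integrable_on_def set_integrable_def
  by (subst integrable_restrict_space[symmetric]) (auto intro!: fmeasurableD lmeasurable_compact)

lemma integral_cbox_support:
  fixes h :: "real^'n::finite \<Rightarrow> real"
  assumes "continuous_on (cbox a b) h" "S \<subseteq> cbox a b" "\<And>x. x \<notin> S \<Longrightarrow> h x = 0"
  shows "integral (cbox a b) h = (LINT x:S|lebesgue. h x)"
proof -
  have "set_integrable lebesgue (cbox a b) h"
    by (rule set_integrable_continuous_compact[OF compact_cbox assms(1)])
  then have "integral (cbox a b) h = (LINT x:cbox a b|lebesgue. h x)"
    by (rule set_lebesgue_integral_eq_integral(2)[symmetric])
  also have "\<dots> = (LINT x:S|lebesgue. h x)"
    using assms(2,3) unfolding set_lebesgue_integral_def
    by (intro Bochner_Integration.integral_cong) (auto simp: indicator_def)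
  finally show ?thesis .
qed

lemma partial_bump_translate:
  fixes c :: "real^'n::finite"
  shows "partial j (bump c \<eta>) y = partial j (bump 0 \<eta>) (y - c)"
proof -
  obtain f' where f': "\<And>x. (bump (0::real^'n) \<eta> has_derivative f' x) (at x)"
    using bump_space_derivative[OF bump_in_bump_space[of 0 \<eta>]] by blast
  have "((\<lambda>y. bump 0 \<eta> (y - c)) has_derivative (\<lambda>v. f' (y - c) v)) (at y)"
    by (rule has_derivative_compose[OF _ f']) (auto intro!: derivative_eq_intros)
  then have "(bump c \<eta> has_derivative f' (y - c)) (at y)"
    by (simp add: bump_def[abs_def])
  from partial_eqI[OF this] partial_eqI[OF f'] show ?thesis by metis
qed

lemma continuous_on_partial_bump: "continuous_on S (partial j (bump c \<eta>))"
  by (rule bump_space_continuous[OF bump_space_partial[OF bump_in_bump_space]])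

lemma bump_outside: "\<eta> > 0 \<Longrightarrow> y \<notin> cball c \<eta> \<Longrightarrow> bump c \<eta> y = 0"
  by (rule bump_eq_0) (auto simp: dist_commute)

lemma partial_bump_outside: "\<eta> > 0 \<Longrightarrow> y \<notin> cball c \<eta> \<Longrightarrow> partial j (bump c \<eta>) y = 0"
  by (rule bump_space_eq_0[OF bump_space_partial[OF bump_in_bump_space]]) (auto simp: dist_commute)

text \<open>Moving the centre along \<open>v\<close> differentiates the bump in \<open>y\<close>
  with the opposite sign. This is what lets the weak gradient of \<open>f\<close> appear when
  \<open>smoothed f\<close> is differentiated.\<close>

lemma derivative_bump_centre:
  fixes c :: "real^'n::finite"
  shows "((\<lambda>t. bump (c + t *\<^sub>R v) \<eta> y) has_real_derivative
      - (\<Sum>j\<in>UNIV. v $ j * partial j (bump (c + t *\<^sub>R v) \<eta>) y)) (at t within T)"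
proof -
  obtain f' where f': "\<And>x. (bump (0::real^'n) \<eta> has_derivative f' x) (at x)"
    using bump_space_derivative[OF bump_in_bump_space[of 0 \<eta>]] by blast
  let ?z = "y - (c + t *\<^sub>R v)"
  have lin: "linear (f' ?z)" using f' has_derivative_linear by blast
  have "((\<lambda>t. bump 0 \<eta> (y - (c + t *\<^sub>R v))) has_derivative (\<lambda>s. f' ?z (- (s *\<^sub>R v)))) (at t within T)"
    by (rule has_derivative_compose[OF _ f']) (auto intro!: derivative_eq_intros)
  moreover have *: "f' ?z (- (s *\<^sub>R v)) = - (\<Sum>j\<in>UNIV. v $ j * partial j (bump (c + t *\<^sub>R v) \<eta>) y) * s" for s
  proof -
    have "f' ?z v = f' ?z (\<Sum>j\<in>UNIV. v $ j *\<^sub>R axis j 1)"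
      by (simp add: basis_expansion flip: scalar_mult_eq_scaleR)
    also have "\<dots> = (\<Sum>j\<in>UNIV. v $ j * f' ?z (axis j 1))"
      by (simp add: linear_sum[OF lin] linear_cmul[OF lin])
    also have "\<dots> = (\<Sum>j\<in>UNIV. v $ j * partial j (bump (c + t *\<^sub>R v) \<eta>) y)"
      using partial_eqI[OF f'] partial_bump_translate by metis
    finally show ?thesis
      by (simp add: linear_neg[OF lin] linear_cmul[OF lin])
  qed
  ultimately have "((\<lambda>t. bump 0 \<eta> (y - (c + t *\<^sub>R v))) has_derivative
      (*) (- (\<Sum>j\<in>UNIV. v $ j * partial j (bump (c + t *\<^sub>R v) \<eta>) y))) (at t within T)"
    by (simp only: ext[of "\<lambda>s. f' ?z (- (s *\<^sub>R v))" "(*) (- (\<Sum>j\<in>UNIV. v $ j * partial j (bump (c + t *\<^sub>R v) \<eta>) y))", OF *])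
  moreover have "(\<lambda>t. bump (c + t *\<^sub>R v) \<eta> y) = (\<lambda>t. bump 0 \<eta> (y - (c + t *\<^sub>R v)))"
    by (simp add: bump_def)
  ultimately show ?thesis
    by (simp only: has_field_derivative_def)
qed

text \<open>The convolution of \<open>f\<close> with a bump is \<open>smoothed f \<eta> c\<close> divided by \<open>bump_mass \<eta>\<close>.\<close>
definition smoothed :: "(real^'n::finite \<Rightarrow> real) \<Rightarrow> real \<Rightarrow> real^'n \<Rightarrow> real" where
  "smoothed f \<eta> c = (LINT y:cball c \<eta>|lebesgue. f y * bump c \<eta> y)"

text \<open>The mean value theorem on the segment from \<open>c\<close> to \<open>c + v\<close>,
  followed by the definition of the weak gradient at the intermediate point. The vector
  \<open>A\<close> is free: 0 yields the Lipschitz bound, and the value of \<open>g\<close> at a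
  Lebesgue point yields differentiability there.\<close>

lemma smoothed_increment:
  fixes f :: "real^'n::finite \<Rightarrow> real"
  assumes U: "open U" and f: "continuous_on U f" and wg: "weak_gradient f g U"
    and "\<eta> > 0" and box: "cbox a b \<subseteq> U"
    and seg: "\<And>t. t \<in> {0..1} \<Longrightarrow> cball (c + t *\<^sub>R v) \<eta> \<subseteq> cbox a b"
  obtains \<tau> where "\<tau> \<in> {0..1}"
    "smoothed f \<eta> (c + v) - smoothed f \<eta> c - bump_mass TYPE('n) \<eta> * (A \<bullet> v)
       = (LINT y:cball (c + \<tau> *\<^sub>R v) \<eta>|lebesgue. ((g y - A) \<bullet> v) * bump (c + \<tau> *\<^sub>R v) \<eta> y)"
proof -
  \<comment> \<open>Integrating over a fixed box instead of the moving ball makes the domain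
    independent of \<open>t\<close>, as differentiation under the integral requires; the bump
    vanishes outside the ball.\<close>
  define \<psi> where "\<psi> t = integral (cbox a b) (\<lambda>y. f y * bump (c + t *\<^sub>R v) \<eta> y)" for t
  have fb: "continuous_on (cbox a b) f" using f box continuous_on_subset by blast
  let ?d = "\<lambda>t y. f y * - (\<Sum>j\<in>UNIV. v $ j * partial j (bump (c + t *\<^sub>R v) \<eta>) y)"
  have c1: "continuous_on (cbox a b) (\<lambda>y. f y * bump (c + t *\<^sub>R v) \<eta> y)" for t
    by (intro continuous_intros fb continuous_on_bump)
  have der: "(\<psi> has_field_derivative integral (cbox a b) (?d t)) (at t within {0..1})" if "t \<in> {0..1}" for t
    unfolding \<psi>_def
  proof (rule leibniz_rule_field_derivative)
    show "((\<lambda>t. f y * bump (c + t *\<^sub>R v) \<eta> y) has_field_derivative ?d t y) (at t within {0..1})" for t y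
      by (rule DERIV_cmult[OF derivative_bump_centre])
    show "(\<lambda>y. f y * bump (c + t *\<^sub>R v) \<eta> y) integrable_on cbox a b" for t
      by (rule integrable_continuous[OF c1])
    have "continuous_on ({0..1} \<times> cbox a b) (\<lambda>x. f (snd x) * - (\<Sum>j\<in>UNIV. v $ j * partial j (bump 0 \<eta>) (snd x - (c + fst x *\<^sub>R v))))"
      by (intro continuous_intros continuous_on_compose2[OF fb] continuous_on_compose2[OF continuous_on_partial_bump[of UNIV]]) auto
    then show "continuous_on ({0..1} \<times> cbox a b) (\<lambda>(t, y). ?d t y)"
      by (simp add: case_prod_beta partial_bump_translate[of _ "c + _ *\<^sub>R v"])
  qed (use that in auto)
  define I where "I t = integral (cbox a b) (?d t)" for t
  have der': "(\<psi> has_field_derivative I t) (at t within {0..1})" if "t \<in> {0..1}" for t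
    unfolding I_def by (rule der[OF that])
  obtain \<tau> where \<tau>: "\<tau> \<in> {0<..<1}" "\<psi> 1 - \<psi> 0 = integral (cbox a b) (?d \<tau>)"
  proof -
    have "\<exists>\<tau>\<in>{0<..<1}. \<psi> 1 - \<psi> 0 = (*) (I \<tau>) (1 - 0)"
    proof (rule mvt[of 0 1 \<psi> "\<lambda>\<tau>. (*) (I \<tau>)"])
      show "continuous_on {0..1} \<psi>"
        using der' by (meson DERIV_continuous continuous_on_eq_continuous_within)
      show "(\<psi> has_derivative (*) (I t)) (at t)" if "0 < t" "t < 1" for t
        using der'[of t] that
        by (simp add: has_field_derivative_def at_within_interior[of t "{0..1}"])
    qed auto
    then show thesis using that by (auto simp: I_def)
  qed
  let ?c = "c + \<tau> *\<^sub>R v"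
  have \<tau>01: "\<tau> \<in> {0..1}" using \<tau> by auto
  have sub: "cball ?c \<eta> \<subseteq> cbox a b" "cball ?c \<eta> \<subseteq> U" using seg[OF \<tau>01] box by auto
  have psi: "\<psi> t = smoothed f \<eta> (c + t *\<^sub>R v)" if "t \<in> {0..1}" for t
    unfolding \<psi>_def smoothed_def
    using seg[OF that] bump_outside[OF \<open>\<eta> > 0\<close>]
    by (intro integral_cbox_support c1) auto
  have gi: "set_integrable lebesgue (cball ?c \<eta>) g"
    using wg sub(2) by (auto simp: weak_gradient_def intro: locally_integrable_on_compact)
  have gbi: "set_integrable lebesgue (cball ?c \<eta>) (\<lambda>y. (g y \<bullet> w) * bump ?c \<eta> y)" for w
  proof -
    have [measurable]: "bump ?c \<eta> \<in> borel_measurable lebesgue"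
      using bump_integrable[OF \<open>\<eta> > 0\<close>] by auto
    have m[measurable]: "(\<lambda>y. indicator (cball ?c \<eta>) y *\<^sub>R g y) \<in> borel_measurable lebesgue"
      using gi by (auto simp: set_integrable_def)
    have "integrable lebesgue (\<lambda>y. ((indicator (cball ?c \<eta>) y *\<^sub>R g y) \<bullet> w) * bump ?c \<eta> y)"
    proof (rule Bochner_Integration.integrable_bound)
      show "integrable lebesgue (\<lambda>y. norm w *\<^sub>R norm (indicator (cball ?c \<eta>) y *\<^sub>R g y))"
        using gi by (intro integrable_scaleR_right integrable_norm) (simp add: set_integrable_def)
      show "AE y in lebesgue. norm (((indicator (cball ?c \<eta>) y *\<^sub>R g y) \<bullet> w) * bump ?c \<eta> y)
          \<le> norm (norm w *\<^sub>R norm (indicator (cball ?c \<eta>) y *\<^sub>R g y))"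
      proof (rule AE_I2)
        fix y
        have "\<bar>(indicator (cball ?c \<eta>) y *\<^sub>R g y) \<bullet> w\<bar> * \<bar>bump ?c \<eta> y\<bar> \<le> (norm (indicator (cball ?c \<eta>) y *\<^sub>R g y) * norm w) * 1"
          using bump_nonneg[of ?c \<eta> y] bump_le_1[of ?c \<eta> y]
          by (intro mult_mono Cauchy_Schwarz_ineq2) auto
        then show "norm (((indicator (cball ?c \<eta>) y *\<^sub>R g y) \<bullet> w) * bump ?c \<eta> y)
          \<le> norm (norm w *\<^sub>R norm (indicator (cball ?c \<eta>) y *\<^sub>R g y))"
          by (simp add: abs_mult mult_ac)
      qed
    qed measurable
    then show ?thesis by (simp add: set_integrable_def mult.assoc)
  qed
  have "integral (cbox a b) (?d \<tau>) = - (\<Sum>j\<in>UNIV. v $ j * integral (cbox a b) (\<lambda>y. f y * partial j (bump ?c \<eta>) y))"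
  proof -
    have ii: "(\<lambda>y. v $ j * (f y * partial j (bump ?c \<eta>) y)) integrable_on cbox a b" for j
      by (intro integrable_continuous continuous_intros fb continuous_on_partial_bump)
    have "integral (cbox a b) (?d \<tau>) = integral (cbox a b) (\<lambda>y. - (\<Sum>j\<in>UNIV. v $ j * (f y * partial j (bump ?c \<eta>) y)))"
      by (rule arg_cong[where f="integral (cbox a b)"]) (simp add: fun_eq_iff sum_distrib_left mult_ac)
    also have "\<dots> = - (\<Sum>j\<in>UNIV. integral (cbox a b) (\<lambda>y. v $ j * (f y * partial j (bump ?c \<eta>) y)))"
      using ii by (subst integral_neg, subst integral_sum) auto
    finally show ?thesis by simp
  qed
  also have "\<dots> = (\<Sum>j\<in>UNIV. v $ j * (LINT y:cball ?c \<eta>|lebesgue. g y $ j * bump ?c \<eta> y))"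
  proof -
    have "integral (cbox a b) (\<lambda>y. f y * partial j (bump ?c \<eta>) y) = - (LINT y:cball ?c \<eta>|lebesgue. g y $ j * bump ?c \<eta> y)" for j
    proof -
      have "integral (cbox a b) (\<lambda>y. f y * partial j (bump ?c \<eta>) y) = (LINT y:cball ?c \<eta>|lebesgue. f y * partial j (bump ?c \<eta>) y)"
        using sub(1) partial_bump_outside[OF \<open>\<eta> > 0\<close>]
        by (intro integral_cbox_support continuous_intros fb continuous_on_partial_bump) auto
      also have "\<dots> = (LINT y|lebesgue_on U. f y * partial j (bump ?c \<eta>) y)"
        using sub(2) partial_bump_outside[OF \<open>\<eta> > 0\<close>] U
        by (intro integral_lebesgue_on_support[symmetric]) auto
      also have "\<dots> = - (LINT y|lebesgue_on U. g y $ j * bump ?c \<eta> y)"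
        using wg bump_space_test_function[OF bump_in_bump_space \<open>\<eta> > 0\<close> sub(2)]
        by (simp add: weak_gradient_def)
      also have "(LINT y|lebesgue_on U. g y $ j * bump ?c \<eta> y) = (LINT y:cball ?c \<eta>|lebesgue. g y $ j * bump ?c \<eta> y)"
        using sub(2) bump_outside[OF \<open>\<eta> > 0\<close>] U
        by (intro integral_lebesgue_on_support) auto
      finally show ?thesis .
    qed
    then show ?thesis by (simp add: sum_negf)
  qed
  also have "\<dots> = (LINT y:cball ?c \<eta>|lebesgue. (g y \<bullet> v) * bump ?c \<eta> y)"
  proof -
    have "set_integrable lebesgue (cball ?c \<eta>) (\<lambda>y. g y $ j * bump ?c \<eta> y)" for j
      using gbi[of "axis j 1"] by (simp add: inner_axis)
    then have "(\<Sum>j\<in>UNIV. v $ j * (LINT y:cball ?c \<eta>|lebesgue. g y $ j * bump ?c \<eta> y))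
        = (LINT y|lebesgue. (\<Sum>j\<in>UNIV. v $ j * (indicator (cball ?c \<eta>) y *\<^sub>R (g y $ j * bump ?c \<eta> y))))"
      unfolding set_lebesgue_integral_def set_integrable_def
      by (subst Bochner_Integration.integral_sum) auto
    also have "\<dots> = (LINT y:cball ?c \<eta>|lebesgue. (g y \<bullet> v) * bump ?c \<eta> y)"
      unfolding set_lebesgue_integral_def
      by (rule Bochner_Integration.integral_cong) (auto simp: inner_vec_def sum_distrib_left sum_distrib_right mult_ac)
    finally show ?thesis .
  qed
  finally have key: "\<psi> 1 - \<psi> 0 = (LINT y:cball ?c \<eta>|lebesgue. (g y \<bullet> v) * bump ?c \<eta> y)"
    using \<tau>(2) by simp
  have bi: "set_integrable lebesgue (cball ?c \<eta>) (bump ?c \<eta>)"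
    unfolding set_integrable_def by (intro integrable_mult_indicator bump_integrable \<open>\<eta> > 0\<close>) auto
  have mass: "(LINT y:cball ?c \<eta>|lebesgue. bump ?c \<eta> y) = bump_mass TYPE('n) \<eta>"
    unfolding integral_bump[of ?c \<eta>, symmetric] set_lebesgue_integral_def
    using bump_outside[OF \<open>\<eta> > 0\<close>]
    by (intro Bochner_Integration.integral_cong) (auto simp: indicator_def simp del: mem_cball)
  have "(LINT y:cball ?c \<eta>|lebesgue. ((g y - A) \<bullet> v) * bump ?c \<eta> y)
      = (LINT y:cball ?c \<eta>|lebesgue. (g y \<bullet> v) * bump ?c \<eta> y - (A \<bullet> v) * bump ?c \<eta> y)"
    by (simp add: inner_diff_left left_diff_distrib)
  also have "\<dots> = (LINT y:cball ?c \<eta>|lebesgue. (g y \<bullet> v) * bump ?c \<eta> y) - (A \<bullet> v) * bump_mass TYPE('n) \<eta>"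
    using bi by (subst set_integral_diff(2)[OF gbi]) (auto simp: mass)
  finally show thesis
    using key psi[of 0] psi[of 1] by (intro that[OF \<tau>01]) (simp add: mult.commute)
qed

lemma smoothed_close:
  fixes f :: "real^'n::finite \<Rightarrow> real"
  assumes "\<eta> > 0" and f: "continuous_on (cball c \<eta>) f"
    and \<omega>: "\<And>y. y \<in> cball c \<eta> \<Longrightarrow> \<bar>f y - f c\<bar> \<le> \<omega>"
  shows "\<bar>smoothed f \<eta> c - bump_mass TYPE('n) \<eta> * f c\<bar> \<le> bump_mass TYPE('n) \<eta> * \<omega>"
proof -
  have i1: "set_integrable lebesgue (cball c \<eta>) (\<lambda>y. f y * bump c \<eta> y)"
    by (intro set_integrable_continuous_compact continuous_intros f continuous_on_bump) auto
  have i2: "set_integrable lebesgue (cball c \<eta>) (bump c \<eta>)"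
    by (intro set_integrable_continuous_compact continuous_on_bump) auto
  have mass: "(LINT y:cball c \<eta>|lebesgue. bump c \<eta> y) = bump_mass TYPE('n) \<eta>"
    unfolding integral_bump[of c \<eta>, symmetric] set_lebesgue_integral_def
    using bump_outside[OF \<open>\<eta> > 0\<close>]
    by (intro Bochner_Integration.integral_cong) (auto simp: indicator_def simp del: mem_cball)
  have "smoothed f \<eta> c - bump_mass TYPE('n) \<eta> * f c = (LINT y:cball c \<eta>|lebesgue. f y * bump c \<eta> y - f c * bump c \<eta> y)"
    using i2 by (subst set_integral_diff(2)[OF i1]) (auto simp: mass smoothed_def)
  also have "\<bar>\<dots>\<bar> \<le> (LINT y:cball c \<eta>|lebesgue. \<omega> * bump c \<eta> y)"
  proof -
    have i3: "set_integrable lebesgue (cball c \<eta>) (\<lambda>y. f y * bump c \<eta> y - f c * bump c \<eta> y)"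
      using i1 i2 by (intro set_integral_diff(1)) auto
    have "norm (LINT y:cball c \<eta>|lebesgue. f y * bump c \<eta> y - f c * bump c \<eta> y)
        \<le> (LINT y:cball c \<eta>|lebesgue. norm (f y * bump c \<eta> y - f c * bump c \<eta> y))"
      by (rule set_integral_norm_bound[OF i3])
    also have "\<dots> \<le> (LINT y:cball c \<eta>|lebesgue. \<omega> * bump c \<eta> y)"
    proof (rule set_integral_mono)
      show "set_integrable lebesgue (cball c \<eta>) (\<lambda>y. norm (f y * bump c \<eta> y - f c * bump c \<eta> y))"
        using i3 by (rule set_integrable_norm)
      show "set_integrable lebesgue (cball c \<eta>) (\<lambda>y. \<omega> * bump c \<eta> y)" using i2 by simp
      show "norm (f y * bump c \<eta> y - f c * bump c \<eta> y) \<le> \<omega> * bump c \<eta> y" if "y \<in> cball c \<eta>" for y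
        using \<omega>[OF that] bump_nonneg[of c \<eta> y]
        by (simp add: mult_right_mono abs_mult flip: left_diff_distrib)
    qed
    finally show ?thesis by simp
  qed
  also have "\<dots> = bump_mass TYPE('n) \<eta> * \<omega>" by (simp add: mass)
  finally show ?thesis .
qed

section \<open>Almost everywhere differentiability\<close>

text \<open>A non-integrable \<open>h\<close> has integral 0 by convention, and \<open>k\<close> is
  non-negative almost everywhere; this covers functions \<open>h\<close> of unknown
  measurability.\<close>

lemma abs_integral_le_AE:
  fixes h k :: "'a \<Rightarrow> real"
  assumes k: "integrable M k" and le: "AE x in M. \<bar>h x\<bar> \<le> k x"
  shows "\<bar>LINT x|M. h x\<bar> \<le> (LINT x|M. k x)"
proof (cases "integrable M h")
  case True
  have "\<bar>LINT x|M. h x\<bar> \<le> (LINT x|M. \<bar>h x\<bar>)"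
    by (rule integral_abs_bound)
  also have "\<dots> \<le> (LINT x|M. k x)"
    using True k le by (intro integral_mono_AE) auto
  finally show ?thesis .
next
  case False
  have "AE x in M. 0 \<le> k x"
    using le by eventually_elim linarith
  then show ?thesis
    using False by (simp add: not_integrable_integral_eq integral_nonneg_AE)
qed

lemma cball_segment_subset:
  fixes x v :: "'a::real_normed_vector"
  assumes "convex S" "cball x \<eta> \<subseteq> S" "cball (x + v) \<eta> \<subseteq> S" "t \<in> {0..1}"
  shows "cball (x + t *\<^sub>R v) \<eta> \<subseteq> S"
proof
  fix z assume z: "z \<in> cball (x + t *\<^sub>R v) \<eta>"
  define w where "w = z - (x + t *\<^sub>R v)"
  have "norm w \<le> \<eta>" using z by (simp add: w_def dist_norm norm_minus_commute)
  then have "x + w \<in> S" "x + v + w \<in> S"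
    using assms(2,3) by (auto simp: subset_iff dist_norm)
  then have "(1 - t) *\<^sub>R (x + w) + t *\<^sub>R (x + v + w) \<in> S"
    using assms(1,4) by (intro convexD) auto
  moreover have "(1 - t) *\<^sub>R (x + w) + t *\<^sub>R (x + v + w) = z"
    by (simp add: w_def algebra_simps)
  ultimately show "z \<in> S" by simp
qed

lemma continuous_on_open_cball:
  fixes f :: "'a::heine_borel \<Rightarrow> real"
  assumes S: "open S" and f: "continuous_on S f" and z: "z \<in> S" and "e > 0"
  shows "\<exists>\<eta>>0. cball z \<eta> \<subseteq> S \<and> (\<forall>w\<in>cball z \<eta>. \<bar>f w - f z\<bar> \<le> e)"
proof -
  obtain d1 where d1: "d1 > 0" "cball z d1 \<subseteq> S"
    using z S open_contains_cball by blast
  have "isCont f z" using f z continuous_on_eq_continuous_at[OF S] by blast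
  then obtain d2 where d2: "d2 > 0" "\<And>w. dist w z < d2 \<Longrightarrow> dist (f w) (f z) < e"
    using \<open>e > 0\<close> unfolding continuous_at_eps_delta by metis
  show ?thesis
  proof (intro exI[of _ "min d1 (d2 / 2)"] conjI ballI)
    show "min d1 (d2 / 2) > 0" using d1 d2 by simp
    show "cball z (min d1 (d2 / 2)) \<subseteq> S" using d1(2) by auto
    show "\<bar>f w - f z\<bar> \<le> e" if "w \<in> cball z (min d1 (d2 / 2))" for w
      using d2(2)[of w] that d2(1) by (auto simp: dist_real_def dist_commute)
  qed
qed

text \<open>Increments of the smoothed function inherit the bound \<open>M\<close> up to the factor
  \<open>?Z\<close>, and at both end points it approximates \<open>?Z * f\<close> within
  \<open>?Z * (e / 2)\<close> once \<eta> is small. The factor \<open>?Z\<close> cancels, whatever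
  its size.\<close>

lemma weak_gradient_lipschitz:
  fixes f :: "real^'n::finite \<Rightarrow> real"
  assumes U: "open U" and f: "continuous_on U f" and wg: "weak_gradient f g U"
    and box: "cbox a b \<subseteq> U" and M: "0 \<le> M" "AE x in lebesgue. x \<in> U \<longrightarrow> norm (g x) \<le> M"
    and xy: "x \<in> box a b" "y \<in> box a b"
  shows "\<bar>f y - f x\<bar> \<le> M * norm (y - x)"
proof (rule field_le_epsilon)
  fix e :: real assume "e > 0"
  define v where "v = y - x"
  have f': "continuous_on (box a b) f"
    using f box box_subset_cbox continuous_on_subset by blast
  have "\<exists>\<eta>>0. cball z \<eta> \<subseteq> box a b \<and> (\<forall>w\<in>cball z \<eta>. \<bar>f w - f z\<bar> \<le> e / 2)" if z: "z \<in> box a b" for z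
    by (rule continuous_on_open_cball[OF open_box f' z]) (use \<open>e > 0\<close> in simp)
  then obtain d1 d2 where d1: "d1 > 0" "cball x d1 \<subseteq> box a b" "\<And>w. w\<in>cball x d1 \<Longrightarrow> \<bar>f w - f x\<bar> \<le> e / 2"
    and d2: "d2 > 0" "cball y d2 \<subseteq> box a b" "\<And>w. w\<in>cball y d2 \<Longrightarrow> \<bar>f w - f y\<bar> \<le> e / 2"
    using xy by metis
  define \<eta> where "\<eta> = min d1 d2"
  have \<eta>: "\<eta> > 0" "cball x \<eta> \<subseteq> box a b" "cball (x + v) \<eta> \<subseteq> box a b"
    using d1 d2 by (auto simp: \<eta>_def v_def)
  let ?Z = "bump_mass TYPE('n) \<eta>"
  have Z: "?Z > 0" by (rule bump_mass_pos[OF \<eta>(1)])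
  have seg: "cball (x + t *\<^sub>R v) \<eta> \<subseteq> box a b" if "t \<in> {0..1}" for t
    by (rule cball_segment_subset[OF convex_box(2) \<eta>(2,3) that])
  obtain \<tau> where \<tau>: "\<tau> \<in> {0..1}"
    "smoothed f \<eta> (x + v) - smoothed f \<eta> x - ?Z * (0 \<bullet> v)
       = (LINT y:cball (x + \<tau> *\<^sub>R v) \<eta>|lebesgue. ((g y - 0) \<bullet> v) * bump (x + \<tau> *\<^sub>R v) \<eta> y)"
    using smoothed_increment[OF U f wg \<eta>(1) box, of x v 0] seg box_subset_cbox by blast
  let ?c = "x + \<tau> *\<^sub>R v"
  have "\<bar>LINT y:cball ?c \<eta>|lebesgue. ((g y - 0) \<bullet> v) * bump ?c \<eta> y\<bar> \<le> (LINT y|lebesgue. M * norm v * bump ?c \<eta> y)"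
    unfolding set_lebesgue_integral_def
  proof (rule abs_integral_le_AE)
    show "integrable lebesgue (\<lambda>y. M * norm v * bump ?c \<eta> y)"
      by (intro integrable_mult_right bump_integrable \<eta>)
    show "AE y in lebesgue. \<bar>indicator (cball ?c \<eta>) y *\<^sub>R (((g y - 0) \<bullet> v) * bump ?c \<eta> y)\<bar> \<le> M * norm v * bump ?c \<eta> y"
      using M(2)
    proof eventually_elim
      fix y assume gy: "y \<in> U \<longrightarrow> norm (g y) \<le> M"
      show "\<bar>indicator (cball ?c \<eta>) y *\<^sub>R (((g y - 0) \<bullet> v) * bump ?c \<eta> y)\<bar> \<le> M * norm v * bump ?c \<eta> y"
      proof (cases "y \<in> cball ?c \<eta>")
        case True
        then have "norm (g y) \<le> M" using gy seg[OF \<tau>(1)] box box_subset_cbox by blast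
        then have "\<bar>g y \<bullet> v\<bar> \<le> M * norm v"
          using Cauchy_Schwarz_ineq2[of "g y" v] mult_right_mono[of "norm (g y)" M "norm v"] by simp
        then show ?thesis using True bump_nonneg[of ?c \<eta> y]
          by (simp add: abs_mult mult_right_mono)
      qed (use M(1) bump_nonneg[of ?c \<eta> y] in simp)
    qed
  qed
  then have 1: "\<bar>smoothed f \<eta> (x + v) - smoothed f \<eta> x\<bar> \<le> ?Z * (M * norm v)"
    using \<tau>(2) by (simp add: integral_bump mult_ac)
  have 2: "\<bar>smoothed f \<eta> x - ?Z * f x\<bar> \<le> ?Z * (e / 2)"
    using \<eta> d1 by (intro smoothed_close continuous_on_subset[OF f']) (auto simp: \<eta>_def)
  have 3: "\<bar>smoothed f \<eta> (x + v) - ?Z * f (x + v)\<bar> \<le> ?Z * (e / 2)"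
    using \<eta> d2 by (intro smoothed_close continuous_on_subset[OF f']) (auto simp: \<eta>_def v_def)
  have "\<bar>?Z * f (x + v) - ?Z * f x\<bar> \<le> ?Z * (M * norm v) + ?Z * (e / 2) + ?Z * (e / 2)"
    using 1 2 3 by linarith
  moreover have "?Z * f (x + v) - ?Z * f x = ?Z * (f (x + v) - f x)"
    by (simp only: right_diff_distrib)
  moreover have "?Z * (M * norm v) + ?Z * (e / 2) + ?Z * (e / 2) = ?Z * (M * norm v + e)"
    by (simp add: algebra_simps)
  ultimately have "?Z * \<bar>f (x + v) - f x\<bar> \<le> ?Z * (M * norm v + e)"
    using Z by (simp only: abs_mult abs_of_pos)
  then show "\<bar>f y - f x\<bar> \<le> M * norm (y - x) + e"
    using Z by (simp add: v_def)
qed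

text \<open>The order of the choices matters. At a displacement of length r the smoothing error is a
  multiple of \<delta> r, so \<delta> is fixed first. The mean oscillation of \<open>g\<close> on
  the ball of radius 2 r is then measured against a bump mass of order (\<delta> r)^n; the ratio of
  the two volumes is harmless because \<delta> no longer changes as r tends to 0.\<close>

lemma has_derivative_at_Lebesgue_point:
  fixes f :: "real^'n::finite \<Rightarrow> real"
  assumes U: "open U" and f: "continuous_on U f" and wg: "weak_gradient f g U"
    and x: "x \<in> box a b" and box: "cbox a b \<subseteq> U"
    and lip: "\<And>y z. y \<in> box a b \<Longrightarrow> z \<in> box a b \<Longrightarrow> \<bar>f y - f z\<bar> \<le> M * norm (y - z)"
    and L: "Lebesgue_point U g x"
  shows "(f has_derivative (\<lambda>v. g x \<bullet> v)) (at x)"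
  unfolding has_derivative_at_alt
proof (intro conjI allI impI)
  show "bounded_linear (\<lambda>v. g x \<bullet> v)" by (rule bounded_linear_inner_right)
  fix e :: real assume "e > 0"
  define M' where "M' = max M 0"
  have lip': "\<bar>f y - f z\<bar> \<le> M' * norm (y - z)" if "y \<in> box a b" "z \<in> box a b" for y z
    using lip[OF that] mult_right_mono[of M M' "norm (y - z)"] by (simp add: M'_def)
  have M': "M' \<ge> 0" by (simp add: M'_def)
  \<comment> \<open>Chosen so that the smoothing errors at the two end points,
    \<open>M' * \<delta> * r\<close> each, add up to at most \<open>e / 2 * r\<close>.\<close>
  define \<delta> where "\<delta> = min 1 (e / (4 * (M' + 1)))"
  have \<delta>: "\<delta> > 0" "\<delta> \<le> 1" "2 * M' * \<delta> \<le> e / 2"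
  proof -
    show "\<delta> > 0" "\<delta> \<le> 1" using \<open>e > 0\<close> M' by (auto simp: \<delta>_def)
    have "2 * M' * \<delta> \<le> 2 * (M' + 1) * (e / (4 * (M' + 1)))"
      using M' \<open>\<delta> > 0\<close> by (intro mult_mono) (auto simp: \<delta>_def)
    also have "\<dots> = e / 2" using M' by (simp add: field_simps)
    finally show "2 * M' * \<delta> \<le> e / 2" .
  qed
  \<comment> \<open>Since \<eta> / 2 will be \<open>(2 * r) * (\<delta> / 4)\<close>, the last
    factor converts the volume of the ball of radius \<open>2 * r\<close> into that of the ball of
    radius \<eta> / 2, on which the bump is at least \<open>exp (- 2)\<close>.\<close>
  define e' where "e' = e / 2 * exp (- 2) * (\<delta> / 4) ^ CARD('n)"
  have "e' > 0" using \<open>e > 0\<close> \<delta> by (simp add: e'_def)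
  then obtain d0 where d0: "d0 > 0" "\<And>r. 0 < r \<Longrightarrow> r < d0 \<Longrightarrow>
           cball x r \<subseteq> U \<and> set_integrable lebesgue (cball x r) g \<and>
           (LINT y:cball x r|lebesgue. norm (g y - g x)) \<le> e' * measure lebesgue (cball x r)"
    using L unfolding Lebesgue_point_def by meson
  obtain d1 where d1: "d1 > 0" "cball x d1 \<subseteq> box a b"
    using x open_box open_contains_cball by blast
  have f': "continuous_on (box a b) f"
    using f box box_subset_cbox continuous_on_subset by blast
  show "\<exists>d>0. \<forall>y. norm (y - x) < d \<longrightarrow> norm (f y - f x - g x \<bullet> (y - x)) \<le> e * norm (y - x)"
  proof (intro exI[of _ "min d0 d1 / 2"] conjI allI impI)
    show "min d0 d1 / 2 > 0" using d0 d1 by simp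
    fix y assume y: "norm (y - x) < min d0 d1 / 2"
    define v where "v = y - x"
    define r where "r = norm v"
    show "norm (f y - f x - g x \<bullet> (y - x)) \<le> e * norm (y - x)"
    proof (cases "v = 0")
      case False
      define \<eta> where "\<eta> = \<delta> * r"
      have r: "r > 0" "2 * r < d0" "2 * r < d1" using False y by (auto simp: r_def v_def)
      have \<eta>: "\<eta> > 0" "\<eta> \<le> r" using r \<delta> by (auto simp: \<eta>_def mult_le_cancel_right1)
      have ball2: "cball (x + t *\<^sub>R v) \<eta> \<subseteq> cball x (2 * r)" if "t \<in> {0..1}" for t
      proof
        fix z assume "z \<in> cball (x + t *\<^sub>R v) \<eta>"
        then have "dist x z \<le> norm (t *\<^sub>R v) + \<eta>"
          using dist_triangle[of x z "x + t *\<^sub>R v"] by (simp add: dist_norm)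
        also have "norm (t *\<^sub>R v) \<le> r" using that by (auto simp: r_def mult_left_le_one_le)
        finally show "z \<in> cball x (2 * r)" using \<eta> by simp
      qed
      have sub: "cball x (2 * r) \<subseteq> box a b" using d1(2) r by (auto simp: subset_iff)
      let ?Z = "bump_mass TYPE('n) \<eta>"
      have Z: "?Z > 0" by (rule bump_mass_pos[OF \<eta>(1)])
      obtain \<tau> where \<tau>: "\<tau> \<in> {0..1}"
        "smoothed f \<eta> (x + v) - smoothed f \<eta> x - ?Z * (g x \<bullet> v)
           = (LINT y:cball (x + \<tau> *\<^sub>R v) \<eta>|lebesgue. ((g y - g x) \<bullet> v) * bump (x + \<tau> *\<^sub>R v) \<eta> y)"
        using smoothed_increment[OF U f wg \<eta>(1) box, of x v "g x"] ball2 sub box_subset_cbox by blast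
      let ?c = "x + \<tau> *\<^sub>R v"
      have gi: "set_integrable lebesgue (cball x (2 * r)) g" and
        gL: "(LINT y:cball x (2 * r)|lebesgue. norm (g y - g x)) \<le> e' * measure lebesgue (cball x (2 * r))"
        using d0(2)[of "2 * r"] r by auto
      have gi': "set_integrable lebesgue (cball x (2 * r)) (\<lambda>y. r * norm (g y - g x))"
        by (intro set_integrable_mult_right set_integrable_norm set_integral_diff(1) gi
            set_integrable_continuous_compact) auto
      have "\<bar>LINT y:cball ?c \<eta>|lebesgue. ((g y - g x) \<bullet> v) * bump ?c \<eta> y\<bar>
          \<le> (LINT y:cball x (2 * r)|lebesgue. r * norm (g y - g x))"
        unfolding set_lebesgue_integral_def
      proof (rule abs_integral_le_AE)
        show "integrable lebesgue (\<lambda>y. indicator (cball x (2 * r)) y *\<^sub>R (r * norm (g y - g x)))"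
          using gi' by (simp only: set_integrable_def)
        show "AE y in lebesgue. \<bar>indicator (cball ?c \<eta>) y *\<^sub>R (((g y - g x) \<bullet> v) * bump ?c \<eta> y)\<bar>
            \<le> indicator (cball x (2 * r)) y *\<^sub>R (r * norm (g y - g x))"
        proof (rule AE_I2)
          fix y
          have "\<bar>(g y - g x) \<bullet> v\<bar> * \<bar>bump ?c \<eta> y\<bar> \<le> (norm (g y - g x) * norm v) * 1"
            using bump_nonneg[of ?c \<eta> y] bump_le_1[of ?c \<eta> y]
            by (intro mult_mono Cauchy_Schwarz_ineq2) auto
          then show "\<bar>indicator (cball ?c \<eta>) y *\<^sub>R (((g y - g x) \<bullet> v) * bump ?c \<eta> y)\<bar>
            \<le> indicator (cball x (2 * r)) y *\<^sub>R (r * norm (g y - g x))"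
            using subsetD[OF ball2[OF \<tau>(1)], of y] r(1)
            by (cases "y \<in> cball ?c \<eta>") (auto simp: abs_mult r_def mult_ac)
        qed
      qed
      also have "\<dots> = r * (LINT y:cball x (2 * r)|lebesgue. norm (g y - g x))" by simp
      also have "\<dots> \<le> r * (e' * measure lebesgue (cball x (2 * r)))"
        using gL r by (intro mult_left_mono) auto
      also have "measure lebesgue (cball x (2 * r)) = (2 * r) ^ CARD('n) * measure lborel (ball (0::real^'n) 1)"
        using r content_ball_conv_unit_ball[of "2 * r" x] by (simp add: content_cball_conv_ball)
      also have "e' * \<dots> = (e / 2) * (exp (- 2) * measure lborel (ball (0::real^'n) 1) * (\<eta> / 2) ^ CARD('n))"
      proof -
        have "\<eta> / 2 = (2 * r) * (\<delta> / 4)" by (simp add: \<eta>_def)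
        then have "(\<eta> / 2) ^ CARD('n) = (2 * r) ^ CARD('n) * (\<delta> / 4) ^ CARD('n)"
          by (simp only: power_mult_distrib)
        then show ?thesis by (simp only: e'_def mult_ac)
      qed
      also have "\<dots> \<le> (e / 2) * ?Z"
        using bump_mass_lower[OF \<eta>(1), where 'n='n] \<open>e > 0\<close> by (intro mult_left_mono) auto
      finally have 1: "\<bar>smoothed f \<eta> (x + v) - smoothed f \<eta> x - ?Z * (g x \<bullet> v)\<bar> \<le> r * ((e / 2) * ?Z)"
        using \<tau>(2) r(1) by (simp add: mult_left_mono)
      have cl: "\<bar>smoothed f \<eta> z - ?Z * f z\<bar> \<le> ?Z * (M' * \<eta>)" if "cball z \<eta> \<subseteq> box a b" for z
      proof (rule smoothed_close[OF \<eta>(1) continuous_on_subset[OF f' that]])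
        fix w assume w: "w \<in> cball z \<eta>"
        have "z \<in> box a b" "w \<in> box a b" using that w \<eta> by auto
        then have "\<bar>f w - f z\<bar> \<le> M' * norm (w - z)" by (rule lip'[rotated])
        also have "\<dots> \<le> M' * \<eta>" using w M' by (intro mult_left_mono) (auto simp: dist_norm norm_minus_commute)
        finally show "\<bar>f w - f z\<bar> \<le> M' * \<eta>" .
      qed
      have 2: "\<bar>smoothed f \<eta> x - ?Z * f x\<bar> \<le> ?Z * (M' * \<eta>)" and 3: "\<bar>smoothed f \<eta> (x + v) - ?Z * f (x + v)\<bar> \<le> ?Z * (M' * \<eta>)"
        using cl[of x] cl[of "x + v"] ball2[of 0] ball2[of 1] sub by auto
      have "\<bar>?Z * f (x + v) - ?Z * f x - ?Z * (g x \<bullet> v)\<bar> \<le> r * ((e / 2) * ?Z) + ?Z * (M' * \<eta>) + ?Z * (M' * \<eta>)"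
        using 1 2 3 by linarith
      moreover have "?Z * f (x + v) - ?Z * f x - ?Z * (g x \<bullet> v) = ?Z * (f (x + v) - f x - g x \<bullet> v)"
        by (simp only: right_diff_distrib)
      moreover have "r * ((e / 2) * ?Z) + ?Z * (M' * \<eta>) + ?Z * (M' * \<eta>) = ?Z * (r * (e / 2) + 2 * M' * \<delta> * r)"
        by (simp add: \<eta>_def algebra_simps)
      ultimately have "?Z * \<bar>f (x + v) - f x - g x \<bullet> v\<bar> \<le> ?Z * (r * (e / 2) + 2 * M' * \<delta> * r)"
        using Z by (simp only: abs_mult abs_of_pos)
      then have "\<bar>f (x + v) - f x - g x \<bullet> v\<bar> \<le> r * (e / 2) + 2 * M' * \<delta> * r"
        using Z by simp
      also have "\<dots> \<le> r * (e / 2) + (e / 2) * r"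
        using \<delta>(3) r by (intro add_left_mono mult_right_mono) auto
      finally show ?thesis by (simp add: v_def r_def mult_ac)
    qed (simp add: v_def)
  qed
qed

lemma AE_lebesgue_on_iff:
  assumes "U \<in> sets lebesgue"
  shows "(AE x in lebesgue_on U. P x) \<longleftrightarrow> (AE x in lebesgue. x \<in> U \<longrightarrow> P x)"
  using assms by (subst AE_restrict_space_iff) auto

lemma W1inf_locally_lipschitz:
  fixes u :: "real^'n::finite \<Rightarrow> real^'n"
  assumes U: "open U" and u: "u \<in> W1inf U" and x: "x \<in> U"
  obtains a b M where "x \<in> box a b" "cbox a b \<subseteq> U" "M \<ge> 0"
    "\<And>y z. y \<in> box a b \<Longrightarrow> z \<in> box a b \<Longrightarrow> norm (u y - u z) \<le> M * norm (y - z)"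
proof -
  obtain G C where cont: "continuous_on U u" and G: "has_weak_jacobian u G U"
    and C: "AE x in lebesgue_on U. norm (G x) \<le> C"
    using u by (auto simp: W1inf_def Linf_def)
  define M where "M = max C 0"
  have M: "M \<ge> 0" "AE x in lebesgue. x \<in> U \<longrightarrow> norm (G x $ i) \<le> M" for i
  proof -
    have "AE x in lebesgue. x \<in> U \<longrightarrow> norm (G x) \<le> C"
      using C U by (simp add: AE_lebesgue_on_iff)
    then show "AE x in lebesgue. x \<in> U \<longrightarrow> norm (G x $ i) \<le> M"
    proof eventually_elim
      fix x assume "x \<in> U \<longrightarrow> norm (G x) \<le> C"
      then show "x \<in> U \<longrightarrow> norm (G x $ i) \<le> M"
        using Finite_Cartesian_Product.norm_nth_le[of "G x" i] by (auto simp: M_def)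
    qed
  qed (simp add: M_def)
  obtain a b where ab: "x \<in> box a b" "cbox a b \<subseteq> U"
    using U x by (meson open_contains_cbox)
  have comp: "\<bar>u y $ i - u z $ i\<bar> \<le> M * norm (y - z)" if "y \<in> box a b" "z \<in> box a b" for y z i
    by (rule weak_gradient_lipschitz[OF U _ weak_gradient_component[OF G] ab(2) M])
      (use that cont in \<open>auto intro!: continuous_intros\<close>)
  have "norm (u y - u z) \<le> (real CARD('n) * M) * norm (y - z)" if "y \<in> box a b" "z \<in> box a b" for y z
  proof -
    have "norm (u y - u z) \<le> (\<Sum>i\<in>UNIV. \<bar>(u y - u z) $ i\<bar>)" by (rule norm_le_l1_cart)
    also have "\<dots> \<le> (\<Sum>i\<in>(UNIV::'n set). M * norm (y - z))"
      using comp[OF that] by (intro sum_mono) simp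
    finally show ?thesis by simp
  qed
  then show thesis
    by (intro that[OF ab, of "real CARD('n) * M"]) (use M(1) in auto)
qed

text \<open>\<open>Du\<close> may be any weak Jacobian: the local Lipschitz bound comes from the
  bounded one in \<open>W1inf\<close>, and the derivative is identified at the Lebesgue points of
  the rows of \<open>Du\<close>.\<close>

lemma W1inf_has_derivative:
  fixes u :: "real^'n::finite \<Rightarrow> real^'n"
  assumes U: "open U" and u: "u \<in> W1inf U" and Du: "has_weak_jacobian u Du U"
  shows "AE x in lebesgue. x \<in> U \<longrightarrow> (u has_derivative (\<lambda>v. Du x *v v)) (at x)"
proof -
  have cont: "continuous_on U u" using u by (simp add: W1inf_def)
  have "AE x in lebesgue. x \<in> U \<longrightarrow> Lebesgue_point U (\<lambda>x. Du x $ i) x" for i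
    using weak_gradient_component[OF Du]
    by (intro Lebesgue_points_locally_integrable U) (auto simp: weak_gradient_def)
  then have "AE x in lebesgue. \<forall>i. x \<in> U \<longrightarrow> Lebesgue_point U (\<lambda>x. Du x $ i) x"
    unfolding AE_all_countable by (rule allI)
  then show ?thesis
  proof (rule AE_mp, intro AE_I2 impI)
    fix x
    assume L: "\<forall>i. x \<in> U \<longrightarrow> Lebesgue_point U (\<lambda>x. Du x $ i) x" and x: "x \<in> U"
    obtain a b M where ab: "x \<in> box a b" "cbox a b \<subseteq> U"
      and lip: "\<And>y z. y \<in> box a b \<Longrightarrow> z \<in> box a b \<Longrightarrow> norm (u y - u z) \<le> M * norm (y - z)"
      using W1inf_locally_lipschitz[OF U u x] by metis
    have "((\<lambda>x. u x $ i) has_derivative (\<lambda>v. Du x $ i \<bullet> v)) (at x)" for i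
    proof (rule has_derivative_at_Lebesgue_point[OF U _ weak_gradient_component[OF Du] ab])
      show "continuous_on U (\<lambda>x. u x $ i)" by (intro continuous_intros cont)
      show "\<bar>u y $ i - u z $ i\<bar> \<le> M * norm (y - z)" if "y \<in> box a b" "z \<in> box a b" for y z
        using lip[OF that] component_le_norm_cart[of "u y - u z" i] by simp
    qed (use L x in simp)
    then have "((\<lambda>x. u x \<bullet> b) has_derivative (\<lambda>v. (Du x *v v) \<bullet> b)) (at x)" if "b \<in> Basis" for b
      using that by (auto simp: Basis_vec_def inner_axis matrix_vector_mul_component)
    then show "(u has_derivative (\<lambda>v. Du x *v v)) (at x)"
      by (subst has_derivative_componentwise_within) blast
  qed
qed

text \<open>Both Jacobians coincide almost everywhere with the classical derivative.\<close>

lemma weak_jacobian_unique: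
  fixes u :: "real^'n::finite \<Rightarrow> real^'n"
  assumes U: "open U" and u: "u \<in> W1inf U" and D: "has_weak_jacobian u D U" and G: "has_weak_jacobian u G U"
  shows "AE x in lebesgue. x \<in> U \<longrightarrow> D x = G x"
  using W1inf_has_derivative[OF U u D] W1inf_has_derivative[OF U u G]
proof eventually_elim
  fix x
  assume "x \<in> U \<longrightarrow> (u has_derivative (\<lambda>v. D x *v v)) (at x)" "x \<in> U \<longrightarrow> (u has_derivative (\<lambda>v. G x *v v)) (at x)"
  then show "x \<in> U \<longrightarrow> D x = G x"
    using has_derivative_unique[of u "\<lambda>v. D x *v v" x "\<lambda>v. G x *v v"]
    by (metis matrix_of_matrix_vector_mul)
qed

section \<open>The area formula for arbitrary finite index types\<close>

text \<open>The change-of-variables theorems of the library require a well-ordered index type; every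
  finite index type has a well-ordered copy.\<close>

typedef 'a wo = "UNIV :: 'a set" morphisms wo_elem wo_of ..

definition wo_index :: "'a::finite wo \<Rightarrow> nat" where
  "wo_index = (SOME f. inj f)"

lemma wo_of_elem: "bij (wo_of :: 'a \<Rightarrow> 'a wo)"
  by (metis bijI' wo_elem_inverse wo_of_inject UNIV_I)

instance wo :: (finite) finite
proof
  have "(UNIV :: 'a wo set) = range wo_of"
    using wo_of_elem by (metis bij_is_surj)
  then show "finite (UNIV :: 'a wo set)" by (metis finite finite_imageI)
qed

lemma inj_wo_index: "inj (wo_index :: 'a::finite wo \<Rightarrow> nat)"
  unfolding wo_index_def by (rule someI_ex[of inj]) (use finite_imp_inj_to_nat_seg[of "UNIV :: 'a wo set"] in auto)

instantiation wo :: (finite) wellorder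
begin

definition less_eq_wo :: "'a wo \<Rightarrow> 'a wo \<Rightarrow> bool" where "less_eq_wo x y \<longleftrightarrow> wo_index x \<le> wo_index y"
definition less_wo :: "'a wo \<Rightarrow> 'a wo \<Rightarrow> bool" where "less_wo x y \<longleftrightarrow> wo_index x < wo_index y"

instance
proof
  fix P :: "'a wo \<Rightarrow> bool" and a
  assume step: "\<And>x. (\<And>y. y < x \<Longrightarrow> P y) \<Longrightarrow> P x"
  show "P a"
    by (induction a rule: measure_induct_rule[of wo_index]) (use step in \<open>auto simp: less_wo_def\<close>)
qed (auto simp: less_eq_wo_def less_wo_def inj_eq[OF inj_wo_index])

end

section \<open>Relabelling of coordinates: volumes and determinants are unchanged\<close>

definition reindex :: "('m \<Rightarrow> 'n) \<Rightarrow> real^'n::finite \<Rightarrow> real^'m::finite" where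
  "reindex p x = (\<chi> i. x $ p i)"

lemma reindex_nth [simp]: "reindex p x $ i = x $ p i"
  by (simp add: reindex_def)

lemma linear_reindex: "linear (reindex p)"
  by (rule linearI) (auto simp: vec_eq_iff)

lemma bounded_linear_reindex: "bounded_linear (reindex p)"
  using linear_reindex linear_conv_bounded_linear by blast

lemma reindex_measurable [measurable]: "reindex p \<in> borel_measurable borel"
  by (intro borel_measurable_continuous_onI linear_continuous_on bounded_linear_reindex)

lemma prod_Basis_cart: "(\<Prod>b\<in>(Basis :: (real^'n::finite) set). h b) = (\<Prod>i\<in>UNIV. h (axis i 1))"
proof -
  have "(Basis :: (real^'n) set) = (\<lambda>i. axis i 1) ` UNIV" by (auto simp: Basis_vec_def)
  moreover have "inj (\<lambda>i. axis i (1::real) :: real^'n)" by (auto simp: inj_on_def axis_eq_axis)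
  ultimately show ?thesis by (metis (mono_tags, lifting) prod.reindex_cong)
qed

text \<open>Relabelling takes open boxes to open boxes with the same side lengths, and the measures
  of boxes determine Lebesgue measure.\<close>

lemma lborel_distr_reindex:
  assumes p: "bij (p :: 'm::finite \<Rightarrow> 'n::finite)"
  shows "distr lborel borel (reindex p) = (lborel :: (real^'m) measure)"
proof (rule lborel_eqI[symmetric])
  fix l u :: "real^'m" assume le: "\<And>b. b \<in> Basis \<Longrightarrow> l \<bullet> b \<le> u \<bullet> b"
  have le': "l $ i \<le> u $ i" for i using le[of "axis i 1"] by (simp add: inner_axis)
  let ?q = "inv p"
  have pq: "p (?q k) = k" "?q (p i) = i" for k i
    using p by (simp_all add: bij_is_surj surj_f_inv_f bij_is_inj inv_f_f)
  have "reindex p -` box l u = box (reindex ?q l) (reindex ?q u)"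
    by (auto simp: mem_box_cart) (metis pq(1), metis pq(1), metis pq(2), metis pq(2))
  then have "emeasure (distr lborel borel (reindex p)) (box l u) = emeasure lborel (box (reindex ?q l) (reindex ?q u))"
    by (subst emeasure_distr) auto
  also have "\<dots> = (\<Prod>b\<in>Basis. (reindex ?q u - reindex ?q l) \<bullet> b)"
    using le' by (intro emeasure_lborel_box) (auto simp: Basis_vec_def inner_axis)
  also have "(\<Prod>b\<in>Basis. (reindex ?q u - reindex ?q l) \<bullet> b) = (\<Prod>k\<in>UNIV. u $ ?q k - l $ ?q k)"
    by (simp add: prod_Basis_cart inner_axis)
  also have "\<dots> = (\<Prod>i\<in>UNIV. u $ i - l $ i)"
    using p by (intro prod.reindex_bij_betw[of ?q] ) (simp add: bij_imp_bij_inv)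
  also have "\<dots> = (\<Prod>b\<in>Basis. (u - l) \<bullet> b)"
    by (simp add: prod_Basis_cart inner_axis)
  finally show "emeasure (distr lborel borel (reindex p)) (box l u) = (\<Prod>b\<in>Basis. (u - l) \<bullet> b)" .
qed simp

lemma lebesgue_reindex:
  assumes p: "bij (p :: 'm::finite \<Rightarrow> 'n::finite)"
  shows "reindex p \<in> (lebesgue :: (real^'n) measure) \<rightarrow>\<^sub>M (lebesgue :: (real^'m) measure)"
    and "distr lebesgue lebesgue (reindex p) = (lebesgue :: (real^'m) measure)"
proof -
  have m: "reindex p \<in> lebesgue \<rightarrow>\<^sub>M (lborel :: (real^'m) measure)"
    by (rule measurable_completion) simp
  have d: "distr lebesgue lborel (reindex p) = (lborel :: (real^'m) measure)"
    using lborel_distr_reindex[OF p] by (subst distr_completion) (auto cong: distr_cong)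
  show "reindex p \<in> (lebesgue :: (real^'n) measure) \<rightarrow>\<^sub>M (lebesgue :: (real^'m) measure)"
    by (rule completion.measurable_completion2[OF m]) (simp add: d)
  show "distr lebesgue lebesgue (reindex p) = (lebesgue :: (real^'m) measure)"
    using completion.completion_distr_eq[OF m] by (simp add: d)
qed

text \<open>The transposition of \<open>a\<close> and \<open>b\<close> is conjugated into that of
  \<open>p a\<close> and \<open>p b\<close>, so the number of factors is kept. This transfers signs
  between permutations of different index types.\<close>

lemma swapidseq_conjugate:
  assumes p: "bij p" and "swapidseq n \<pi>"
  shows "swapidseq n (p \<circ> \<pi> \<circ> inv p)"
  using assms(2)
proof induction
  case id
  have "p \<circ> id \<circ> inv p = id" using p by (simp add: fun_eq_iff bij_is_surj surj_f_inv_f)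
  then show ?case by (metis swapidseq.id)
next
  case (comp_Suc n \<pi> a b)
  have "p \<circ> (Transposition.transpose a b \<circ> \<pi>) \<circ> inv p = Transposition.transpose (p a) (p b) \<circ> (p \<circ> \<pi> \<circ> inv p)"
    using p by (auto simp: fun_eq_iff Transposition.transpose_def inj_eq[OF bij_is_inj])
  moreover have "p a \<noteq> p b" using comp_Suc p by (simp add: inj_eq[OF bij_is_inj])
  ultimately show ?case using swapidseq.comp_Suc[OF comp_Suc.IH] by metis
qed

lemma sign_conjugate:
  assumes p: "bij p" and "permutation \<pi>"
  shows "sign (p \<circ> \<pi> \<circ> inv p) = sign \<pi>"
proof -
  obtain n where n: "swapidseq n \<pi>" using assms by (auto simp: permutation_def)
  have "evenperm \<pi> = even n" using evenperm_unique[OF n] by simp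
  moreover have "evenperm (p \<circ> \<pi> \<circ> inv p) = even n"
    using evenperm_unique[OF swapidseq_conjugate[OF p n]] by simp
  ultimately show ?thesis by (simp add: sign_def)
qed

lemma det_reindex:
  fixes A :: "real^'n::finite^'n"
  assumes p: "bij (p :: 'm::finite \<Rightarrow> 'n)"
  shows "det (\<chi> i j. A $ p i $ p j) = det A"
proof -
  have pq: "p (inv p k) = k" "inv p (p i) = i" for k i
    using p by (simp_all add: bij_is_surj surj_f_inv_f bij_is_inj inv_f_f)
  have bb: "bij_betw (\<lambda>\<pi>. p \<circ> \<pi> \<circ> inv p) {\<pi>. \<pi> permutes UNIV} {\<pi>. \<pi> permutes UNIV}"
  proof (rule bij_betw_byWitness[where f'="\<lambda>\<pi>. inv p \<circ> \<pi> \<circ> p"])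
    show "(\<lambda>\<pi>. p \<circ> \<pi> \<circ> inv p) ` {\<pi>. \<pi> permutes UNIV} \<subseteq> {\<pi>. \<pi> permutes UNIV}"
      "(\<lambda>\<pi>. inv p \<circ> \<pi> \<circ> p) ` {\<pi>. \<pi> permutes UNIV} \<subseteq> {\<pi>. \<pi> permutes UNIV}"
      using p by (auto intro!: bij_imp_permutes bij_comp bij_imp_bij_inv permutes_bij)
  qed (auto simp: fun_eq_iff pq)
  have "det A = (\<Sum>\<pi>\<in>{\<pi>. \<pi> permutes UNIV}. of_int (sign (p \<circ> \<pi> \<circ> inv p)) * (\<Prod>k\<in>UNIV. A $ k $ (p \<circ> \<pi> \<circ> inv p) k))"
    unfolding det_def by (rule sum.reindex_bij_betw[OF bb, symmetric])
  also have "\<dots> = (\<Sum>\<pi>\<in>{\<pi>. \<pi> permutes UNIV}. of_int (sign \<pi>) * (\<Prod>i\<in>UNIV. A $ p i $ p (\<pi> i)))"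
  proof (rule sum.cong[OF refl])
    fix \<pi> :: "'m \<Rightarrow> 'm" assume "\<pi> \<in> {\<pi>. \<pi> permutes UNIV}"
    then have "sign (p \<circ> \<pi> \<circ> inv p) = sign \<pi>"
      using p by (intro sign_conjugate) (auto intro: permutes_imp_permutation[OF finite])
    moreover have "(\<Prod>k\<in>UNIV. A $ k $ (p \<circ> \<pi> \<circ> inv p) k) = (\<Prod>i\<in>UNIV. A $ p i $ p (\<pi> i))"
      using prod.reindex_bij_betw[OF p, of "\<lambda>k. A $ k $ (p \<circ> \<pi> \<circ> inv p) k"] by (simp add: pq)
    ultimately show "of_int (sign (p \<circ> \<pi> \<circ> inv p)) * (\<Prod>k\<in>UNIV. A $ k $ (p \<circ> \<pi> \<circ> inv p) k)
        = of_int (sign \<pi>) * (\<Prod>i\<in>UNIV. A $ p i $ p (\<pi> i))" by simp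
  qed
  finally show ?thesis by (simp add: det_def)
qed

lemma area_formula_wellorder:
  fixes f :: "real^'n::{finite,wellorder} \<Rightarrow> real^'n::_"
  assumes S: "S \<in> sets lebesgue"
    and der: "\<And>x. x \<in> S \<Longrightarrow> (f has_derivative (\<lambda>v. D x *v v)) (at x within S)"
    and inj: "inj_on f S"
    and int: "set_integrable lebesgue S (\<lambda>x. det (D x))"
  shows "f ` S \<in> lmeasurable" "measure lebesgue (f ` S) = (LINT x:S|lebesgue. \<bar>det (D x)\<bar>)"
proof -
  have i: "set_integrable lebesgue S (\<lambda>x. \<bar>det (D x)\<bar>)"
    using int by (rule set_integrable_abs)
  then have "((\<lambda>x. \<bar>det (matrix ((*v) (D x)))\<bar>) has_integral (LINT x:S|lebesgue. \<bar>det (D x)\<bar>)) S"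
    using set_lebesgue_integral_eq_integral[OF i] by (simp add: has_integral_iff)
  then show "f ` S \<in> lmeasurable" "measure lebesgue (f ` S) = (LINT x:S|lebesgue. \<bar>det (D x)\<bar>)"
    using has_measure_differentiable_image[OF S der inj] by auto
qed

text \<open>Conjugation with the relabelling carries \<open>f\<close> to the well-ordered copy. Rows
  and columns of the derivative are relabelled alike, so the determinant stays the same.\<close>

lemma area_formula:
  fixes f :: "real^'n::finite \<Rightarrow> real^'n"
  assumes S: "S \<in> sets lebesgue"
    and der: "\<And>x. x \<in> S \<Longrightarrow> (f has_derivative (\<lambda>v. D x *v v)) (at x within S)"
    and inj: "inj_on f S"
    and int: "set_integrable lebesgue S (\<lambda>x. det (D x))"
  shows "f ` S \<in> lmeasurable" "measure lebesgue (f ` S) = (LINT x:S|lebesgue. \<bar>det (D x)\<bar>)"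
proof -
  define p :: "'n wo \<Rightarrow> 'n" where "p = wo_elem"
  define q :: "'n \<Rightarrow> 'n wo" where "q = wo_of"
  have pq [simp]: "p (q k) = k" "q (p i) = i" for k i
    by (simp_all add: p_def q_def wo_of_inverse wo_elem_inverse)
  have p: "bij p" and q: "bij q" by (metis bijI' pq)+
  let ?\<rho> = "reindex p :: real^'n \<Rightarrow> real^'n wo" and ?\<sigma> = "reindex q :: real^'n wo \<Rightarrow> real^'n"
  have rs [simp]: "?\<rho> (?\<sigma> y) = y" "?\<sigma> (?\<rho> x) = x" for x y
    by (simp_all add: vec_eq_iff)
  have vim: "?\<rho> ` T = ?\<sigma> -` T" "?\<sigma> ` T' = ?\<rho> -` T'" for T T'
    by (auto simp: image_iff) (metis rs)+
  have vimm: "?\<sigma> -` T \<in> sets lebesgue" if "T \<in> sets lebesgue" for T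
    using measurable_sets[OF lebesgue_reindex(1)[OF q] that] by simp
  have vimm': "?\<rho> -` T \<in> sets lebesgue" if "T \<in> sets lebesgue" for T
    using measurable_sets[OF lebesgue_reindex(1)[OF p] that] by simp
  define f' where "f' y = ?\<rho> (f (?\<sigma> y))" for y
  define D' where "D' y = (\<chi> i j. D (?\<sigma> y) $ p i $ p j)" for y
  let ?S = "?\<sigma> -` S"
  have der': "(f' has_derivative (\<lambda>v. D' y *v v)) (at y within ?S)" if y: "y \<in> ?S" for y
  proof -
    have "((\<lambda>y. ?\<rho> (f (?\<sigma> y))) has_derivative (\<lambda>v. ?\<rho> (D (?\<sigma> y) *v (?\<sigma> v)))) (at y within ?S)"
    proof (rule bounded_linear.has_derivative[OF bounded_linear_reindex])
      have "(?\<sigma> has_derivative ?\<sigma>) (at y within ?S)"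
        by (rule bounded_linear_imp_has_derivative[OF bounded_linear_reindex])
      moreover have "(f has_derivative (\<lambda>v. D (?\<sigma> y) *v v)) (at (?\<sigma> y) within ?\<sigma> ` ?S)"
        using der[of "?\<sigma> y"] y by (intro has_derivative_subset[where s=S and t="?\<sigma> ` ?S"]) auto
      ultimately show "((\<lambda>y. f (?\<sigma> y)) has_derivative (\<lambda>v. D (?\<sigma> y) *v ?\<sigma> v)) (at y within ?S)"
        by (rule has_derivative_in_compose)
    qed
    moreover have "?\<rho> (D (?\<sigma> y) *v (?\<sigma> v)) = D' y *v v" for v
    proof -
      have "(\<Sum>k\<in>UNIV. D (?\<sigma> y) $ p i $ k * v $ q k) = (\<Sum>j\<in>UNIV. D (?\<sigma> y) $ p i $ p j * v $ j)" for i
        using sum.reindex_bij_betw[OF p, of "\<lambda>k. D (?\<sigma> y) $ p i $ k * v $ q k"] by simp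
      then show ?thesis by (simp add: vec_eq_iff D'_def matrix_vector_mult_def)
    qed
    moreover have "f' = (\<lambda>y. ?\<rho> (f (?\<sigma> y)))" by (simp add: fun_eq_iff f'_def)
    ultimately show ?thesis by simp
  qed
  have inj': "inj_on f' ?S"
    using inj by (auto simp: inj_on_def f'_def) (metis rs)
  have det': "det (D' y) = det (D (?\<sigma> y))" for y
    unfolding D'_def by (rule det_reindex[OF p])
  have "integrable lebesgue (\<lambda>x. indicator S x *\<^sub>R det (D x))" using int by (simp add: set_integrable_def)
  then have "integrable (distr lebesgue lebesgue ?\<sigma>) (\<lambda>x. indicator S x *\<^sub>R det (D x))"
    by (simp add: lebesgue_reindex(2)[OF q])
  then have "integrable lebesgue (\<lambda>y. indicator S (?\<sigma> y) *\<^sub>R det (D (?\<sigma> y)))"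
    by (rule integrable_distr[OF lebesgue_reindex(1)[OF q]])
  then have int': "set_integrable lebesgue ?S (\<lambda>y. det (D' y))"
    by (simp add: set_integrable_def det' indicator_def)
  note area = area_formula_wellorder[OF vimm[OF S] der' inj' int']
  have im: "f ` S = ?\<rho> -` (f' ` ?S)"
  proof -
    have "f' ` ?S = ?\<rho> ` f ` S"
    proof -
      have "f' ` ?\<rho> ` S = ?\<rho> ` f ` S" by (simp add: image_image f'_def)
      then show ?thesis by (simp add: vim(1)[of S])
    qed
    then show ?thesis by (simp add: vim(2)[symmetric] image_image)
  qed
  have em: "emeasure lebesgue (f ` S) = emeasure lebesgue (f' ` ?S)"
  proof -
    have "emeasure lebesgue (f' ` ?S) = emeasure (distr lebesgue lebesgue ?\<rho>) (f' ` ?S)"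
      by (simp add: lebesgue_reindex(2)[OF p])
    also have "\<dots> = emeasure lebesgue (?\<rho> -` (f' ` ?S))"
      using area(1) by (subst emeasure_distr[OF lebesgue_reindex(1)[OF p]]) auto
    finally show ?thesis by (simp add: im)
  qed
  show "f ` S \<in> lmeasurable"
  proof (rule fmeasurableI)
    show "f ` S \<in> sets lebesgue"
      unfolding im using area(1) by (intro vimm') auto
    show "emeasure lebesgue (f ` S) < \<infinity>"
      unfolding em using area(1) by (simp only: fmeasurable_def mem_Collect_eq infinity_ennreal_def)
  qed
  have "measure lebesgue (f ` S) = measure lebesgue (f' ` ?S)" by (simp add: measure_def em)
  also have "\<dots> = (LINT y|lebesgue. indicator S (?\<sigma> y) *\<^sub>R \<bar>det (D (?\<sigma> y))\<bar>)"
    using area(2) by (simp only: set_lebesgue_integral_def det' indicator_vimage[symmetric] o_def)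
  also have "\<dots> = (LINT x|distr lebesgue lebesgue ?\<sigma>. indicator S x *\<^sub>R \<bar>det (D x)\<bar>)"
  proof (rule integral_distr[OF lebesgue_reindex(1)[OF q], symmetric])
    have "set_integrable lebesgue S (\<lambda>x. \<bar>det (D x)\<bar>)" using int by (rule set_integrable_abs)
    then show "(\<lambda>x. indicator S x *\<^sub>R \<bar>det (D x)\<bar>) \<in> borel_measurable lebesgue"
      unfolding set_integrable_def by (rule borel_measurable_integrable)
  qed
  also have "\<dots> = (LINT x:S|lebesgue. \<bar>det (D x)\<bar>)"
    by (simp add: lebesgue_reindex(2)[OF q] set_lebesgue_integral_def)
  finally show "measure lebesgue (f ` S) = (LINT x:S|lebesgue. \<bar>det (D x)\<bar>)" .
qed

section \<open>Essentially injective deformations\<close>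

text \<open>Lebesgue measure is complete, so of two preimages that agree up to a null set one is
  measurable if the other is.\<close>

lemma borel_measurable_lebesgue_AE_cong:
  fixes f g :: "'a::euclidean_space \<Rightarrow> 'b::topological_space"
  assumes f: "f \<in> borel_measurable lebesgue" and eq: "AE x in lebesgue. f x = g x"
  shows "g \<in> borel_measurable lebesgue"
proof (rule measurableI)
  fix A :: "'b set" assume A: "A \<in> sets borel"
  have "AE x in lebesgue. x \<in> f -` A \<longleftrightarrow> x \<in> g -` A"
    using eq by eventually_elim simp
  moreover have "f -` A \<in> sets lebesgue" using measurable_sets[OF f A] by simp
  ultimately have "g -` A \<in> sets lebesgue"
    by (rule completion.in_sets_AE) simp
  then show "g -` A \<inter> space lebesgue \<in> sets lebesgue" by simp
qed simp

text \<open>The converse of Sard's lemma: near a point with injective derivative, \<open>f\<close> does not decrease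
  distances to that point by more than a constant factor, so \<open>A\<close> is a countable union of pieces on
  which \<open>f\<close> has a Lipschitz inverse.\<close>
lemma negligible_of_negligible_image:
  fixes f :: "'a::euclidean_space \<Rightarrow> 'a"
  assumes der: "\<And>x. x \<in> A \<Longrightarrow> (f has_derivative f' x) (at x)"
    and inj: "\<And>x. x \<in> A \<Longrightarrow> inj (f' x)" and neg: "negligible (f ` A)"
  shows "negligible A"
proof -
  define P where "P k = {x \<in> A. \<forall>y. norm (y - x) < 1 / real (Suc k) \<longrightarrow> norm (y - x) \<le> real (Suc k) * norm (f y - f x)}" for k
  obtain D :: "'a set" where D: "countable D" "\<And>S. open S \<Longrightarrow> S \<noteq> {} \<Longrightarrow> \<exists>q\<in>D. q \<in> S"
    using countable_dense_exists by blast
  have "\<exists>k. x \<in> P k" if x: "x \<in> A" for x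
  proof -
    have lin: "linear (f' x)" using der[OF x] has_derivative_linear by blast
    obtain B where B: "B > 0" "\<And>v. B * norm v \<le> norm (f' x v)"
      using linear_inj_bounded_below_pos[OF lin inj[OF x]] by metis
    obtain d where d: "d > 0" "\<And>y. norm (y - x) < d \<Longrightarrow> norm (f y - f x - f' x (y - x)) \<le> B / 2 * norm (y - x)"
      using der[OF x] B(1) unfolding has_derivative_at_alt by (metis half_gt_zero)
    obtain k where k: "1 / real (Suc k) < d" "2 / B \<le> real (Suc k)"
    proof -
      obtain k1 where "1 / real (Suc k1) < d" using d(1) nat_approx_posE by blast
      moreover obtain k2 where "2 / B \<le> real k2" using real_arch_simple by blast
      moreover have "1 / real (Suc (k1 + k2)) \<le> 1 / real (Suc k1)" by (simp add: frac_le)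
      ultimately show thesis by (intro that[of "k1 + k2"]) auto
    qed
    have "norm (y - x) \<le> real (Suc k) * norm (f y - f x)" if y: "norm (y - x) < 1 / real (Suc k)" for y
    proof -
      have "B * norm (y - x) \<le> norm (f' x (y - x))" by (rule B(2))
      also have "\<dots> \<le> norm (f y - f x) + norm (f y - f x - f' x (y - x))"
        by (metis norm_triangle_sub norm_minus_commute add.commute)
      also have "\<dots> \<le> norm (f y - f x) + B / 2 * norm (y - x)" using d(2)[of y] y k by simp
      finally have "norm (y - x) \<le> (2 / B) * norm (f y - f x)" using B(1) by (simp add: field_simps)
      also have "\<dots> \<le> real (Suc k) * norm (f y - f x)" using k by (intro mult_right_mono) auto
      finally show ?thesis .
    qed
    then show ?thesis using x by (auto simp: P_def)
  qed
  note Pk = this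
  \<comment> \<open>With this radius two points of the same ball are closer than
    \<open>1 / real (Suc k)\<close>, as the estimate defining \<open>P k\<close> demands.\<close>
  have Dq: "\<exists>q\<in>D. x \<in> ball q (1 / (2 * real (Suc k)))" for x k
    using D(2)[of "ball x (1 / (2 * real (Suc k)))"] by (auto simp: dist_commute)
  have cover: "A \<subseteq> (\<Union>(k, q) \<in> UNIV \<times> D. P k \<inter> ball q (1 / (2 * real (Suc k))))"
  proof
    fix x assume "x \<in> A"
    then obtain k where k: "x \<in> P k" using Pk by blast
    obtain q where "q \<in> D" "x \<in> ball q (1 / (2 * real (Suc k)))" using Dq by blast
    with k show "x \<in> (\<Union>(k, q) \<in> UNIV \<times> D. P k \<inter> ball q (1 / (2 * real (Suc k))))"
      by (intro UN_I[of "(k, q)"]) auto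
  qed
  have "negligible (P k \<inter> ball q (1 / (2 * real (Suc k))))" (is "negligible ?P") for k q
  proof -
    have low: "norm (x - y) \<le> real (Suc k) * norm (f x - f y)" if "x \<in> ?P" "y \<in> ?P" for x y
    proof -
      have "dist x y < 1 / (2 * real (Suc k)) + 1 / (2 * real (Suc k))"
        using that by (intro le_less_trans[OF dist_triangle2[of x y q]] add_strict_mono) (auto simp: dist_commute)
      then have "norm (x - y) < 1 / real (Suc k)" by (simp add: dist_norm field_simps)
      then show ?thesis using that by (auto simp: P_def)
    qed
    have injP: "inj_on f ?P"
      using low by (intro inj_onI) (metis mult_zero_right norm_le_zero_iff norm_zero right_minus_eq)
    define g where "g = inv_into ?P f"
    have "negligible (g ` (f ` ?P))"
    proof (rule negligible_locally_Lipschitz_image)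
      show "negligible (f ` ?P)" by (rule negligible_subset[OF neg]) (auto simp: P_def)
      show "\<exists>T B. open T \<and> z \<in> T \<and> (\<forall>w\<in>f ` ?P \<inter> T. norm (g w - g z) \<le> B * norm (w - z))" if "z \<in> f ` ?P" for z
        using that low injP
        by (intro exI[of _ UNIV] exI[of _ "real (Suc k)"]) (auto simp: g_def inv_into_f_f)
    qed simp
    then show ?thesis using injP by (simp add: g_def)
  qed
  then have "negligible (\<Union>(k, q) \<in> UNIV \<times> D. P k \<inter> ball q (1 / (2 * real (Suc k))))"
    using D(1) by (intro negligible_countable_Union) auto
  then show ?thesis using cover negligible_subset by blast
qed

lemma continuous_on_det: "continuous_on S (det :: real^'n::finite^'n \<Rightarrow> real)"
  unfolding det_def[abs_def] by (intro continuous_intros)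

section \<open>Injectivity almost everywhere and the area formula for a deformation\<close>

locale deformation =
  fixes U :: "(real^'n::finite) set" and u :: "real^'n \<Rightarrow> real^'n" and Du :: "real^'n \<Rightarrow> real^'n^'n" and lam :: real
  assumes U: "open U" "bounded U" and u: "u \<in> W1inf U" and Du: "has_weak_jacobian u Du U"
    and ess_inj: "essentially_injective U u"
    and lam: "0 < lam" "AE x in lebesgue_on U. lam \<le> det (Du x)"
begin

lemma U_lmeasurable: "U \<in> lmeasurable"
  using U by (simp add: lmeasurable_open)

lemma u_cont: "continuous_on U u"
  using u by (simp add: W1inf_def)

text \<open>The essential bound holds everywhere: by continuity the set where it fails is open, and
  a nonempty open set is not null.\<close>

lemma u_bounded: obtains C where "\<And>x. x \<in> U \<Longrightarrow> norm (u x) \<le> C"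
proof -
  obtain C where C: "AE x in lebesgue_on U. norm (u x) \<le> C"
    using u by (auto simp: W1inf_def Linf_def)
  have "norm (u x) \<le> C" if x: "x \<in> U" for x
  proof (rule ccontr)
    assume "\<not> norm (u x) \<le> C"
    moreover have "open (U \<inter> u -` {y. C < norm y})"
      by (intro continuous_open_preimage u_cont U open_Collect_less continuous_intros)
    ultimately have "\<not> negligible (U \<inter> u -` {y. C < norm y})"
      using open_not_negligible x by (auto simp: not_le)
    moreover have "AE x in lebesgue. x \<notin> U \<inter> u -` {y. C < norm y}"
      using C U by (simp add: AE_lebesgue_on_iff not_less)
    then have "U \<inter> u -` {y. C < norm y} \<in> null_sets lebesgue"
      by (simp add: completion.null_sets_iff_AE)
    ultimately show False by (simp add: negligible_iff_null_sets)
  qed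
  then show thesis using that by blast
qed

text \<open>Essential injectivity excludes only a null set of values. Because
  \<open>det (Du x)\<close> is positive, the points of differentiability that are mapped into a null
  set form a null set themselves; hence almost every point of \<open>U\<close> has a value that is
  taken only once.\<close>

lemma good_set:
  obtains X C where "X \<in> sets lebesgue" "X \<subseteq> U" "negligible (U - X)" "inj_on u X"
    "\<And>x. x \<in> X \<Longrightarrow> (u has_derivative (\<lambda>v. Du x *v v)) (at x)"
    "\<And>x. x \<in> X \<Longrightarrow> lam \<le> det (Du x)" "\<And>x. x \<in> X \<Longrightarrow> norm (Du x) \<le> C"
proof -
  obtain G C where G: "has_weak_jacobian u G U" and C: "AE x in lebesgue_on U. norm (G x) \<le> C"
    using u by (auto simp: W1inf_def Linf_def)
  define Y where "Y = {x \<in> U. (u has_derivative (\<lambda>v. Du x *v v)) (at x) \<and> lam \<le> det (Du x) \<and> norm (Du x) \<le> C}"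
  have "AE x in lebesgue. x \<in> U \<longrightarrow> x \<in> Y"
    using W1inf_has_derivative[OF U(1) u Du] weak_jacobian_unique[OF U(1) u Du G]
      C[unfolded AE_lebesgue_on_iff[OF fmeasurableD[OF U_lmeasurable]]]
      lam(2)[unfolded AE_lebesgue_on_iff[OF fmeasurableD[OF U_lmeasurable]]]
    by eventually_elim (auto simp: Y_def)
  then have "AE x in lebesgue. x \<notin> U - Y" by eventually_elim auto
  then have nY: "negligible (U - Y)"
    by (simp add: negligible_iff_null_sets completion.null_sets_iff_AE)
  have "AE y in lebesgue. multiplicity_fun u U y \<le> 1"
    using ess_inj esssup_AE unfolding essentially_injective_def by metis
  then have nB: "negligible {y. \<not> multiplicity_fun u U y \<le> 1}" (is "negligible ?B")
    by (simp add: negligible_iff_null_sets completion.AE_iff_null_sets)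
  define X where "X = Y - u -` ?B"
  have nYB: "negligible (Y \<inter> u -` ?B)"
  proof (rule negligible_of_negligible_image[where f=u and f'="\<lambda>x v. Du x *v v"])
    fix x assume x: "x \<in> Y \<inter> u -` ?B"
    then show "(u has_derivative (\<lambda>v. Du x *v v)) (at x)" by (simp add: Y_def)
    have "det (Du x) \<noteq> 0" using x lam(1) by (auto simp: Y_def)
    then show "inj (\<lambda>v. Du x *v v)"
      by (simp add: invertible_det_nz[symmetric] inj_matrix_vector_mult)
  next
    show "negligible (u ` (Y \<inter> u -` ?B))" by (rule negligible_subset[OF nB]) auto
  qed
  have nX: "negligible (U - X)"
    by (rule negligible_subset[OF negligible_Un[OF nY nYB]]) (auto simp: X_def)
  show thesis
  proof
    show "X \<subseteq> U" by (auto simp: X_def Y_def)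
    have "X = U - (U - X)" using \<open>X \<subseteq> U\<close> by blast
    then show "X \<in> sets lebesgue"
      using nX U_lmeasurable by (metis fmeasurableD negligible_imp_sets sets.Diff)
    show "inj_on u X"
    proof (rule inj_onI, rule ccontr)
      fix x y assume xy: "x \<in> X" "y \<in> X" "u x = u y" "x \<noteq> y"
      then have "{x, y} \<subseteq> U \<inter> u -` {u x}" using \<open>X \<subseteq> U\<close> by auto
      then have "emeasure (count_space UNIV) {x, y} \<le> multiplicity_fun u U (u x)"
        unfolding multiplicity_fun_def by (intro emeasure_mono) auto
      also have "\<dots> \<le> 1" using xy(1) by (simp add: X_def)
      finally show False using xy(4) by (simp add: emeasure_count_space)
    qed
  qed (use nX in \<open>auto simp: X_def Y_def\<close>)
qed

text \<open>Measurability comes from the bounded Jacobian in \<open>W1inf\<close>, which agrees with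
  \<open>Du\<close> almost everywhere; the bound comes from the compactness of closed balls of
  matrices.\<close>

lemma det_set_integrable: "set_integrable lebesgue U (\<lambda>x. det (Du x))"
proof -
  obtain G C where G: "has_weak_jacobian u G U" and C: "AE x in lebesgue_on U. norm (G x) \<le> C"
    and Gm: "G \<in> borel_measurable (lebesgue_on U)"
    using u by (auto simp: W1inf_def Linf_def)
  have Um: "U \<in> sets lebesgue" using U_lmeasurable by auto
  have "(\<lambda>x. indicator U x *\<^sub>R G x) \<in> borel_measurable lebesgue"
    using Gm Um by (simp add: borel_measurable_restrict_space_iff)
  then have "(\<lambda>x. det (indicator U x *\<^sub>R G x)) \<in> borel_measurable lebesgue"
    by (rule measurable_compose) (intro borel_measurable_continuous_onI continuous_on_det)
  then have "(\<lambda>x. indicator U x *\<^sub>R det (indicator U x *\<^sub>R G x)) \<in> borel_measurable lebesgue"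
    using Um by (intro borel_measurable_scaleR borel_measurable_indicator) auto
  then have m: "(\<lambda>x. indicator U x *\<^sub>R det (Du x)) \<in> borel_measurable lebesgue"
  proof (rule borel_measurable_lebesgue_AE_cong)
    show "AE x in lebesgue. indicator U x *\<^sub>R det (indicator U x *\<^sub>R G x) = indicator U x *\<^sub>R det (Du x)"
      using weak_jacobian_unique[OF U(1) u Du G] by eventually_elim (auto simp: indicator_def)
  qed
  obtain X K where X: "negligible (U - X)" "\<And>x. x \<in> X \<Longrightarrow> norm (Du x) \<le> K"
    using good_set by metis
  have "compact (det ` cball (0 :: real^'n^'n) K)"
    by (intro compact_continuous_image compact_cball continuous_on_det)
  then obtain B where B: "\<And>A. A \<in> cball (0 :: real^'n^'n) K \<Longrightarrow> \<bar>det A\<bar> \<le> B"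
    using compact_imp_bounded bounded_iff by (metis imageI real_norm_def)
  show ?thesis
    unfolding set_integrable_def
  proof (rule Bochner_Integration.integrable_bound[OF _ m])
    show "integrable lebesgue (\<lambda>x. indicator U x *\<^sub>R B)"
      using U_lmeasurable by (intro integrable_scaleR_left) (auto simp: fmeasurable_def)
    have "AE x in lebesgue. x \<notin> U - X"
      using X(1) unfolding negligible_iff_null_sets by (rule AE_not_in)
    then show "AE x in lebesgue. norm (indicator U x *\<^sub>R det (Du x)) \<le> norm (indicator U x *\<^sub>R B)"
    proof eventually_elim
      fix x assume "x \<notin> U - X"
      then show "norm (indicator U x *\<^sub>R det (Du x)) \<le> norm (indicator U x *\<^sub>R B)"
        using B[of "Du x"] X(2)[of x] by (auto simp: indicator_def)
    qed
  qed
qed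

lemma preimage_measurable: "E \<in> sets borel \<Longrightarrow> U \<inter> u -` E \<in> sets lebesgue"
proof -
  assume E: "E \<in> sets borel"
  have "u \<in> borel_measurable (lebesgue_on U)" using u by (simp add: W1inf_def Linf_def)
  from measurable_sets[OF this E] show ?thesis
    using U_lmeasurable by (auto simp: sets_restrict_space_iff space_restrict_space Int_commute)
qed

text \<open>One set \<open>X\<close> serves every \<open>E\<close>, so that its image can act as the
  target set when \<open>u\<close> is shown to be measure preserving. On \<open>X\<close> the
  determinant is positive, which removes the absolute value of the area formula.\<close>

lemma area_U:
  obtains X where "X \<in> sets lebesgue" "X \<subseteq> U" "negligible (U - X)" "inj_on u X"
    "\<And>E. E \<in> sets borel \<Longrightarrow> u ` (X \<inter> u -` E) \<in> lmeasurable \<and>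
       measure lebesgue (u ` (X \<inter> u -` E)) = (LINT x:U \<inter> u -` E|lebesgue. det (Du x))"
proof -
  obtain X C where X: "X \<in> sets lebesgue" "X \<subseteq> U" "negligible (U - X)" "inj_on u X"
    "\<And>x. x \<in> X \<Longrightarrow> (u has_derivative (\<lambda>v. Du x *v v)) (at x)"
    "\<And>x. x \<in> X \<Longrightarrow> lam \<le> det (Du x)"
    by (rule good_set) (rule that)
  show thesis
  proof
    fix E :: "(real^'n) set" assume E: "E \<in> sets borel"
    let ?S = "X \<inter> u -` E"
    have S: "?S \<in> sets lebesgue"
    proof -
      have "?S = X \<inter> (U \<inter> u -` E)" using X by blast
      then show ?thesis using X(1) preimage_measurable[OF E] by (metis sets.Int)
    qed
    have "set_integrable lebesgue ?S (\<lambda>x. det (Du x))"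
      by (rule set_integrable_subset[OF det_set_integrable S]) (use X in auto)
    note int_S = this
    then have "u ` ?S \<in> lmeasurable" "measure lebesgue (u ` ?S) = (LINT x:?S|lebesgue. \<bar>det (Du x)\<bar>)"
      using area_formula[OF S, of u Du] X(5) inj_on_subset[OF X(4)] has_derivative_at_withinI by blast+
    moreover have "(LINT x:?S|lebesgue. \<bar>det (Du x)\<bar>) = (LINT x:U \<inter> u -` E|lebesgue. det (Du x))"
      unfolding set_lebesgue_integral_def
    proof (rule integral_cong_AE)
      have "set_integrable lebesgue ?S (\<lambda>x. \<bar>det (Du x)\<bar>)"
        using int_S by (rule set_integrable_abs)
      then show "(\<lambda>x. indicator ?S x *\<^sub>R \<bar>det (Du x)\<bar>) \<in> borel_measurable lebesgue"
        unfolding set_integrable_def by (rule borel_measurable_integrable)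
      have "set_integrable lebesgue (U \<inter> u -` E) (\<lambda>x. det (Du x))"
        by (rule set_integrable_subset[OF det_set_integrable preimage_measurable[OF E]]) auto
      then show "(\<lambda>x. indicator (U \<inter> u -` E) x *\<^sub>R det (Du x)) \<in> borel_measurable lebesgue"
        unfolding set_integrable_def by (rule borel_measurable_integrable)
      have "AE x in lebesgue. x \<notin> U - X"
        using X(3) unfolding negligible_iff_null_sets by (rule AE_not_in)
      then show "AE x in lebesgue. indicator ?S x *\<^sub>R \<bar>det (Du x)\<bar> = indicator (U \<inter> u -` E) x *\<^sub>R det (Du x)"
      proof eventually_elim
        fix x assume "x \<notin> U - X"
        then show "indicator ?S x *\<^sub>R \<bar>det (Du x)\<bar> = indicator (U \<inter> u -` E) x *\<^sub>R det (Du x)"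
          using X(2,6) lam(1) by (cases "x \<in> X") (force simp: indicator_def)+
      qed
    qed
    ultimately show "u ` ?S \<in> lmeasurable \<and> measure lebesgue (u ` ?S) = (LINT x:U \<inter> u -` E|lebesgue. det (Du x))"
      by simp
  qed (fact X)+
qed

end

text \<open>Both measures are finite, so it is enough to compare their real values on Borel
  sets.\<close>

lemma measure_preservingI:
  fixes A B :: "(real^'n::finite) set"
  assumes A: "A \<in> lmeasurable" and s: "s \<in> Linf A" and B: "B \<in> lmeasurable"
    and eq: "\<And>E. E \<in> sets borel \<Longrightarrow> A \<inter> s -` E \<in> sets lebesgue \<Longrightarrow> measure lebesgue (A \<inter> s -` E) = measure lebesgue (B \<inter> E)"
  shows "measure_preserving A s"
  unfolding measure_preserving_def
proof (intro conjI bexI)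
  show "distr (lebesgue_on A) borel s = distr (lebesgue_on B) borel (\<lambda>y. y)"
  proof (rule measure_eqI)
    fix E assume "E \<in> sets (distr (lebesgue_on A) borel s)"
    then have E: "E \<in> sets borel" by simp
    have s': "s \<in> borel_measurable (lebesgue_on A)" using s by (simp add: Linf_def)
    have i: "(\<lambda>y. y) \<in> borel_measurable (lebesgue_on B)"
      by (rule measurable_restrict_space1) (simp add: measurable_completion)
    have 1: "s -` E \<inter> A \<in> sets lebesgue"
      using measurable_sets[OF s' E] A by (auto simp: sets_restrict_space_iff)
    have "E \<in> sets lebesgue" using E by simp
    then have 2: "E \<inter> B \<in> sets lebesgue" using B by (intro sets.Int) auto
    have m1: "s -` E \<inter> A \<in> lmeasurable" by (rule fmeasurableI2[OF A]) (use 1 in auto)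
    have m2: "E \<inter> B \<in> lmeasurable" by (rule fmeasurableI2[OF B]) (use 2 in auto)
    have "emeasure (distr (lebesgue_on A) borel s) E = emeasure lebesgue (s -` E \<inter> A)"
      using A 1 by (subst emeasure_distr[OF s' E]) (auto simp: emeasure_restrict_space)
    also have "\<dots> = emeasure lebesgue (E \<inter> B)"
      using eq[OF E] 1 m1 m2 by (simp add: emeasure_eq_measure2 Int_commute)
    also have "\<dots> = emeasure (distr (lebesgue_on B) borel (\<lambda>y. y)) E"
      using B 2 by (subst emeasure_distr[OF i E]) (auto simp: emeasure_restrict_space)
    finally show "emeasure (distr (lebesgue_on A) borel s) E = emeasure (distr (lebesgue_on B) borel (\<lambda>y. y)) E" .
  qed simp
qed (use A B s in auto)

section \<open>Comparing the volume of a set with that of its preimage\<close>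

context deformation
begin

text \<open>The image of the good part of the preimage lies in \<open>E\<close>. In other words,
  \<open>u\<close> pushes the measure with density \<open>det Du\<close> to a measure below Lebesgue
  measure.\<close>

lemma integral_det_preimage_le:
  assumes E: "E \<in> sets borel" "E \<in> lmeasurable"
  shows "(LINT x:U \<inter> u -` E|lebesgue. det (Du x)) \<le> measure lebesgue E"
proof -
  obtain X where "u ` (X \<inter> u -` E) \<in> lmeasurable"
       "measure lebesgue (u ` (X \<inter> u -` E)) = (LINT x:U \<inter> u -` E|lebesgue. det (Du x))"
    using area_U E by metis
  moreover have "measure lebesgue (u ` (X \<inter> u -` E)) \<le> measure lebesgue E"
    using E calculation(1) by (intro measure_mono_fmeasurable) auto
  ultimately show ?thesis by simp
qed

text \<open>Only compression counts: where \<open>det Du\<close> is at least 1, the image offers at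
  least as much room as is needed.\<close>

definition excess :: real where
  "excess = (LINT x:U|lebesgue. max 0 (1 - det (Du x)))"

lemma const_set_integrable: "S \<in> lmeasurable \<Longrightarrow> set_integrable lebesgue S (\<lambda>_. c :: real)"
  unfolding set_integrable_def by (intro integrable_scaleR_left) (auto simp: fmeasurable_def)

lemma one_minus_det_integrable: "set_integrable lebesgue U (\<lambda>x. 1 - det (Du x))"
  by (intro set_integral_diff(1) const_set_integrable det_set_integrable U_lmeasurable)

lemma abs_one_minus_det_integrable: "set_integrable lebesgue U (\<lambda>x. \<bar>1 - det (Du x)\<bar>)"
  by (rule set_integrable_abs[OF one_minus_det_integrable])

lemma excess_integrable: "set_integrable lebesgue U (\<lambda>x. max 0 (1 - det (Du x)))"
proof -
  have "set_integrable lebesgue U (\<lambda>x. (1 / 2) *\<^sub>R (\<bar>1 - det (Du x)\<bar> + (1 - det (Du x))))"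
    using one_minus_det_integrable abs_one_minus_det_integrable
    by (intro set_integrable_scaleR_right set_integral_add(1))
  moreover have "(1 / 2) *\<^sub>R (\<bar>1 - det (Du x)\<bar> + (1 - det (Du x))) = max 0 (1 - det (Du x))" for x
    by (auto simp: max_def)
  ultimately show ?thesis by simp
qed

lemma preimage_lmeasurable: "E \<in> sets borel \<Longrightarrow> U \<inter> u -` E \<in> lmeasurable"
  by (rule fmeasurableI2[OF U_lmeasurable]) (auto intro: preimage_measurable)

text \<open>Pointwise \<open>1 \<le> det (Du x) + max 0 (1 - det (Du x))\<close>, and the first
  summand integrates to at most the measure of \<open>E\<close>. This is the Hall-type condition
  behind the assignment of cubes: up to the excess, no region attracts more volume than it can
  hold.\<close>

lemma measure_preimage_le_excess:
  assumes E: "E \<in> sets borel" "E \<in> lmeasurable"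
  shows "measure lebesgue (U \<inter> u -` E) \<le> measure lebesgue E + excess"
proof -
  let ?S = "U \<inter> u -` E"
  have S: "?S \<in> lmeasurable" by (rule preimage_lmeasurable[OF E(1)])
  have d: "set_integrable lebesgue ?S (\<lambda>x. det (Du x))"
    by (rule set_integrable_subset[OF det_set_integrable]) (use S in auto)
  have m: "set_integrable lebesgue ?S (\<lambda>x. max 0 (1 - det (Du x)))"
    by (rule set_integrable_subset[OF excess_integrable]) (use S in auto)
  have "measure lebesgue ?S = (LINT x:?S|lebesgue. 1)"
    using S by (simp add: set_lebesgue_integral_def)
  also have "\<dots> \<le> (LINT x:?S|lebesgue. det (Du x) + max 0 (1 - det (Du x)))"
    by (intro set_integral_mono const_set_integrable S set_integral_add(1) d m) auto
  also have "\<dots> = (LINT x:?S|lebesgue. det (Du x)) + (LINT x:?S|lebesgue. max 0 (1 - det (Du x)))"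
    by (rule set_integral_add(2)[OF d m])
  also have "(LINT x:?S|lebesgue. max 0 (1 - det (Du x))) \<le> excess"
    unfolding excess_def set_lebesgue_integral_def
    using m excess_integrable unfolding set_integrable_def
    by (intro integral_mono) (auto simp: indicator_def)
  finally show ?thesis using integral_det_preimage_le[OF E] by linarith
qed

text \<open>Applied to a ball of radius \<open>d\<close> containing the image, this shows that the
  ball of radius \<open>d / lam powr (1 / n)\<close> has at least the volume of \<open>U\<close>,
  hence room for the displaced cubes.\<close>

lemma lam_measure_le:
  assumes E: "E \<in> sets borel" "E \<in> lmeasurable" "u ` U \<subseteq> E"
  shows "lam * measure lebesgue U \<le> measure lebesgue E"
proof -
  have UE: "U \<inter> u -` E = U" using E(3) by auto
  have "lam * measure lebesgue U = (LINT x:U|lebesgue. lam)"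
    using U_lmeasurable by (simp add: set_lebesgue_integral_def)
  also have "\<dots> \<le> (LINT x:U|lebesgue. det (Du x))"
    using const_set_integrable[OF U_lmeasurable] det_set_integrable
      lam(2)[unfolded AE_lebesgue_on_iff[OF fmeasurableD[OF U_lmeasurable]]]
    by (intro set_integral_mono_AE) auto
  also have "\<dots> \<le> measure lebesgue E"
    using integral_det_preimage_le[OF E(1,2)] UE by simp
  finally show ?thesis .
qed

lemma total_defect: "(LINT x|lebesgue_on U. \<bar>1 - det (Du x)\<bar>) = (LINT x:U|lebesgue. \<bar>1 - det (Du x)\<bar>)"
  using U_lmeasurable by (simp add: integral_restrict_space set_lebesgue_integral_def)

lemma excess_le: "0 \<le> excess" "excess \<le> (LINT x|lebesgue_on U. \<bar>1 - det (Du x)\<bar>)"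
proof -
  show "0 \<le> excess"
    unfolding excess_def set_lebesgue_integral_def by (intro Bochner_Integration.integral_nonneg) auto
  show "excess \<le> (LINT x|lebesgue_on U. \<bar>1 - det (Du x)\<bar>)"
    unfolding excess_def total_defect
    by (intro set_integral_mono excess_integrable abs_one_minus_det_integrable) auto
qed

text \<open>When \<open>lam\<close> exceeds 1, the radius \<open>d / lam powr (1 / n)\<close> is
  smaller than \<open>d\<close>, and a cost proportional to \<open>d\<close> could not be absorbed
  by it; the coefficient of that cost then vanishes.\<close>

lemma excess_eq_0: "1 \<le> lam \<Longrightarrow> excess = 0"
proof -
  assume "1 \<le> lam"
  have "AE x in lebesgue. x \<in> U \<longrightarrow> lam \<le> det (Du x)"
    using lam(2) U_lmeasurable by (simp add: AE_lebesgue_on_iff fmeasurableD)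
  then have "AE x in lebesgue. indicator U x *\<^sub>R max 0 (1 - det (Du x)) = 0"
    by eventually_elim (use \<open>1 \<le> lam\<close> in \<open>auto simp: indicator_def\<close>)
  then show ?thesis
    unfolding excess_def set_lebesgue_integral_def by (rule integral_eq_zero_AE)
qed

lemma measure_preserving_u:
  assumes "(LINT x|lebesgue_on U. \<bar>1 - det (Du x)\<bar>) = 0"
  shows "measure_preserving U u"
proof -
  have "(LINT x|lebesgue. indicator U x *\<^sub>R \<bar>1 - det (Du x)\<bar>) = 0"
    using assms unfolding total_defect set_lebesgue_integral_def .
  moreover have "integrable lebesgue (\<lambda>x. indicator U x *\<^sub>R \<bar>1 - det (Du x)\<bar>)"
    using abs_one_minus_det_integrable by (simp add: set_integrable_def)
  ultimately have "AE x in lebesgue. indicator U x *\<^sub>R \<bar>1 - det (Du x)\<bar> = 0"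
    by (subst (asm) integral_nonneg_eq_0_iff_AE) auto
  then have d1: "AE x in lebesgue. x \<in> U \<longrightarrow> det (Du x) = 1"
    by eventually_elim (auto simp: indicator_def)
  obtain X where X: "X \<subseteq> U" "inj_on u X"
    and area: "\<And>E. E \<in> sets borel \<Longrightarrow> u ` (X \<inter> u -` E) \<in> lmeasurable \<and>
       measure lebesgue (u ` (X \<inter> u -` E)) = (LINT x:U \<inter> u -` E|lebesgue. det (Du x))"
    using area_U by metis
  show ?thesis
  proof (rule measure_preservingI[OF U_lmeasurable])
    show "u \<in> Linf U" using u by (simp add: W1inf_def)
    show "u ` X \<in> lmeasurable" using area[of UNIV] by simp
    fix E :: "(real^'n) set" assume E: "E \<in> sets borel"
    have S: "U \<inter> u -` E \<in> lmeasurable" by (rule preimage_lmeasurable[OF E])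
    have "measure lebesgue (U \<inter> u -` E) = (LINT x:U \<inter> u -` E|lebesgue. 1)"
      using S by (simp add: set_lebesgue_integral_def)
    also have "\<dots> = (LINT x:U \<inter> u -` E|lebesgue. det (Du x))"
      unfolding set_lebesgue_integral_def
    proof (rule integral_cong_AE)
      have "set_integrable lebesgue (U \<inter> u -` E) (\<lambda>x. det (Du x))"
        by (rule set_integrable_subset[OF det_set_integrable]) (use S in auto)
      then show "(\<lambda>x. indicator (U \<inter> u -` E) x *\<^sub>R det (Du x)) \<in> borel_measurable lebesgue"
        unfolding set_integrable_def by (rule borel_measurable_integrable)
      show "(\<lambda>x. indicator (U \<inter> u -` E) x *\<^sub>R (1::real)) \<in> borel_measurable lebesgue"
        using const_set_integrable[OF S, of 1] unfolding set_integrable_def by (rule borel_measurable_integrable)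
      show "AE x in lebesgue. indicator (U \<inter> u -` E) x *\<^sub>R 1 = indicator (U \<inter> u -` E) x *\<^sub>R det (Du x)"
        using d1 by eventually_elim (auto simp: indicator_def)
    qed
    also have "\<dots> = measure lebesgue (u ` (X \<inter> u -` E))" using area[OF E] by simp
    also have "u ` (X \<inter> u -` E) = u ` X \<inter> E" by auto
    finally show "measure lebesgue (U \<inter> u -` E) = measure lebesgue (u ` X \<inter> E)" .
  qed
qed

end

section \<open>Volume-preserving $C^1$ diffeomorphisms\<close>

text \<open>Bijections of the whole space are taken, so that compositions need no matching of
  domains.\<close>

definition unimodular_C1 :: "(real^'n::finite \<Rightarrow> real^'n) \<Rightarrow> bool" where
  "unimodular_C1 \<Phi> \<longleftrightarrow> bij \<Phi> \<and> (\<exists>G. continuous_on UNIV G \<and>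
     (\<forall>x. (\<Phi> has_derivative (\<lambda>v. G x *v v)) (at x)) \<and> (\<forall>x. det (G x) = 1))"

lemma unimodular_C1_translation: "unimodular_C1 (\<lambda>x :: real^'n::finite. x + c)"
proof -
  have "((\<lambda>x. x + c) has_derivative (\<lambda>v. mat 1 *v v)) (at x)" for x
    unfolding matrix_vector_mul_lid by (auto intro!: derivative_eq_intros)
  moreover have "bij (\<lambda>x. x + c)"
    by (rule bij_betw_byWitness[where f'="\<lambda>x. x - c"]) auto
  moreover have "continuous_on UNIV (\<lambda>_ :: real^'n. mat 1 :: real^'n^'n)" by (rule continuous_on_const)
  moreover have "det (mat 1 :: real^'n^'n) = 1" by simp
  ultimately show ?thesis
    unfolding unimodular_C1_def by (intro conjI exI[of _ "\<lambda>_. mat 1"] allI)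
qed

lemma unimodular_C1_id: "unimodular_C1 (\<lambda>x :: real^'n::finite. x)"
  using unimodular_C1_translation[of 0] by (simp only: add_0_right)

lemma unimodular_C1_comp:
  assumes "unimodular_C1 \<Phi>" "unimodular_C1 \<Psi>"
  shows "unimodular_C1 (\<lambda>x. \<Psi> (\<Phi> x))"
proof -
  obtain F where F: "continuous_on UNIV F" "\<And>x. (\<Phi> has_derivative (\<lambda>v. F x *v v)) (at x)" "\<And>x. det (F x) = 1"
    using assms(1) by (auto simp: unimodular_C1_def)
  obtain G where G: "continuous_on UNIV G" "\<And>x. (\<Psi> has_derivative (\<lambda>v. G x *v v)) (at x)" "\<And>x. det (G x) = 1"
    using assms(2) by (auto simp: unimodular_C1_def)
  have \<Phi>: "continuous_on UNIV \<Phi>"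
    using F(2) by (meson continuous_at_imp_continuous_on has_derivative_continuous)
  show ?thesis
    unfolding unimodular_C1_def
  proof (intro conjI exI[of _ "\<lambda>x. G (\<Phi> x) ** F x"] allI)
    show "bij (\<lambda>x. \<Psi> (\<Phi> x))"
      using assms bij_comp[of \<Phi> \<Psi>] by (simp add: unimodular_C1_def o_def)
    have "continuous_on UNIV (\<lambda>x. G (\<Phi> x))"
      by (rule continuous_on_compose2[OF G(1) \<Phi>]) auto
    then show "continuous_on UNIV (\<lambda>x. G (\<Phi> x) ** F x)"
      unfolding matrix_matrix_mult_def using F(1)
      by (intro continuous_intros) auto
    show "((\<lambda>x. \<Psi> (\<Phi> x)) has_derivative (\<lambda>v. (G (\<Phi> x) ** F x) *v v)) (at x)" for x
      using has_derivative_compose[OF F(2) G(2)] by (simp add: matrix_vector_mul_assoc)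
    show "det (G (\<Phi> x) ** F x) = 1" for x by (simp add: det_mul F(3) G(3))
  qed
qed

definition shear :: "'n \<Rightarrow> 'n \<Rightarrow> (real \<Rightarrow> real) \<Rightarrow> real^'n::finite \<Rightarrow> real^'n" where
  "shear k l g x = x + g (x $ l) *\<^sub>R axis k 1"

lemma shear_nth: "shear k l g x $ i = (if i = k then x $ i + g (x $ l) else x $ i)"
  by (simp add: shear_def axis_def)

text \<open>The Jacobian is the identity with \<open>g'\<close> times row \<open>l\<close> added to
  row \<open>k\<close>, so its determinant is 1. Since coordinate \<open>l\<close> is unchanged, the
  shear with \<open>- g\<close> is the inverse.\<close>

lemma unimodular_C1_shear:
  assumes kl: "k \<noteq> (l :: 'n::finite)" and g: "\<And>t. (g has_real_derivative g' t) (at t)" "continuous_on UNIV g'"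
  shows "unimodular_C1 (shear k l g)"
proof -
  define G where "G x = (\<chi> i. if i = k then row k (mat 1) + g' (x $ l) *s row l (mat 1) else row i (mat 1 :: real^'n^'n))" for x :: "real^'n"
  have Gv: "G x *v v = v + (g' (x $ l) * v $ l) *\<^sub>R axis k 1" for x v
  proof -
    have r: "(\<Sum>j\<in>UNIV. row i (mat 1 :: real^'n^'n) $ j * v $ j) = v $ i" for i
      by (simp add: row_def mat_def if_distrib[of "\<lambda>a. a * _"] cong: if_cong)
    have "(G x *v v) $ i = (v + (g' (x $ l) * v $ l) *\<^sub>R axis k 1) $ i" for i
    proof (cases "i = k")
      case True
      have "(G x *v v) $ k = (\<Sum>j\<in>UNIV. row k (mat 1 :: real^'n^'n) $ j * v $ j) + g' (x $ l) * (\<Sum>j\<in>UNIV. row l (mat 1 :: real^'n^'n) $ j * v $ j)"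
        by (simp add: G_def matrix_vector_mult_def distrib_right sum.distrib sum_distrib_left mult.assoc)
      then show ?thesis using True by (simp add: r)
    next
      case False
      then show ?thesis using r[of i] by (simp add: G_def matrix_vector_mult_def axis_def)
    qed
    then show ?thesis by (simp add: vec_eq_iff)
  qed
  show ?thesis
    unfolding unimodular_C1_def
  proof (intro conjI exI[of _ G] allI)
    show "bij (shear k l g)"
      by (rule bij_betw_byWitness[where f'="shear k l (\<lambda>t. - g t)"])
        (use kl in \<open>auto simp: vec_eq_iff shear_nth\<close>)
    have "continuous_on UNIV (\<lambda>x. g' (x $ l))"
      by (rule continuous_on_compose2[OF g(2)]) (auto intro!: continuous_intros)
    then have "continuous_on UNIV (\<lambda>x. G x $ i)" for i
      unfolding G_def vector_scalar_mult_def[symmetric]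
      by (cases "i = k") (auto simp: scalar_mult_eq_scaleR intro!: continuous_intros)
    then show "continuous_on UNIV G"
      using continuous_on_vec_lambda[of UNIV "\<lambda>i x. G x $ i"] by (simp add: vec_nth_inverse)
    show "(shear k l g has_derivative (\<lambda>v. G x *v v)) (at x)" for x
    proof -
      have "((\<lambda>x. g (x $ l)) has_derivative (\<lambda>v. g' (x $ l) * v $ l)) (at x)"
        by (rule has_derivative_compose[OF bounded_linear_imp_has_derivative[OF bounded_linear_vec_nth]
            g(1)[THEN has_field_derivative_imp_has_derivative]])
      then have "((\<lambda>x. x + g (x $ l) *\<^sub>R axis k 1) has_derivative (\<lambda>v. v + (g' (x $ l) * v $ l) *\<^sub>R axis k 1)) (at x)"
        by (auto intro!: derivative_eq_intros)
      moreover have "shear k l g = (\<lambda>x. x + g (x $ l) *\<^sub>R axis k 1)" by (simp add: fun_eq_iff shear_def)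
      ultimately show ?thesis by (simp add: Gv)
    qed
    show "det (G x) = 1" for x
      unfolding G_def using det_row_operation[OF kl, of "mat 1 :: real^'n^'n" "g' (x $ l)"] by simp
  qed
qed

text \<open>The difference quotients have integral 0 by translation invariance, and they converge
  dominatedly to the derivative: the mean value theorem bounds them uniformly, and increments of
  length at most 1 keep their supports in the ball of radius \<open>R + 1\<close>.\<close>

lemma integral_directional_derivative_eq_0:
  fixes F :: "'a::euclidean_space \<Rightarrow> real"
  assumes der: "\<And>x. (F has_derivative F' x) (at x)" and cont: "continuous_on UNIV (\<lambda>x. F' x e)"
    and R: "\<And>x. x \<notin> cball 0 R \<Longrightarrow> F x = 0" "\<And>x. x \<notin> cball 0 R \<Longrightarrow> F' x e = 0" and e: "norm e \<le> 1"
  shows "(LINT x|lborel. F' x e) = 0"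
proof -
  have Fc: "continuous_on UNIV F"
    using der by (meson continuous_at_imp_continuous_on has_derivative_continuous)
  then have Fm [measurable]: "F \<in> borel_measurable borel" by (rule borel_measurable_continuous_onI)
  have F'm [measurable]: "(\<lambda>x. F' x e) \<in> borel_measurable borel" using cont by (rule borel_measurable_continuous_onI)
  have "compact ((\<lambda>x. F' x e) ` cball 0 R)"
    by (intro compact_continuous_image continuous_on_subset[OF cont]) auto
  then have "bounded ((\<lambda>x. F' x e) ` cball 0 R)" by (rule compact_imp_bounded)
  then obtain B0 where "\<forall>y\<in>(\<lambda>x. F' x e) ` cball 0 R. norm y \<le> B0"
    unfolding bounded_iff by blast
  then have B0: "\<bar>F' x e\<bar> \<le> B0" if "x \<in> cball 0 R" for x using that by simp
  define B where "B = max B0 0"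
  have B: "B \<ge> 0" by (simp add: B_def)
  have B': "\<bar>F' x e\<bar> \<le> B" for x
  proof (cases "x \<in> cball 0 R")
    case True
    from B0[OF True] show ?thesis by (simp add: B_def)
  next
    case False
    from R(2)[OF False] show ?thesis using B by simp
  qed
  define h where "h n x = real (Suc n) * (F (x + (1 / real (Suc n)) *\<^sub>R e) - F x)" for n x
  have hB: "\<bar>h n x\<bar> \<le> B * indicator (cball 0 (R + 1)) x" for n x
  proof (cases "x \<in> cball 0 (R + 1)")
    case True
    let ?t = "1 / real (Suc n)"
    have "((\<lambda>t. F (x + t *\<^sub>R e)) has_real_derivative F' (x + t *\<^sub>R e) e) (at t)" for t
    proof -
      have "((\<lambda>t. F (x + t *\<^sub>R e)) has_derivative (\<lambda>s. F' (x + t *\<^sub>R e) (s *\<^sub>R e))) (at t)"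
        by (rule has_derivative_compose[OF _ der]) (auto intro!: derivative_eq_intros)
      moreover have "(\<lambda>s. F' (x + t *\<^sub>R e) (s *\<^sub>R e)) = (*) (F' (x + t *\<^sub>R e) e)"
        using linear_cmul[OF has_derivative_linear[OF der]] by (simp add: fun_eq_iff mult.commute)
      ultimately show ?thesis by (simp add: has_field_derivative_def)
    qed
    then obtain z where "F (x + ?t *\<^sub>R e) - F (x + 0 *\<^sub>R e) = (?t - 0) * F' (x + z *\<^sub>R e) e"
      using MVT2[of 0 ?t "\<lambda>t. F (x + t *\<^sub>R e)" "\<lambda>t. F' (x + t *\<^sub>R e) e"] by auto
    then have "h n x = F' (x + z *\<^sub>R e) e" by (simp add: h_def)
    then show ?thesis using B' True by simp
  next
    case False
    have "norm ((1 / real (Suc n)) *\<^sub>R e) \<le> 1 * 1"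
      unfolding norm_scaleR using e by (intro mult_mono) auto
    then have "norm (x + (1 / real (Suc n)) *\<^sub>R e) \<ge> norm x - 1"
      using norm_diff_ineq[of x "(1 / real (Suc n)) *\<^sub>R e"] by linarith
    then have "F (x + (1 / real (Suc n)) *\<^sub>R e) = 0" "F x = 0" using False by (auto intro!: R(1))
    then show ?thesis using B by (simp add: h_def)
  qed
  have zero: "(LINT x|lborel. h n x) = 0" for n
  proof -
    let ?c = "(1 / real (Suc n)) *\<^sub>R e"
    have iF: "integrable lborel F"
    proof -
      have "integrable lborel (\<lambda>x. indicator (cball 0 R) x *\<^sub>R F x)"
        by (intro borel_integrable_compact compact_cball continuous_on_subset[OF Fc]) auto
      moreover have "(\<lambda>x. indicator (cball 0 R) x *\<^sub>R F x) = F"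
        using R(1) by (auto simp: indicator_def fun_eq_iff)
      ultimately show ?thesis by simp
    qed
    have d: "distr lborel borel ((+) ?c) = (lborel :: 'a measure)" by (rule lborel_distr_plus)
    have t: "(LINT x|lborel. F (?c + x)) = (LINT x|lborel. F x)"
      by (subst (2) d[symmetric], subst integral_distr) auto
    have iFc: "integrable lborel (\<lambda>x. F (?c + x))"
      using iF by (subst (asm) d[symmetric], subst (asm) integrable_distr_eq) auto
    show ?thesis
      unfolding h_def using iF iFc t by (simp add: add.commute)
  qed
  have lim: "(\<lambda>n. h n x) \<longlonglongrightarrow> F' x e" for x
  proof -
    have "((\<lambda>t. F (x + t *\<^sub>R e)) has_real_derivative F' x e) (at 0)"
    proof -
      have "((\<lambda>t. F (x + t *\<^sub>R e)) has_derivative (\<lambda>s. F' (x + 0 *\<^sub>R e) (s *\<^sub>R e))) (at 0)"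
        by (rule has_derivative_compose[OF _ der]) (auto intro!: derivative_eq_intros)
      moreover have "(\<lambda>s. F' (x + 0 *\<^sub>R e) (s *\<^sub>R e)) = (*) (F' x e)"
        using linear_cmul[OF has_derivative_linear[OF der]] by (simp add: fun_eq_iff mult.commute)
      ultimately show ?thesis by (simp add: has_field_derivative_def)
    qed
    then have "((\<lambda>t. (F (x + t *\<^sub>R e) - F x) / t) \<longlongrightarrow> F' x e) (at 0)"
      by (simp add: has_field_derivative_iff)
    moreover have "filterlim (\<lambda>n. 1 / real (Suc n)) (at 0) sequentially"
      unfolding filterlim_at using LIMSEQ_inverse_real_of_nat by (auto simp: inverse_eq_divide)
    ultimately have "(\<lambda>n. (F (x + (1 / real (Suc n)) *\<^sub>R e) - F x) / (1 / real (Suc n))) \<longlonglongrightarrow> F' x e"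
      by (rule filterlim_compose)
    then show ?thesis by (simp add: h_def mult.commute)
  qed
  have "(\<lambda>n. LINT x|lborel. h n x) \<longlonglongrightarrow> (LINT x|lborel. F' x e)"
  proof (rule integral_dominated_convergence[where w="\<lambda>x. B * indicator (cball 0 (R + 1)) x"])
    show "integrable lborel (\<lambda>x. B * indicator (cball (0::'a) (R + 1)) x)"
      using emeasure_lborel_cball_finite[of "0::'a" "R + 1"] by (intro integrable_mult_right integrable_real_indicator) (auto simp: less_top)
    show "h n \<in> borel_measurable lborel" for n unfolding h_def by measurable
  qed (use lim hB in auto)
  then show ?thesis using zero by (simp add: LIMSEQ_const_iff)
qed

text \<open>The weak Jacobian is the classical one, by the vanishing integral of the derivative of a
  component times a test function. Bounds hold because the map and its Jacobian are continuous on
  the compact closure of \<open>U\<close>.\<close>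

lemma unimodular_C1_W1inf:
  fixes U :: "(real^'n::finite) set"
  assumes U: "open U" "bounded U" and \<Phi>: "unimodular_C1 \<Phi>"
  shows "\<Phi> \<in> W1inf U"
proof -
  obtain G where G: "continuous_on UNIV G" "\<And>x. (\<Phi> has_derivative (\<lambda>v. G x *v v)) (at x)" "\<And>x. det (G x) = 1"
    using \<Phi> by (auto simp: unimodular_C1_def)
  have \<Phi>c: "continuous_on UNIV \<Phi>"
    using G(2) by (meson continuous_at_imp_continuous_on has_derivative_continuous)
  have Um: "U \<in> sets lebesgue" using U(1) by simp
  have Linf: "f \<in> Linf U" if f: "continuous_on UNIV f" for f :: "real^'n \<Rightarrow> 'b::euclidean_space"
  proof -
    have "bounded (f ` closure U)"
      using U by (intro compact_imp_bounded compact_continuous_image continuous_on_subset[OF f]) (auto simp: compact_closure)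
    then obtain C where "\<And>x. x \<in> U \<Longrightarrow> norm (f x) \<le> C"
      using closure_subset unfolding bounded_iff by (metis imageI subsetD)
    then have "AE x in lebesgue_on U. norm (f x) \<le> C"
      using Um by (simp add: AE_lebesgue_on_iff)
    moreover have "f \<in> borel_measurable (lebesgue_on U)"
      by (rule continuous_imp_measurable_on_sets_lebesgue[OF continuous_on_subset[OF f] Um]) auto
    ultimately show ?thesis by (auto simp: Linf_def)
  qed
  have loc: "locally_integrable_on f U" if f: "continuous_on UNIV f" for f :: "real^'n \<Rightarrow> 'b::euclidean_space"
    unfolding locally_integrable_on_def
  proof (intro allI impI)
    fix K :: "(real^'n) set" assume K: "compact K \<and> K \<subseteq> U"
    then have "set_integrable lebesgue K f"
      by (intro set_integrable_continuous_compact continuous_on_subset[OF f]) auto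
    then show "integrable (lebesgue_on K) f"
      using K unfolding set_integrable_def by (subst integrable_restrict_space) (auto intro!: fmeasurableD lmeasurable_compact)
  qed
  have weak: "(LINT x|lebesgue_on U. \<Phi> x $ i * partial j \<phi> x) = - (LINT x|lebesgue_on U. G x $ i $ j * \<phi> x)"
    if \<phi>: "\<phi> \<in> test_functions U" for \<phi> i j
  proof -
    define K where "K = closure {x. \<phi> x \<noteq> 0}"
    have K: "compact K" "K \<subseteq> U" using \<phi> by (auto simp: test_functions_def K_def)
    have Ck1: "Ck (Suc 0) \<phi>" using \<phi> by (simp add: test_functions_def)
    define \<phi>' where "\<phi>' x = frechet_derivative \<phi> (at x)" for x
    have d\<phi>: "(\<phi> has_derivative \<phi>' x) (at x)" for x
      using Ck1 by (simp add: \<phi>'_def frechet_derivative_works[symmetric])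
    have p\<phi>: "partial j \<phi> x = \<phi>' x (axis j 1)" for x by (simp add: partial_def \<phi>'_def)
    have c1: "continuous_on UNIV (partial j \<phi>)" using Ck1 by simp
    have c0: "continuous_on UNIV \<phi>" using d\<phi> by (meson continuous_at_imp_continuous_on has_derivative_continuous)
    have z0: "\<phi> x = 0" if "x \<notin> K" for x using that closure_subset[of "{x. \<phi> x \<noteq> 0}"] by (auto simp: K_def)
    have z1: "partial j \<phi> x = 0" if "x \<notin> K" for x
    proof -
      have "(\<phi> has_derivative (\<lambda>_. 0)) (at x)"
      proof (rule has_derivative_transform_within_open[of "\<lambda>_. 0" _ _ _ "- K"])
        show "open (- K)" using K(1) by (simp add: compact_imp_closed open_Compl)
      qed (use that z0 in auto)
      from partial_eqI[OF this] show ?thesis by simp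
    qed
    define F where "F x = \<Phi> x $ i * \<phi> x" for x
    define F' where "F' x v = \<Phi> x $ i * \<phi>' x v + (G x *v v) $ i * \<phi> x" for x v
    have der: "(F has_derivative F' x) (at x)" for x
      unfolding F_def F'_def
      by (intro has_derivative_mult bounded_linear.has_derivative[OF bounded_linear_vec_nth] G(2) d\<phi>)
    have F'e: "F' x (axis j 1) = \<Phi> x $ i * partial j \<phi> x + G x $ i $ j * \<phi> x" for x
      by (simp add: F'_def p\<phi> matrix_vector_mul_component inner_axis)
    obtain R where R: "K \<subseteq> cball 0 R"
      proof -
      obtain R where "\<forall>x\<in>K. norm x \<le> R" using compact_imp_bounded[OF K(1)] unfolding bounded_iff by blast
      then show thesis by (intro that[of R]) auto
    qed
    have cF': "continuous_on UNIV (\<lambda>x. F' x (axis j 1))"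
      unfolding F'e by (intro continuous_intros \<Phi>c c1 c0 G(1))
    have "(LINT x|lborel. F' x (axis j 1)) = 0"
    proof (rule integral_directional_derivative_eq_0[OF der cF', of R])
      show "F x = 0" "F' x (axis j 1) = 0" if "x \<notin> cball 0 R" for x
      proof -
        have "x \<notin> K" using that R by blast
        then show "F x = 0" "F' x (axis j 1) = 0" unfolding F_def F'e using z0 z1 by simp_all
      qed
    qed simp
    then have "0 = (LINT x|lebesgue. F' x (axis j 1))"
      using cF' by (subst integral_completion) (auto intro: borel_measurable_continuous_onI)
    also have "\<dots> = (LINT x:K|lebesgue. \<Phi> x $ i * partial j \<phi> x + G x $ i $ j * \<phi> x)"
      unfolding set_lebesgue_integral_def F'e using z0 z1
      by (intro Bochner_Integration.integral_cong) (auto simp: indicator_def)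
    also have "\<dots> = (LINT x:K|lebesgue. \<Phi> x $ i * partial j \<phi> x) + (LINT x:K|lebesgue. G x $ i $ j * \<phi> x)"
      by (intro set_integral_add(2) set_integrable_continuous_compact K(1) continuous_intros
          continuous_on_subset[OF \<Phi>c] continuous_on_subset[OF c1] continuous_on_subset[OF c0] continuous_on_subset[OF G(1)]) auto
    also have "(LINT x:K|lebesgue. \<Phi> x $ i * partial j \<phi> x) = (LINT x|lebesgue_on U. \<Phi> x $ i * partial j \<phi> x)"
      by (rule integral_lebesgue_on_support[symmetric]) (use Um K z1 in auto)
    also have "(LINT x:K|lebesgue. G x $ i $ j * \<phi> x) = (LINT x|lebesgue_on U. G x $ i $ j * \<phi> x)"
      by (rule integral_lebesgue_on_support[symmetric]) (use Um K z0 in auto)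
    finally show ?thesis by simp
  qed
  show ?thesis
    unfolding W1inf_def has_weak_jacobian_def
    using Linf[OF \<Phi>c] Linf[OF G(1)] loc[OF \<Phi>c] loc[OF G(1)] weak continuous_on_subset[OF \<Phi>c, of U] by auto
qed

text \<open>The essential supremum has to be exactly 1, so the image must not be null. By invariance
  of domain it is open.\<close>

lemma essentially_injective_inj:
  fixes \<Phi> :: "real^'n::finite \<Rightarrow> real^'n"
  assumes U: "open U" "U \<noteq> {}" and \<Phi>: "continuous_on U \<Phi>" "inj_on \<Phi> U"
  shows "essentially_injective U \<Phi>"
proof -
  have op: "open (\<Phi> ` U)" by (rule invariance_of_domain[OF \<Phi>(1) U(1) \<Phi>(2)])
  have m: "multiplicity_fun \<Phi> U = indicator (\<Phi> ` U)"
  proof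
    fix y
    show "multiplicity_fun \<Phi> U y = indicator (\<Phi> ` U) y"
    proof (cases "y \<in> \<Phi> ` U")
      case True
      then obtain x where x: "x \<in> U" "y = \<Phi> x" by blast
      then have "U \<inter> \<Phi> -` {y} = {x}" using \<Phi>(2) by (auto simp: inj_on_def)
      then show ?thesis using True by (simp add: multiplicity_fun_def)
    next
      case False
      then have "U \<inter> \<Phi> -` {y} = {}" by auto
      then show ?thesis using False by (simp add: multiplicity_fun_def)
    qed
  qed
  have meas: "(indicator (\<Phi> ` U) :: _ \<Rightarrow> ennreal) \<in> borel_measurable lebesgue"
    using op by (intro borel_measurable_indicator) simp
  have le: "esssup lebesgue (indicator (\<Phi> ` U) :: _ \<Rightarrow> ennreal) \<le> 1"
    using meas by (intro esssup_I) (auto simp: indicator_def)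
  have "\<not> esssup lebesgue (indicator (\<Phi> ` U) :: _ \<Rightarrow> ennreal) < 1"
  proof
    assume "esssup lebesgue (indicator (\<Phi> ` U) :: _ \<Rightarrow> ennreal) < 1"
    then have "AE y in lebesgue. (indicator (\<Phi> ` U) y :: ennreal) < 1"
      using esssup_AE[of "indicator (\<Phi> ` U) :: _ \<Rightarrow> ennreal" lebesgue] by (auto elim: eventually_mono)
    then have "AE y in lebesgue. y \<notin> \<Phi> ` U"
      by eventually_elim (auto simp: indicator_def)
    then have "negligible (\<Phi> ` U)"
      by (simp add: negligible_iff_null_sets completion.null_sets_iff_AE)
    then show False using open_not_negligible[OF op] U(2) by simp
  qed
  with le show ?thesis by (simp add: essentially_injective_def m)
qed

lemma unimodular_C1_measure_preserving:
  fixes U :: "(real^'n::finite) set"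
  assumes U: "open U" "bounded U" and \<Phi>: "unimodular_C1 \<Phi>"
  shows "measure_preserving U \<Phi>"
proof -
  obtain G where G: "continuous_on UNIV G" "\<And>x. (\<Phi> has_derivative (\<lambda>v. G x *v v)) (at x)" "\<And>x. det (G x) = 1"
    using \<Phi> by (auto simp: unimodular_C1_def)
  have inj: "inj \<Phi>" using \<Phi> by (simp add: unimodular_C1_def bij_is_inj)
  have Um: "U \<in> lmeasurable" using U by (simp add: lmeasurable_open)
  have area: "\<Phi> ` S \<in> lmeasurable \<and> measure lebesgue (\<Phi> ` S) = measure lebesgue S" if S: "S \<in> lmeasurable" for S
  proof -
    have i: "set_integrable lebesgue S (\<lambda>x. det (G x))"
      unfolding set_integrable_def G(3) using S by (intro integrable_scaleR_left) (auto simp: fmeasurable_def)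
    have "measure lebesgue (\<Phi> ` S) = (LINT x:S|lebesgue. \<bar>det (G x)\<bar>)"
      "\<Phi> ` S \<in> lmeasurable"
      using area_formula[OF fmeasurableD[OF S] has_derivative_at_withinI[OF G(2)] inj_on_subset[OF inj] i] by auto
    then show ?thesis using S by (simp add: G(3) set_lebesgue_integral_def)
  qed
  show ?thesis
  proof (rule measure_preservingI[OF Um])
    show "\<Phi> \<in> Linf U" using unimodular_C1_W1inf[OF U \<Phi>] by (simp add: W1inf_def)
    show "\<Phi> ` U \<in> lmeasurable" using area[OF Um] by simp
    fix E assume "U \<inter> \<Phi> -` E \<in> sets lebesgue"
    then have "U \<inter> \<Phi> -` E \<in> lmeasurable" by (intro fmeasurableI2[OF Um]) auto
    then have "measure lebesgue (U \<inter> \<Phi> -` E) = measure lebesgue (\<Phi> ` (U \<inter> \<Phi> -` E))" using area by simp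
    also have "\<Phi> ` (U \<inter> \<Phi> -` E) = \<Phi> ` U \<inter> E" by auto
    finally show "measure lebesgue (U \<inter> \<Phi> -` E) = measure lebesgue (\<Phi> ` U \<inter> E)" .
  qed
qed

section \<open>Permuting cubes by shears\<close>

text \<open>A family of points of the integer grid, labelled by \<open>I\<close>, is moved by
  shifting whole grid lines in direction \<open>k\<close>. The shift depends only on coordinate
  \<open>l\<close>, so a move is a discrete shear that acts on all points at once.\<close>

inductive reach :: "'i set \<Rightarrow> ('i \<Rightarrow> int^'n::finite) \<Rightarrow> ('i \<Rightarrow> int^'n) \<Rightarrow> bool" for I a where
  stay: "\<forall>i\<in>I. b i = a i \<Longrightarrow> reach I a b"
| move: "reach I a b \<Longrightarrow> k \<noteq> l \<Longrightarrow> \<forall>i\<in>I. \<forall>j. b' i $ j = b i $ j + (if j = k then c (b i $ l) else 0) \<Longrightarrow> reach I a b'"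

lemma reach_trans: "reach I b d \<Longrightarrow> reach I a b \<Longrightarrow> reach I a d"
proof (induction rule: reach.induct)
  case (stay d)
  from stay(2) show ?case
  proof cases
    case stay': stay
    then show ?thesis using stay(1) by (intro reach.stay) auto
  next
    case (move b0 k l c)
    then show ?thesis using stay(1) by (intro reach.move[OF move(1,2)]) auto
  qed
next
  case (move d k l d' c)
  then show ?case by (intro reach.move[of I a d k l d' c]) auto
qed

text \<open>A move does not touch coordinate \<open>l\<close>, so the opposite shift is again a
  function of that coordinate.\<close>

lemma reach_sym: "reach I a b \<Longrightarrow> reach I b a"
proof (induction rule: reach.induct)
  case (stay b)
  then show ?case by (intro reach.stay) auto
next
  case (move b k l b' c)
  have "reach I b' b"
    using move(2,3) by (intro reach.move[OF reach.stay[of I b' b'], of k l b "\<lambda>m. - c m"]) auto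
  then show ?case using move.IH reach_trans by blast
qed

text \<open>When the points have different coordinates in direction \<open>l\<close>, a shift
  depending on that coordinate can address each of them individually.\<close>

lemma reach_set_coordinate:
  assumes kl: "k \<noteq> l" and inj: "inj_on (\<lambda>i. a i $ l) I"
  shows "reach I a (\<lambda>i. \<chi> j. if j = k then t i else a i $ j)"
proof -
  let ?i = "inv_into I (\<lambda>i. a i $ l)"
  have "?i (a i $ l) = i" if "i \<in> I" for i
    using inv_into_f_f[OF inj that] .
  then show ?thesis
    by (intro reach.move[OF reach.stay[of I a a] kl, of _ "\<lambda>m. t (?i m) - a (?i m) $ k"]) auto
qed

lemma reach_set_coordinates:
  assumes inj: "inj_on (\<lambda>i. a i $ l) I" and L: "finite L" "l \<notin> L"
  shows "reach I a (\<lambda>i. \<chi> j. if j \<in> L then b i $ j else a i $ j)"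
  using L
proof (induction L)
  case empty
  then show ?case by (intro reach.stay) (simp add: vec_eq_iff)
next
  case (insert k L)
  let ?a = "\<lambda>i. \<chi> j. if j \<in> L then b i $ j else a i $ j"
  have "reach I ?a (\<lambda>i. \<chi> j. if j = k then b i $ k else ?a i $ j)"
    using insert inj by (intro reach_set_coordinate[where l=l]) auto
  moreover have "(\<lambda>i. \<chi> j. if j = k then b i $ k else ?a i $ j) = (\<lambda>i. \<chi> j. if j \<in> insert k L then b i $ j else a i $ j)"
    by (auto simp: fun_eq_iff vec_eq_iff)
  moreover have "reach I a ?a" using insert by simp
  ultimately show ?case using reach_trans by fastforce
qed

text \<open>Adding large multiples of the other coordinates, one after the other, separates the points in
  the direction \<open>k\<close>.\<close>
lemma reach_separate:
  fixes a :: "'i \<Rightarrow> int^'n::finite"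
  assumes I: "finite I" and inj: "inj_on a I"
  obtains b where "reach I a b" "inj_on (\<lambda>i. b i $ k) I"
proof -
  have claim: "\<exists>b. reach I a b \<and> (\<forall>i\<in>I. \<forall>j. j \<noteq> k \<longrightarrow> b i $ j = a i $ j) \<and>
      (\<forall>i\<in>I. \<forall>i'\<in>I. b i $ k = b i' $ k \<longrightarrow> (\<forall>j\<in>insert k L. a i $ j = a i' $ j))"
    if "finite L" "k \<notin> L" for L
    using that
  proof (induction L)
    case empty
    then show ?case by (intro exI[of _ a]) (auto intro: reach.stay)
  next
    case (insert l L)
    then obtain b where b: "reach I a b" "\<And>i j. i \<in> I \<Longrightarrow> j \<noteq> k \<Longrightarrow> b i $ j = a i $ j"
      "\<And>i i' j. i \<in> I \<Longrightarrow> i' \<in> I \<Longrightarrow> b i $ k = b i' $ k \<Longrightarrow> j \<in> insert k L \<Longrightarrow> a i $ j = a i' $ j"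
      by (metis insertCI)
    \<comment> \<open>\<open>K\<close> exceeds all differences of \<open>k\<close>-coordinates, so
      the \<open>k\<close>-coordinate plus \<open>K\<close> times the \<open>l\<close>-coordinate
      determines both, like digits in base \<open>K\<close>. The inserted 0 covers empty
      \<open>I\<close>.\<close>
    define K where "K = 1 + Max (insert 0 ((\<lambda>(i, i'). \<bar>b i $ k - b i' $ k\<bar>) ` (I \<times> I)))"
    have K: "\<bar>b i $ k - b i' $ k\<bar> < K" if "i \<in> I" "i' \<in> I" for i i'
    proof -
      have "\<bar>b i $ k - b i' $ k\<bar> \<in> insert 0 ((\<lambda>(i, i'). \<bar>b i $ k - b i' $ k\<bar>) ` (I \<times> I))"
        using that by force
      then have "\<bar>b i $ k - b i' $ k\<bar> \<le> Max (insert 0 ((\<lambda>(i, i'). \<bar>b i $ k - b i' $ k\<bar>) ` (I \<times> I)))"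
        using I by (intro Max_ge) auto
      then show ?thesis by (simp add: K_def)
    qed
    define b' where "b' i = (\<chi> j. b i $ j + (if j = k then K * b i $ l else 0))" for i
    have r: "reach I a b'"
      using insert by (intro reach.move[OF b(1), of k l _ "\<lambda>m. K * m"]) (auto simp: b'_def)
    have lk: "l \<noteq> k" using insert by auto
    have "a i $ j = a i' $ j" if i: "i \<in> I" "i' \<in> I" and eq: "b' i $ k = b' i' $ k" and j: "j \<in> insert k (insert l L)" for i i' j
    proof -
      have e: "b i $ k - b i' $ k = K * (b i' $ l - b i $ l)"
        using eq by (simp add: b'_def algebra_simps)
      have ll: "b i' $ l = b i $ l"
      proof (rule ccontr)
        assume "b i' $ l \<noteq> b i $ l"
        then have "1 \<le> \<bar>b i' $ l - b i $ l\<bar>" by linarith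
        moreover have "0 < K" using K[OF i] by linarith
        ultimately have "K * 1 \<le> K * \<bar>b i' $ l - b i $ l\<bar>" by (intro mult_left_mono) auto
        also have "\<dots> = \<bar>b i $ k - b i' $ k\<bar>" using \<open>0 < K\<close> by (simp add: e abs_mult)
        finally show False using K[OF i] by simp
      qed
      then have "b i $ k = b i' $ k" using e by simp
      then show ?thesis using b(3)[OF i] j ll b(2)[OF i(1) lk] b(2)[OF i(2) lk] by auto
    qed
    moreover have "b' i $ j = a i $ j" if "i \<in> I" "j \<noteq> k" for i j
      using b(2)[OF that] that by (simp add: b'_def)
    ultimately show ?case using r by blast
  qed
  have "finite (UNIV - {k})" "k \<notin> UNIV - {k}" by auto
  from claim[OF this] obtain b where b: "reach I a b"
    "\<forall>i\<in>I. \<forall>i'\<in>I. b i $ k = b i' $ k \<longrightarrow> (\<forall>j\<in>insert k (UNIV - {k}). a i $ j = a i' $ j)"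
    by (elim exE conjE)
  have U: "insert k (UNIV - {k}) = UNIV" by auto
  have "inj_on (\<lambda>i. b i $ k) I"
  proof (rule inj_onI)
    fix i i' assume i: "i \<in> I" "i' \<in> I" "b i $ k = b i' $ k"
    then have "\<forall>j\<in>UNIV. a i $ j = a i' $ j" using b(2)[unfolded U] by blast
    then have "a i = a i'" by (simp add: vec_eq_iff)
    then show "i = i'" using inj i by (simp add: inj_on_def)
  qed
  with b(1) show thesis by (rule that)
qed

text \<open>Moves are reversible, so \<open>a\<close> and \<open>b\<close> may both be replaced by
  configurations that are separated in direction \<open>k\<close>. Changing the
  \<open>k\<close>-coordinates needs separation in another direction, which the labels
  \<open>e\<close> provide in direction \<open>l\<close>. Once the \<open>k\<close>-coordinates are
  those of \<open>b1\<close>, which are distinct, all the others can be set.\<close>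

lemma reach_all:
  fixes a b :: "'i \<Rightarrow> int^'n::finite"
  assumes card: "CARD('n) \<ge> 2" and I: "finite I" and a: "inj_on a I" and b: "inj_on b I"
  shows "reach I a b"
proof -
  obtain k l :: 'n where kl: "k \<noteq> l"
    using card card_2_iff' card_le_Suc0_iff_eq[of "UNIV :: 'n set"] by fastforce
  obtain a1 where a1: "reach I a a1" "inj_on (\<lambda>i. a1 i $ k) I" using reach_separate[OF I a] by blast
  obtain b1 where b1: "reach I b b1" "inj_on (\<lambda>i. b1 i $ k) I" using reach_separate[OF I b] by blast
  obtain e :: "'i \<Rightarrow> nat" where e: "inj_on e I" using finite_imp_inj_to_nat_seg[OF I] by blast
  define a2 where "a2 i = (\<chi> j. if j = l then int (e i) else a1 i $ j)" for i
  have 2: "reach I a1 a2"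
    unfolding a2_def[abs_def] by (rule reach_set_coordinate[OF kl[symmetric] a1(2)])
  have a2: "inj_on (\<lambda>i. a2 i $ l) I" using e by (auto simp: a2_def inj_on_def)
  define a3 where "a3 i = (\<chi> j. if j = k then b1 i $ k else a2 i $ j)" for i
  have 3: "reach I a2 a3"
    unfolding a3_def[abs_def] by (rule reach_set_coordinate[OF kl a2])
  have a3: "inj_on (\<lambda>i. a3 i $ k) I" using b1(2) by (auto simp: a3_def inj_on_def)
  have "reach I a3 (\<lambda>i. \<chi> j. if j \<in> UNIV - {k} then b1 i $ j else a3 i $ j)"
    by (rule reach_set_coordinates[OF a3]) auto
  moreover have "(\<lambda>i. \<chi> j. if j \<in> UNIV - {k} then b1 i $ j else a3 i $ j) = b1"
    by (auto simp: fun_eq_iff vec_eq_iff a3_def)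
  ultimately have "reach I a3 b1" by simp
  then show ?thesis using a1(1) 2 3 reach_sym[OF b1(1)] reach_trans by blast
qed

section \<open>Continuously differentiable shears that realise the moves\<close>

lemma continuous_on_flat_exp: "continuous_on S (flat_exp k)"
  by (intro continuous_at_imp_continuous_on ballI DERIV_isCont[OF has_real_derivative_flat_exp])

lemma C1_step:
  obtains s s' :: "real \<Rightarrow> real" where "\<And>t. (s has_real_derivative s' t) (at t)" "continuous_on UNIV s'"
    "\<And>t. t \<le> 0 \<Longrightarrow> s t = 0" "\<And>t. 1 \<le> t \<Longrightarrow> s t = 1" "\<And>t. 0 \<le> s t" "\<And>t. s t \<le> 1"
proof -
  let ?f = "flat_exp 0" let ?f' = "flat_exp 2"
  have f: "(?f has_real_derivative ?f' t) (at t)" for t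
    using has_real_derivative_flat_exp[of 0 t] by (simp add: numeral_2_eq_2)
  have fm: "((\<lambda>t. ?f (1 - t)) has_real_derivative (- ?f' (1 - t))) (at t)" for t
  proof -
    have "((\<lambda>t. 1 - t) has_real_derivative - 1) (at t)" by (auto intro!: derivative_eq_intros)
    from DERIV_chain2[OF f this] show ?thesis by simp
  qed
  have pos: "?f t + ?f (1 - t) > 0" for t by (auto simp: flat_exp_def add_pos_nonneg)
  \<comment> \<open>One of \<open>t\<close> and \<open>1 - t\<close> is positive, so the denominator
    never vanishes.\<close>
  define s where "s t = ?f t / (?f t + ?f (1 - t))" for t
  define s' where "s' t = (?f' t * (?f t + ?f (1 - t)) - ?f t * (?f' t + - ?f' (1 - t))) / ((?f t + ?f (1 - t)) * (?f t + ?f (1 - t)))" for t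
  show thesis
  proof
    show "(s has_real_derivative s' t) (at t)" for t
      unfolding s_def[abs_def] s'_def using pos[of t]
      by (intro DERIV_divide DERIV_add f fm) auto
    have pos': "?f t + ?f (1 - t) \<noteq> 0" for t using pos[of t] by simp
    show "continuous_on UNIV s'"
      unfolding s'_def using pos'
      by (intro continuous_intros continuous_on_compose2[OF continuous_on_flat_exp[of UNIV]]) auto
    show "s t = 0" if "t \<le> 0" for t using that by (simp add: s_def flat_exp_def)
    show "s t = 1" if "1 \<le> t" for t using that by (simp add: s_def flat_exp_def)
    show "0 \<le> s t" for t using pos[of t] by (simp add: s_def flat_exp_nonneg)
    show "s t \<le> 1" for t using pos[of t] flat_exp_nonneg[of 0 "1 - t"] by (simp add: s_def)
  qed
qed

text \<open>A sum of plateaus over the intervals of length \<open>h\<close>, with transitions of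
  width \<delta> inside each interval. The bound on \<open>g\<close> must not involve \<delta>; only
  the derivative is allowed to grow as \<delta> tends to 0.\<close>

lemma C1_step_function:
  fixes v :: "int \<Rightarrow> real" and h \<delta> :: real
  assumes M: "finite M" and h: "h > 0" and \<delta>: "\<delta> > 0"
  obtains g g' where "\<And>t. (g has_real_derivative g' t) (at t)" "continuous_on UNIV g'"
    "\<And>m t. m \<in> M \<Longrightarrow> h * real_of_int m + \<delta> \<le> t \<Longrightarrow> t \<le> h * (real_of_int m + 1) - \<delta> \<Longrightarrow> g t = v m"
    "\<And>t. \<bar>g t\<bar> \<le> (\<Sum>m\<in>M. \<bar>v m\<bar>)"
proof -
  obtain s s' where s: "\<And>t. (s has_real_derivative s' t) (at t)" "continuous_on UNIV s'"
    "\<And>t. t \<le> 0 \<Longrightarrow> s t = 0" "\<And>t. 1 \<le> t \<Longrightarrow> s t = 1" "\<And>t. 0 \<le> s t" "\<And>t. s t \<le> 1"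
    using C1_step by blast
  have sc: "continuous_on UNIV s" by (intro continuous_at_imp_continuous_on ballI DERIV_isCont[OF s(1)])
  define p where "p m t = s ((t - h * real_of_int m) / \<delta>) * s ((h * (real_of_int m + 1) - t) / \<delta>)" for m t
  define p' where "p' m t = (s' ((t - h * real_of_int m) / \<delta>) * (1 / \<delta>)) * s ((h * (real_of_int m + 1) - t) / \<delta>)
      + (s' ((h * (real_of_int m + 1) - t) / \<delta>) * (- 1 / \<delta>)) * s ((t - h * real_of_int m) / \<delta>)" for m t
  have dp: "(p m has_real_derivative p' m t) (at t)" for m t
  proof -
    have 1: "((\<lambda>t. s ((t - h * real_of_int m) / \<delta>)) has_real_derivative s' ((t - h * real_of_int m) / \<delta>) * (1 / \<delta>)) (at t)"
      by (rule DERIV_chain2[OF s(1)]) (use \<delta> in \<open>auto intro!: derivative_eq_intros\<close>)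
    have 2: "((\<lambda>t. s ((h * (real_of_int m + 1) - t) / \<delta>)) has_real_derivative s' ((h * (real_of_int m + 1) - t) / \<delta>) * (- 1 / \<delta>)) (at t)"
      by (rule DERIV_chain2[OF s(1)]) (use \<delta> in \<open>auto intro!: derivative_eq_intros\<close>)
    show ?thesis unfolding p_def[abs_def] p'_def by (rule DERIV_mult[OF 1 2])
  qed
  have cp: "continuous_on UNIV (p' m)" for m
    unfolding p'_def using \<delta>
    by (intro continuous_intros continuous_on_compose2[OF s(2)] continuous_on_compose2[OF sc]) auto
  have p01: "0 \<le> p m t" "p m t \<le> 1" for m t
    using s(5,6) by (auto simp: p_def intro: mult_le_one)
  have p1: "p m t = 1" if "h * real_of_int m + \<delta> \<le> t" "t \<le> h * (real_of_int m + 1) - \<delta>" for m :: int and t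
  proof -
    have "1 \<le> (t - h * real_of_int m) / \<delta>" "1 \<le> (h * (real_of_int m + 1) - t) / \<delta>"
      using that \<delta> by (simp_all add: pos_le_divide_eq)
    then show ?thesis by (simp add: p_def s(4))
  qed
  have p0: "p m t = 0" if "t \<le> h * real_of_int m \<or> h * (real_of_int m + 1) \<le> t" for m :: int and t
    using that
  proof
    assume "t \<le> h * real_of_int m"
    then have "(t - h * real_of_int m) / \<delta> \<le> 0" using \<delta> by (simp add: divide_nonpos_pos)
    then show ?thesis by (simp add: p_def s(3))
  next
    assume "h * (real_of_int m + 1) \<le> t"
    then have "(h * (real_of_int m + 1) - t) / \<delta> \<le> 0" using \<delta> by (simp add: divide_nonpos_pos)
    then show ?thesis by (simp add: p_def s(3))
  qed
  show thesis
  proof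
    show "((\<lambda>t. \<Sum>m\<in>M. v m * p m t) has_real_derivative (\<Sum>m\<in>M. v m * p' m t)) (at t)" for t
      by (intro DERIV_sum DERIV_cmult dp)
    show "continuous_on UNIV (\<lambda>t. \<Sum>m\<in>M. v m * p' m t)"
      by (intro continuous_intros cp)
    show "(\<Sum>m\<in>M. v m * p m t) = v m" if m: "m \<in> M" and t: "h * real_of_int m + \<delta> \<le> t" "t \<le> h * (real_of_int m + 1) - \<delta>" for m t
    proof -
      have "p m' t = 0" if "m' \<noteq> m" for m'
      proof (rule p0)
        consider "m + 1 \<le> m'" | "m' + 1 \<le> m" using \<open>m' \<noteq> m\<close> by linarith
        then show "t \<le> h * real_of_int m' \<or> h * (real_of_int m' + 1) \<le> t"
        proof cases
          case 1
          then have "h * (real_of_int m + 1) \<le> h * real_of_int m'" using h by simp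
          then have "t \<le> h * real_of_int m'" using t \<delta> by linarith
          then show ?thesis ..
        next
          case 2
          then have "h * (real_of_int m' + 1) \<le> h * real_of_int m" using h by simp
          then have "h * (real_of_int m' + 1) \<le> t" using t \<delta> by linarith
          then show ?thesis ..
        qed
      qed
      then have "(\<Sum>m'\<in>M. v m' * p m' t) = (\<Sum>m'\<in>M. if m' = m then v m else 0)"
        using p1[OF t] by (intro sum.cong) auto
      then show ?thesis using m M by simp
    qed
    show "\<bar>\<Sum>m\<in>M. v m * p m t\<bar> \<le> (\<Sum>m\<in>M. \<bar>v m\<bar>)" for t
      using p01 by (intro order_trans[OF sum_abs] sum_mono) (auto simp: abs_mult mult_left_le)
  qed
qed

text \<open>\<delta> is a margin: 0 gives the closed cube of side \<open>h\<close>, and a negative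
  value enlarges the cube. All three cases are used.\<close>

definition shrunk_cell :: "real \<Rightarrow> real \<Rightarrow> int^'n::finite \<Rightarrow> (real^'n) set" where
  "shrunk_cell h \<delta> z = {x. \<forall>j. h * real_of_int (z $ j) + \<delta> \<le> x $ j \<and> x $ j \<le> h * (real_of_int (z $ j) + 1) - \<delta>}"

definition real_vec :: "int^'n::finite \<Rightarrow> real^'n" where
  "real_vec z = (\<chi> j. real_of_int (z $ j))"

text \<open>\<open>M\<close> is chosen before \<delta>. On the shrunk cubes each shear is a
  translation by a grid vector, so they arrive at shrunk cubes, where the next step function is
  again constant. Elsewhere only the displacement is controlled.\<close>

lemma reach_realize:
  assumes "reach I a b" and I: "finite I" and h: "h > 0"
  shows "\<exists>M. \<forall>\<delta>>0. \<exists>\<Phi>. unimodular_C1 \<Phi> \<and> (\<forall>x. norm (\<Phi> x - x) \<le> M) \<and>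
    (\<forall>i\<in>I. \<forall>x\<in>shrunk_cell h \<delta> (a i). \<Phi> x = x + h *\<^sub>R (real_vec (b i) - real_vec (a i)))"
  using assms(1)
proof induction
  case (stay b)
  then show ?case by (intro exI[of _ 0]) (auto intro!: exI[of _ "\<lambda>x. x"] unimodular_C1_id)
next
  case (move b k l b' c)
  from move.IH obtain M where IH: "\<And>\<delta>. \<delta> > 0 \<Longrightarrow> \<exists>\<Phi>. unimodular_C1 \<Phi> \<and> (\<forall>x. norm (\<Phi> x - x) \<le> M) \<and>
    (\<forall>i\<in>I. \<forall>x\<in>shrunk_cell h \<delta> (a i). \<Phi> x = x + h *\<^sub>R (real_vec (b i) - real_vec (a i)))" by blast
  let ?L = "(\<lambda>i. b i $ l) ` I"
  let ?v = "\<lambda>m. h * real_of_int (c m)"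
  show ?case
  proof (intro exI[of _ "M + (\<Sum>m\<in>?L. \<bar>?v m\<bar>)"] allI impI)
    fix \<delta> :: real assume \<delta>: "\<delta> > 0"
    obtain \<Phi> where \<Phi>: "unimodular_C1 \<Phi>" "\<And>x. norm (\<Phi> x - x) \<le> M"
      "\<And>i x. i \<in> I \<Longrightarrow> x \<in> shrunk_cell h \<delta> (a i) \<Longrightarrow> \<Phi> x = x + h *\<^sub>R (real_vec (b i) - real_vec (a i))"
      using IH[OF \<delta>] by blast
    obtain g g' where g: "\<And>t. (g has_real_derivative g' t) (at t)" "continuous_on UNIV g'"
      "\<And>m t. m \<in> ?L \<Longrightarrow> h * real_of_int m + \<delta> \<le> t \<Longrightarrow> t \<le> h * (real_of_int m + 1) - \<delta> \<Longrightarrow> g t = ?v m"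
      "\<And>t. \<bar>g t\<bar> \<le> (\<Sum>m\<in>?L. \<bar>?v m\<bar>)"
      by (rule C1_step_function[OF finite_imageI[OF I] h \<delta>, of "\<lambda>i. b i $ l" ?v]) (rule that)
    show "\<exists>\<Phi>. unimodular_C1 \<Phi> \<and> (\<forall>x. norm (\<Phi> x - x) \<le> M + (\<Sum>m\<in>?L. \<bar>?v m\<bar>)) \<and>
      (\<forall>i\<in>I. \<forall>x\<in>shrunk_cell h \<delta> (a i). \<Phi> x = x + h *\<^sub>R (real_vec (b' i) - real_vec (a i)))"
    proof (intro exI[of _ "\<lambda>x. shear k l g (\<Phi> x)"] conjI allI ballI)
      show "unimodular_C1 (\<lambda>x. shear k l g (\<Phi> x))"
        by (rule unimodular_C1_comp[OF \<Phi>(1) unimodular_C1_shear[OF move(2) g(1,2)]])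
      show "norm (shear k l g (\<Phi> x) - x) \<le> M + (\<Sum>m\<in>?L. \<bar>?v m\<bar>)" for x
      proof -
        have "norm (shear k l g (\<Phi> x) - x) = norm ((\<Phi> x - x) + g (\<Phi> x $ l) *\<^sub>R axis k 1)"
          by (simp add: shear_def algebra_simps)
        also have "\<dots> \<le> norm (\<Phi> x - x) + \<bar>g (\<Phi> x $ l)\<bar>"
          by (rule order_trans[OF norm_triangle_ineq]) simp
        finally show ?thesis using \<Phi>(2)[of x] g(4)[of "\<Phi> x $ l"] by linarith
      qed
      fix i x assume i: "i \<in> I" and x: "x \<in> shrunk_cell h \<delta> (a i)"
      have \<Phi>x: "\<Phi> x = x + h *\<^sub>R (real_vec (b i) - real_vec (a i))" by (rule \<Phi>(3)[OF i x])
      have "g (\<Phi> x $ l) = ?v (b i $ l)"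
      proof (rule g(3))
        show "b i $ l \<in> ?L" using i by simp
        show "h * real_of_int (b i $ l) + \<delta> \<le> \<Phi> x $ l" "\<Phi> x $ l \<le> h * (real_of_int (b i $ l) + 1) - \<delta>"
          using x unfolding \<Phi>x by (auto simp: shrunk_cell_def real_vec_def algebra_simps)
      qed
      then have "shear k l g (\<Phi> x) $ j = (x + h *\<^sub>R (real_vec (b' i) - real_vec (a i))) $ j" for j
        using move(3) i unfolding shear_nth \<Phi>x by (auto simp: real_vec_def algebra_simps)
      then show "shear k l g (\<Phi> x) = x + h *\<^sub>R (real_vec (b' i) - real_vec (a i))"
        by (simp add: vec_eq_iff)
    qed
  qed
qed

section \<open>Counting cubes\<close>

definition cell_index :: "real \<Rightarrow> real^'n::finite \<Rightarrow> int^'n" where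
  "cell_index h x = (\<chi> j. \<lfloor>x $ j / h\<rfloor>)"

text \<open>For positive \<open>h\<close> these are half-open cubes; they partition the space, so
  counting cubes amounts to measuring their union.\<close>

definition cell :: "real \<Rightarrow> int^'n::finite \<Rightarrow> (real^'n) set" where
  "cell h z = {x. cell_index h x = z}"

lemma mem_cell:
  assumes "h > 0"
  shows "x \<in> cell h z \<longleftrightarrow> (\<forall>j. h * real_of_int (z $ j) \<le> x $ j \<and> x $ j < h * (real_of_int (z $ j) + 1))"
  using assms by (auto simp: cell_def cell_index_def vec_eq_iff floor_eq_iff field_simps)

lemma shrunk_cell_cbox: "shrunk_cell h \<delta> z = cbox (h *\<^sub>R real_vec z + \<delta> *\<^sub>R 1) (h *\<^sub>R real_vec z + (h - \<delta>) *\<^sub>R 1)"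
  by (auto simp: shrunk_cell_def mem_box_cart real_vec_def algebra_simps)

lemma shrunk_cell_mono: "\<delta> \<le> \<delta>' \<Longrightarrow> shrunk_cell h \<delta>' z \<subseteq> shrunk_cell h \<delta> z"
proof
  fix x assume "\<delta> \<le> \<delta>'" "x \<in> shrunk_cell h \<delta>' z"
  then have "h * real_of_int (z $ j) + \<delta> \<le> x $ j \<and> x $ j \<le> h * (real_of_int (z $ j) + 1) - \<delta>" for j
    by (auto simp: shrunk_cell_def dest!: spec[of _ j])
  then show "x \<in> shrunk_cell h \<delta> z" by (simp add: shrunk_cell_def)
qed

lemma cell_subset_closed: "h > 0 \<Longrightarrow> cell h z \<subseteq> shrunk_cell h 0 z"
  by (auto simp: mem_cell shrunk_cell_def less_imp_le)

lemma shrunk_cell_subset_cell: "h > 0 \<Longrightarrow> \<delta> > 0 \<Longrightarrow> shrunk_cell h \<delta> z \<subseteq> cell h z"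
proof
  fix x assume "h > 0" "\<delta> > 0" "x \<in> shrunk_cell h \<delta> z"
  then have "h * real_of_int (z $ j) \<le> x $ j \<and> x $ j < h * (real_of_int (z $ j) + 1)" for j
    by (auto simp: shrunk_cell_def dest!: spec[of _ j])
  then show "x \<in> cell h z" using \<open>h > 0\<close> by (simp add: mem_cell)
qed

lemma shrunk_cell_measure:
  assumes "2 * \<delta> \<le> h"
  shows "shrunk_cell h \<delta> (z :: int^'n::finite) \<in> lmeasurable" "measure lebesgue (shrunk_cell h \<delta> z) = (h - 2 * \<delta>) ^ CARD('n)"
proof -
  show "shrunk_cell h \<delta> z \<in> lmeasurable" by (simp add: shrunk_cell_cbox)
  have "h *\<^sub>R real_vec z + \<delta> *\<^sub>R 1 \<in> shrunk_cell h \<delta> z"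
    using assms by (auto simp: shrunk_cell_def real_vec_def algebra_simps)
  then have "cbox (h *\<^sub>R real_vec z + \<delta> *\<^sub>R 1) (h *\<^sub>R real_vec z + (h - \<delta>) *\<^sub>R 1) \<noteq> {}"
    unfolding shrunk_cell_cbox by blast
  then show "measure lebesgue (shrunk_cell h \<delta> z) = (h - 2 * \<delta>) ^ CARD('n)"
    by (simp add: shrunk_cell_cbox content_cbox_cart)
qed

lemma cell_measure:
  assumes h: "h > 0"
  shows "cell h (z :: int^'n::finite) \<in> lmeasurable" "measure lebesgue (cell h z) = h ^ CARD('n)"
proof -
  have sub: "box (h *\<^sub>R real_vec z) (h *\<^sub>R real_vec z + h *\<^sub>R 1) \<subseteq> cell h z"
    using h by (auto simp: mem_cell mem_box_cart real_vec_def algebra_simps less_imp_le)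
  have eq: "shrunk_cell h 0 z = cbox (h *\<^sub>R real_vec z) (h *\<^sub>R real_vec z + h *\<^sub>R 1)"
    by (simp add: shrunk_cell_cbox)
  have neg: "negligible ((shrunk_cell h 0 z - cell h z) \<union> (cell h z - shrunk_cell h 0 z))"
    by (rule negligible_subset[OF negligible_frontier_interval[of "h *\<^sub>R real_vec z" "h *\<^sub>R real_vec z + h *\<^sub>R 1"]])
      (use sub cell_subset_closed[OF h, of z] eq in auto)
  show "cell h z \<in> lmeasurable"
    by (rule lmeasurable_negligible_symdiff[OF shrunk_cell_measure(1)[of 0 h z] neg]) (use h in auto)
  show "measure lebesgue (cell h z) = h ^ CARD('n)"
    using measure_negligible_symdiff[OF _ neg] shrunk_cell_measure[of 0 h z] h by simp
qed

lemma cells_measure: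
  assumes h: "h > 0" and Z: "finite (Z :: (int^'n::finite) set)"
  shows "(\<Union>z\<in>Z. cell h z) \<in> lmeasurable" "measure lebesgue (\<Union>z\<in>Z. cell h z) = real (card Z) * h ^ CARD('n)"
proof -
  show "(\<Union>z\<in>Z. cell h z) \<in> lmeasurable"
    by (intro fmeasurable.finite_UN Z cell_measure(1)[OF h])
  have "measure lebesgue (\<Union>z\<in>Z. cell h z) = (\<Sum>z\<in>Z. measure lebesgue (cell h z))"
    using Z
  proof (intro measure_finite_Union)
    show "cell h ` Z \<subseteq> sets lebesgue" using cell_measure(1)[OF h] by auto
    show "disjoint_family_on (cell h) Z" by (auto simp: disjoint_family_on_def cell_def)
    show "emeasure lebesgue (cell h z) \<noteq> \<infinity>" for z
      using fmeasurableD2[OF cell_measure(1)[OF h, of z]] by simp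
  qed
  then show "measure lebesgue (\<Union>z\<in>Z. cell h z) = real (card Z) * h ^ CARD('n)"
    by (simp add: cell_measure(2)[OF h])
qed

lemma card_cells_ge:
  assumes h: "h > 0" and Z: "finite (Z :: (int^'n::finite) set)" and S: "S \<in> lmeasurable" "S \<subseteq> (\<Union>z\<in>Z. cell h z)"
  shows "measure lebesgue S \<le> real (card Z) * h ^ CARD('n)"
  using measure_mono_fmeasurable[OF S(2) fmeasurableD[OF S(1)] cells_measure(1)[OF h Z]]
  by (simp add: cells_measure(2)[OF h Z])

lemma card_cells_le:
  assumes h: "h > 0" and Z: "finite (Z :: (int^'n::finite) set)" and S: "S \<in> lmeasurable" "(\<Union>z\<in>Z. cell h z) \<subseteq> S"
  shows "real (card Z) * h ^ CARD('n) \<le> measure lebesgue S"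
  using measure_mono_fmeasurable[OF S(2) fmeasurableD[OF cells_measure(1)[OF h Z]] S(1)]
  by (simp add: cells_measure(2)[OF h Z])

lemma finite_int_vec:
  assumes "finite F" shows "finite {z :: int^'n::finite. \<forall>j. z $ j \<in> F}"
proof -
  have "finite (Pi\<^sub>E (UNIV :: 'n set) (\<lambda>_. F))" by (rule finite_PiE) (use assms in auto)
  moreover have "{z :: int^'n. \<forall>j. z $ j \<in> F} \<subseteq> vec_lambda ` (Pi\<^sub>E UNIV (\<lambda>_. F))"
  proof
    fix z :: "int^'n" assume "z \<in> {z. \<forall>j. z $ j \<in> F}"
    then show "z \<in> vec_lambda ` (Pi\<^sub>E UNIV (\<lambda>_. F))"
      by (intro image_eqI[of _ _ "vec_nth z"]) auto
  qed
  ultimately show ?thesis by (meson finite_imageI finite_subset)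
qed

lemma finite_cell_index:
  assumes h: "h > 0" and S: "bounded (S :: (real^'n::finite) set)"
  shows "finite (cell_index h ` S)"
proof -
  obtain B where B: "\<And>x. x \<in> S \<Longrightarrow> norm x \<le> B" using S by (auto simp: bounded_iff)
  have "cell_index h ` S \<subseteq> {z. \<forall>j. z $ j \<in> {\<lfloor>- B / h\<rfloor>..\<lfloor>B / h\<rfloor>}}"
  proof (clarify)
    fix x j assume "x \<in> S"
    then have "\<bar>x $ j\<bar> \<le> B" using B component_le_norm_cart order_trans by blast
    then have "- B \<le> x $ j" "x $ j \<le> B" by auto
    then show "cell_index h x $ j \<in> {\<lfloor>- B / h\<rfloor>..\<lfloor>B / h\<rfloor>}"
      using h divide_right_mono[of "- B" "x $ j" h] divide_right_mono[of "x $ j" B h]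
      by (auto simp: cell_index_def intro!: floor_mono)
  qed
  then show ?thesis by (rule finite_subset) (rule finite_int_vec, simp)
qed

lemma subset_cells: "S \<subseteq> (\<Union>z\<in>cell_index h ` S. cell h z)"
  by (auto simp: cell_def)

lemma closed_cell_diameter:
  assumes "x \<in> shrunk_cell h 0 (z :: int^'n::finite)" "y \<in> shrunk_cell h 0 z"
  shows "norm (x - y) \<le> real CARD('n) * h"
proof -
  have "norm (x - y) \<le> (\<Sum>j\<in>UNIV. \<bar>(x - y) $ j\<bar>)" by (rule norm_le_l1_cart)
  also have "\<dots> \<le> (\<Sum>j\<in>(UNIV :: 'n set). h)"
  proof (rule sum_mono)
    fix j
    have "h * real_of_int (z $ j) \<le> x $ j" "x $ j \<le> h * (real_of_int (z $ j) + 1)"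
      "h * real_of_int (z $ j) \<le> y $ j" "y $ j \<le> h * (real_of_int (z $ j) + 1)"
      using assms by (simp_all add: shrunk_cell_def)
    then show "\<bar>(x - y) $ j\<bar> \<le> h" by (simp add: abs_le_iff algebra_simps)
  qed
  finally show ?thesis by simp
qed

section \<open>Assigning fine cubes to slots\<close>

lemma extend_inj_on:
  assumes fin: "finite I" "finite J" "finite T" and f: "inj_on f I" and disj: "I \<inter> J = {}"
    and card: "card I + card J \<le> card T"
  obtains f' where "\<And>i. i \<in> I \<Longrightarrow> f' i = f i" "inj_on f' (I \<union> J)" "f' ` J \<subseteq> T"
proof -
  have "card J \<le> card (T - f ` I)"
    using card diff_card_le_card_Diff[of "f ` I" T] fin card_image_le[of I f] by simp
  then obtain g where g: "g ` J \<subseteq> T - f ` I" "inj_on g J"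
    using card_le_inj[of J "T - f ` I"] fin by auto
  show thesis
  proof
    show "inj_on (\<lambda>i. if i \<in> I then f i else g i) (I \<union> J)"
      using f g disj by (auto simp: inj_on_def)
    show "(\<lambda>i. if i \<in> I then f i else g i) ` J \<subseteq> T" using g disj by auto
  qed auto
qed

text \<open>Every label serves as many of its members as it has slots. Unserved elements therefore
  have overfull labels, and each overfull label serves exactly \<open>k\<close>. So the elements
  with overfull labels are the unserved ones plus \<open>k\<close> for each overfull label; stating
  this as a sum avoids subtraction of natural numbers.\<close>

lemma greedy_assignment:
  assumes I: "finite (I :: 'i set)" and Sub: "\<And>c. finite (Sub c)" "\<And>c. card (Sub c) = k"
    and disj: "\<And>c c'. c \<noteq> c' \<Longrightarrow> Sub c \<inter> Sub c' = {}"
  obtains I1 f where "I1 \<subseteq> I" "inj_on f I1" "\<And>i. i \<in> I1 \<Longrightarrow> f i \<in> Sub (lab i)"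
    "card (I - I1) + card {c \<in> lab ` I. k < card {i \<in> I. lab i = c}} * k
      = card {i \<in> I. k < card {i' \<in> I. lab i' = lab i}}"
proof -
  define N where "N c = {i \<in> I. lab i = c}" for c
  have finN: "finite (N c)" for c using I by (simp add: N_def)
  have "\<exists>P f. P \<subseteq> N c \<and> card P = min (card (N c)) k \<and> inj_on f P \<and> f ` P \<subseteq> Sub c" for c
  proof -
    obtain P where P: "P \<subseteq> N c" "card P = min (card (N c)) k"
      using obtain_subset_with_card_n[of "min (card (N c)) k" "N c"] by auto
    then have "finite P" "card P \<le> card (Sub c)" using finN finite_subset Sub(2) by auto
    then obtain f where "f ` P \<subseteq> Sub c" "inj_on f P" using card_le_inj[OF _ Sub(1)] by blast
    then show ?thesis using P by blast
  qed
  then obtain P F where P: "\<And>c. P c \<subseteq> N c" "\<And>c. card (P c) = min (card (N c)) k"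
    and F: "\<And>c. inj_on (F c) (P c)" "\<And>c. F c ` P c \<subseteq> Sub c"
    by metis
  define I1 where "I1 = {i \<in> I. i \<in> P (lab i)}"
  define f where "f i = F (lab i) i" for i
  define Z where "Z = {c \<in> lab ` I. k < card {i \<in> I. lab i = c}}"
  have finZ: "finite Z" using I by (simp add: Z_def)
  show thesis
  proof
    show "I1 \<subseteq> I" by (auto simp: I1_def)
    show fS: "f i \<in> Sub (lab i)" if "i \<in> I1" for i
      using that F(2) by (auto simp: I1_def f_def)
    show "inj_on f I1"
    proof (rule inj_onI)
      fix i i' assume i: "i \<in> I1" "i' \<in> I1" "f i = f i'"
      have "lab i = lab i'" using fS[OF i(1)] fS[OF i(2)] i(3) disj by fastforce
      then show "i = i'" using i F(1)[of "lab i"] by (auto simp: I1_def f_def inj_on_def)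
    qed
    have split: "{i \<in> I. k < card {i' \<in> I. lab i' = lab i}} = (I - I1) \<union> (\<Union>c\<in>Z. P c)" (is "?L = ?R")
    proof (intro equalityI subsetI)
      fix i assume "i \<in> ?L"
      then have "i \<in> I" "lab i \<in> Z" by (auto simp: Z_def)
      then show "i \<in> ?R" by (auto simp: I1_def)
    next
      fix i assume "i \<in> ?R"
      then consider "i \<in> I" "i \<notin> P (lab i)" | c where "c \<in> Z" "i \<in> P c" by (auto simp: I1_def)
      then show "i \<in> ?L"
      proof cases
        case 1
        have "\<not> card (N (lab i)) \<le> k"
        proof
          assume "card (N (lab i)) \<le> k"
          then have "P (lab i) = N (lab i)" using P[of "lab i"] finN by (intro card_subset_eq) auto
          then show False using 1 by (auto simp: N_def)
        qed
        then show ?thesis using 1 by (simp add: N_def)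
      next
        case 2
        then show ?thesis using P(1)[of c] by (auto simp: Z_def N_def)
      qed
    qed
    have "card (\<Union>c\<in>Z. P c) = (\<Sum>c\<in>Z. card (P c))"
    proof (intro card_UN_disjoint finZ ballI impI)
      show "finite (P c)" for c using P(1) finN finite_subset by blast
      show "P c \<inter> P c' = {}" if "c \<noteq> c'" for c c'
        using P(1)[of c] P(1)[of c'] that unfolding N_def by blast
    qed
    also have "\<dots> = (\<Sum>c\<in>Z. k)"
      using P(2) by (intro sum.cong) (auto simp: Z_def N_def)
    finally have cP: "card (\<Union>c\<in>Z. P c) = card Z * k" by simp
    have "(I - I1) \<inter> (\<Union>c\<in>Z. P c) = {}"
      using P(1) by (auto simp: I1_def N_def)
    moreover have "finite (\<Union>c\<in>Z. P c)"
      using finZ finN P(1) by (intro finite_UN_I) (auto intro: finite_subset)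
    ultimately show "card (I - I1) + card {c \<in> lab ` I. k < card {i \<in> I. lab i = c}} * k
      = card {i \<in> I. k < card {i' \<in> I. lab i' = lab i}}"
      using I unfolding split Z_def[symmetric] by (subst card_Un_disjoint) (auto simp: cP)
  qed
qed

text \<open>Integer division of its index by \<open>m\<close> finds the coarse cube that contains a
  fine cube. The number of fine cubes is read off from the volumes.\<close>

lemma subcells:
  fixes c :: "int^'n::finite"
  assumes H: "H > 0" and m: "m > 0"
  defines "h \<equiv> H / real m" and "Sub \<equiv> \<lambda>c :: int^'n. {z. \<forall>j. z $ j div int m = c $ j}"
  shows "z \<in> Sub c \<Longrightarrow> cell h z \<subseteq> cell H c" "finite (Sub c)" "card (Sub c) = m ^ CARD('n)"
    "c \<noteq> c' \<Longrightarrow> Sub c \<inter> Sub c' = {}"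
proof -
  have h: "h > 0" using H m by (simp add: h_def)
  have idx: "cell_index h x $ j div int m = cell_index H x $ j" for x :: "real^'n" and j
  proof -
    have "\<lfloor>x $ j / h\<rfloor> div int m = \<lfloor>(x $ j / h) / real m\<rfloor>"
      using floor_divide_real_eq_div[of "int m" "x $ j / h"] by simp
    also have "(x $ j / h) / real m = x $ j / H" using m by (simp add: h_def)
    finally show ?thesis by (simp add: cell_index_def)
  qed
  show "cell h z \<subseteq> cell H c" if "z \<in> Sub c" for z c
  proof
    fix x assume "x \<in> cell h z"
    then have "cell_index h x = z" by (simp add: cell_def)
    then have "cell_index H x $ j = c $ j" for j using idx[of x j] that by (simp add: Sub_def)
    then show "x \<in> cell H c" by (simp add: cell_def vec_eq_iff)
  qed
  then have sub: "(\<Union>z\<in>Sub c. cell h z) \<subseteq> cell H c" by blast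
  have cov: "cell H c \<subseteq> (\<Union>z\<in>Sub c. cell h z)"
  proof
    fix x assume "x \<in> cell H c"
    then have "cell_index h x \<in> Sub c" using idx by (auto simp: Sub_def cell_def)
    then show "x \<in> (\<Union>z\<in>Sub c. cell h z)" by (auto simp: cell_def)
  qed
  have "Sub c \<subseteq> cell_index h ` (cell H c)"
  proof
    fix z assume z: "z \<in> Sub c"
    have "h *\<^sub>R real_vec z \<in> cell h z" using h by (simp add: mem_cell real_vec_def)
    moreover have "h *\<^sub>R real_vec z \<in> cell H c" using calculation sub z by blast
    ultimately show "z \<in> cell_index h ` (cell H c)" unfolding cell_def by (intro image_eqI[of _ _ "h *\<^sub>R real_vec z"]) auto
  qed
  moreover have "bounded (cell H c)"
    using cell_subset_closed[OF H, of c] by (simp add: shrunk_cell_cbox bounded_subset[OF bounded_cbox])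
  ultimately show fin: "finite (Sub c)"
    using finite_cell_index[OF h] finite_subset by blast
  have "(\<Union>z\<in>Sub c. cell h z) = cell H c" using sub cov by blast
  then have "real (card (Sub c)) * h ^ CARD('n) = H ^ CARD('n)"
    using cells_measure(2)[OF h fin] cell_measure(2)[OF H, of c] by simp
  also have "H ^ CARD('n) = real m ^ CARD('n) * h ^ CARD('n)"
    using m by (simp add: h_def flip: power_mult_distrib)
  finally have "real (card (Sub c)) = real (m ^ CARD('n))" using h by simp
  then show "card (Sub c) = m ^ CARD('n)" by (simp only: of_nat_eq_iff)
  show "c \<noteq> c' \<Longrightarrow> Sub c \<inter> Sub c' = {}" by (auto simp: Sub_def vec_eq_iff)
qed

section \<open>Transport plan and approximation\<close>

context deformation
begin

text \<open>\<open>I1\<close> consists of the cubes that find a slot near their image,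
  \<open>I2\<close> of those that do not, and \<open>I3\<close> of the cubes near the boundary,
  which may stick out of \<open>U\<close>. The coarse side \<open>H\<close> is chosen first, then
  the margin \<omega>, and the fine side \<open>h\<close> last, so that \<open>u\<close> oscillates
  by less than \<omega> on the fine cubes of \<open>I1\<close> and \<open>I2\<close>.\<close>

lemma discrete_plan:
  fixes d R W \<epsilon> \<kappa> :: real and y0 :: "real^'n"
  assumes R: "R > 0" "measure lebesgue U \<le> measure lebesgue (ball y0 R)"
    and W: "U \<subseteq> ball 0 W" "W > 0"
    and \<epsilon>: "0 < \<epsilon>" "\<epsilon> \<le> 1" and \<kappa>: "\<kappa> > 0"
  obtains h I1 I2 I3 f where "h > 0" "finite (I1 \<union> I2 \<union> I3)" "cell_index h ` U = I1 \<union> I2 \<union> I3" "inj_on f (I1 \<union> I2 \<union> I3)"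
    "\<And>z x y. z \<in> I1 \<Longrightarrow> x \<in> cell h z \<Longrightarrow> y \<in> shrunk_cell h 0 (f z) \<Longrightarrow> norm (u x - y) \<le> \<epsilon>"
    "\<And>z y. z \<in> I2 \<Longrightarrow> y \<in> shrunk_cell h 0 (f z) \<Longrightarrow> norm (y0 - y) \<le> R + \<epsilon>"
    "\<And>z y. z \<in> I3 \<Longrightarrow> y \<in> shrunk_cell h 0 (f z) \<Longrightarrow> norm (y0 - y) \<le> W + real CARD('n) + 1"
    "measure lebesgue (\<Union>z\<in>I2. cell h z) \<le> excess + \<epsilon>"
    "measure lebesgue (U \<inter> (\<Union>z\<in>I3. cell h z)) \<le> \<kappa>"
proof -
  define n where "n = real CARD('n)"
  have n: "n \<ge> 1" by (simp add: n_def Suc_le_eq)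
  obtain K where K: "compact K" "K \<subseteq> U" "U - K \<in> lmeasurable" "measure lebesgue (U - K) < \<kappa>"
  proof -
    obtain T where T: "closed T" "T \<subseteq> U" "U - T \<in> lmeasurable" "emeasure lebesgue (U - T) < ennreal \<kappa>"
      using sets_lebesgue_inner_closed[OF fmeasurableD[OF U_lmeasurable] \<kappa>] by blast
    moreover have "compact T" using T U(2) bounded_subset compact_eq_bounded_closed by blast
    ultimately show thesis
      by (intro that[of T]) (auto simp: emeasure_eq_measure2 ennreal_less_iff)
  qed
  obtain \<rho> where \<rho>: "\<rho> > 0" "(\<Union>x\<in>K. cball x \<rho>) \<subseteq> U"
    using compact_subset_open_imp_cball_epsilon_subset[OF K(1) U(1) K(2)] by blast
  define K' where "K' = (\<Union>x\<in>K. cball x \<rho>)"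
  have "compact (\<Union>x\<in>K. \<Union>y\<in>cball 0 \<rho>. {x + y})" by (rule compact_sums'[OF K(1) compact_cball])
  moreover have "(\<Union>x\<in>K. \<Union>y\<in>cball 0 \<rho>. {x + y}) = K'"
  proof -
    have "(\<Union>y\<in>cball 0 \<rho>. {x + y}) = cball x \<rho>" for x :: "real^'n"
    proof -
      have "(\<Union>y\<in>cball 0 \<rho>. {x + y}) = (+) x ` cball 0 \<rho>" by (rule UNION_singleton_eq_range)
      also have "\<dots> = cball x \<rho>" using cball_translation[of x 0 \<rho>] by simp
      finally show ?thesis .
    qed
    then show ?thesis by (simp add: K'_def)
  qed
  ultimately have K': "compact K'" "K' \<subseteq> U" using \<rho>(2) by (auto simp: K'_def)
  have uc: "uniformly_continuous_on K' u"
    using K' u_cont by (intro compact_uniformly_continuous) (auto intro: continuous_on_subset)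
  \<comment> \<open>The diameter of a coarse cube, that of a fine cube and the oscillation \<omega>
    each get a quarter of \<epsilon>.\<close>
  define H where "H = \<epsilon> / (4 * n)"
  have H: "H > 0" "n * H = \<epsilon> / 4" using \<epsilon> n by (auto simp: H_def)
  have bu: "bounded (u ` U)"
  proof -
    obtain C where "\<And>x. x \<in> U \<Longrightarrow> norm (u x) \<le> C" using u_bounded by blast
    then show ?thesis by (auto simp: bounded_iff)
  qed
  define CH where "CH = cell_index H ` (u ` U)"
  have CH: "finite CH" unfolding CH_def by (rule finite_cell_index[OF H(1) bu])
  \<comment> \<open>Enlarging the coarse cubes by \<omega> on every side is to add at most
    \<epsilon> to their total volume. All coarse cubes met by the image are counted, because the
    overfull ones are known only after \<open>h\<close> is chosen.\<close>
  obtain \<omega> where \<omega>: "\<omega> > 0" "\<omega> \<le> \<epsilon> / 4" "real (card CH) * ((H + 2 * \<omega>) ^ CARD('n) - H ^ CARD('n)) \<le> \<epsilon>"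
  proof -
    have "isCont (\<lambda>\<omega>. real (card CH) * ((H + 2 * \<omega>) ^ CARD('n) - H ^ CARD('n))) 0"
      by (intro continuous_intros)
    then obtain s where s: "s > 0" "\<And>\<omega>. dist \<omega> 0 < s \<Longrightarrow>
        dist (real (card CH) * ((H + 2 * \<omega>) ^ CARD('n) - H ^ CARD('n))) (real (card CH) * ((H + 2 * 0) ^ CARD('n) - H ^ CARD('n))) < \<epsilon>"
      using \<epsilon>(1) unfolding continuous_at_eps_delta dist_norm by meson
    show thesis
    proof (rule that[of "min (\<epsilon> / 4) (s / 2)"])
      let ?w = "min (\<epsilon> / 4) (s / 2)"
      show "?w > 0" using \<epsilon> s by simp
      have "dist ?w 0 < s" using s(1) \<epsilon>(1) by (auto simp: dist_real_def min_def)
      from s(2)[OF this] show "real (card CH) * ((H + 2 * ?w) ^ CARD('n) - H ^ CARD('n)) \<le> \<epsilon>"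
        by (simp add: dist_real_def)
    qed simp
  qed
  obtain s where s: "s > 0" "\<And>x x'. x \<in> K' \<Longrightarrow> x' \<in> K' \<Longrightarrow> dist x' x < s \<Longrightarrow> dist (u x') (u x) < \<omega>"
    using uc \<omega>(1) unfolding uniformly_continuous_on_def by meson
  \<comment> \<open>Fine cubes of diameter below \<rho> that meet \<open>K\<close> stay in
    \<open>K'\<close>; diameter below \<open>s\<close> makes the oscillation of \<open>u\<close> on
    them less than \<omega>.\<close>
  define q where "q = min \<rho> (min s (\<epsilon> / 4))"
  have q: "q > 0" using \<rho> s \<epsilon> by (simp add: q_def)
  obtain m :: nat where m: "n * H / q < real m" using reals_Archimedean2 by blast
  have "0 \<le> n * H / q" using H q \<epsilon> by simp
  then have m0: "m > 0" using m by (metis gr0I not_less of_nat_0)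
  define h where "h = H / real m"
  have h: "h > 0" using H m0 by (simp add: h_def)
  have nh: "n * h < q" using m m0 q by (simp add: h_def field_simps)
  then have nh': "n * h < \<rho>" "n * h < s" "n * h \<le> \<epsilon> / 4" by (auto simp: q_def)
  define Sub where "Sub c = {z :: int^'n. \<forall>j. z $ j div int m = c $ j}" for c :: "int^'n"
  have sub: "z \<in> Sub c \<Longrightarrow> cell h z \<subseteq> cell H c" "finite (Sub c)" "card (Sub c) = m ^ CARD('n)"
    "c \<noteq> c' \<Longrightarrow> Sub c \<inter> Sub c' = {}" for z c c'
    unfolding h_def Sub_def using subcells[OF H(1) m0] by blast+
  define p where "p z = h *\<^sub>R real_vec z" for z :: "int^'n"
  have p: "p z \<in> cell h z" for z using h by (simp add: p_def mem_cell real_vec_def)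
  have diam: "norm (x - y) \<le> n * h" if "x \<in> shrunk_cell h 0 z" "y \<in> shrunk_cell h 0 z" for x y :: "real^'n" and z
    using closed_cell_diameter[OF that] by (simp add: n_def)
  have cl: "cell h z \<subseteq> shrunk_cell h 0 z" for z :: "int^'n" by (rule cell_subset_closed[OF h])
  define I where "I = cell_index h ` U"
  have I: "finite I" unfolding I_def by (rule finite_cell_index[OF h U(2)])
  define J where "J = {z \<in> I. cell h z \<inter> K \<noteq> {}}"
  have J: "finite J" "J \<subseteq> I" using I by (auto simp: J_def)
  have cellJ: "cell h z \<subseteq> K'" if zJ: "z \<in> J" for z
  proof
    fix x assume x: "x \<in> cell h z"
    obtain x0 where x0: "x0 \<in> cell h z" "x0 \<in> K" using zJ by (auto simp: J_def)
    have "norm (x0 - x) \<le> n * h" using diam cl x x0(1) by blast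
    then have "x \<in> cball x0 \<rho>" using nh'(1) by (simp add: dist_norm)
    then show "x \<in> K'" using x0(2) by (auto simp: K'_def)
  qed
  \<comment> \<open>The corner \<open>p z\<close> represents its cube: its image selects the coarse
    cube in which a slot is sought.\<close>
  define lab where "lab z = cell_index H (u (p z))" for z
  have pJ: "p z \<in> U" if "z \<in> J" for z using cellJ[OF that] p K'(2) by blast
  have labCH: "lab z \<in> CH" if "z \<in> J" for z using pJ[OF that] by (simp add: lab_def CH_def)
  have osc: "norm (u x - u (p z)) < \<omega>" if "z \<in> J" "x \<in> cell h z" for x z
  proof -
    have "norm (x - p z) \<le> n * h" using diam cl that(2) p by blast
    then have "dist x (p z) < s" using nh'(2) by (simp add: dist_norm)
    then show ?thesis using s(2)[of "p z" x] cellJ[OF that(1)] that(2) p by (auto simp: dist_norm)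
  qed
  obtain I1 f1 where I1: "I1 \<subseteq> J" "inj_on f1 I1" "\<And>z. z \<in> I1 \<Longrightarrow> f1 z \<in> Sub (lab z)"
    and cardI2: "card (J - I1) + card {c \<in> lab ` J. m ^ CARD('n) < card {z \<in> J. lab z = c}} * m ^ CARD('n)
      = card {z \<in> J. m ^ CARD('n) < card {z' \<in> J. lab z' = lab z}}"
    by (rule greedy_assignment[where Sub=Sub and lab=lab, OF J(1) sub(2,3,4)]) (assumption, rule that)
  define I2 where "I2 = J - I1"
  define I3 where "I3 = I - J"
  define Z where "Z = {c \<in> lab ` J. m ^ CARD('n) < card {z \<in> J. lab z = c}}"
  define B where "B = {z \<in> J. m ^ CARD('n) < card {z' \<in> J. lab z' = lab z}}"
  have fin: "finite I1" "finite I2" "finite I3" "finite Z" "finite B" "Z \<subseteq> CH" "B \<subseteq> J"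
    using I J I1 labCH finite_subset by (auto simp: I2_def I3_def Z_def B_def)
  \<comment> \<open>The map \<open>u\<close> sends every cube with an overfull label into the
    overfull coarse cubes enlarged by \<omega>. The volume of these cubes is thus at most that of
    \<open>E\<close> plus the excess.\<close>
  define E where "E = (\<Union>c\<in>Z. shrunk_cell H (- \<omega>) c)"
  have E: "closed E" "E \<in> lmeasurable" "measure lebesgue E \<le> real (card Z) * (H + 2 * \<omega>) ^ CARD('n)"
  proof -
    show "closed E" unfolding E_def shrunk_cell_cbox using fin by (intro closed_UN) auto
    show "E \<in> lmeasurable" unfolding E_def shrunk_cell_cbox using fin by (intro fmeasurable.finite_UN) auto
    have "measure lebesgue E \<le> (\<Sum>c\<in>Z. measure lebesgue (shrunk_cell H (- \<omega>) c))"
      unfolding E_def using fin by (intro measure_UNION_le) (auto simp: shrunk_cell_cbox)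
    also have "\<dots> = (\<Sum>c\<in>Z. (H + 2 * \<omega>) ^ CARD('n))"
    proof (rule sum.cong[OF refl])
      show "measure lebesgue (shrunk_cell H (- \<omega>) c) = (H + 2 * \<omega>) ^ CARD('n)" for c :: "int^'n"
        using shrunk_cell_measure(2)[of "- \<omega>" H c] H(1) \<omega>(1) by simp
    qed
    finally show "measure lebesgue E \<le> real (card Z) * (H + 2 * \<omega>) ^ CARD('n)" by simp
  qed
  have cellB: "(\<Union>z\<in>B. cell h z) \<subseteq> U \<inter> u -` E"
  proof clarify
    fix z x assume z: "z \<in> B" and x: "x \<in> cell h z"
    then have zJ: "z \<in> J" and labZ: "lab z \<in> Z" by (auto simp: B_def Z_def)
    have "x \<in> U" using cellJ[OF zJ] x K'(2) by blast
    moreover have "u x \<in> shrunk_cell H (- \<omega>) (lab z)"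
    proof -
      have "u (p z) \<in> cell H (lab z)" by (simp add: cell_def lab_def)
      then have "H * real_of_int (lab z $ j) \<le> u (p z) $ j" "u (p z) $ j < H * (real_of_int (lab z $ j) + 1)" for j
        using H(1) by (simp_all add: mem_cell)
      moreover have "\<bar>u x $ j - u (p z) $ j\<bar> < \<omega>" for j
        using osc[OF zJ x] component_le_norm_cart[of "u x - u (p z)" j] by simp
      ultimately have "H * real_of_int (lab z $ j) + - \<omega> \<le> u x $ j \<and> u x $ j \<le> H * (real_of_int (lab z $ j) + 1) - - \<omega>" for j
        by (smt (verit))
      then show ?thesis by (simp add: shrunk_cell_def)
    qed
    ultimately show "x \<in> U \<inter> u -` E" using labZ by (auto simp: E_def)
  qed
  have m2: "measure lebesgue (\<Union>z\<in>I2. cell h z) \<le> excess + \<epsilon>"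
  proof -
    have Em: "E \<in> sets borel" using E(1) by simp
    have "real (card B) * h ^ CARD('n) \<le> measure lebesgue (U \<inter> u -` E)"
      by (rule card_cells_le[OF h fin(5) preimage_lmeasurable[OF Em] cellB])
    also have "\<dots> \<le> measure lebesgue E + excess" by (rule measure_preimage_le_excess[OF Em E(2)])
    finally have 1: "real (card B) * h ^ CARD('n) \<le> real (card Z) * (H + 2 * \<omega>) ^ CARD('n) + excess"
      using E(3) by linarith
    \<comment> \<open>The filled slots account for the full volume \<open>H ^ CARD('n)\<close> of
      each overfull coarse cube. What remains of the volume of \<open>B\<close> is bounded by the
      enlargement and the excess.\<close>
    have "card I2 + card Z * m ^ CARD('n) = card B"
      using cardI2 unfolding I2_def Z_def B_def .
    then have "real (card I2 + card Z * m ^ CARD('n)) = real (card B)" by (rule arg_cong)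
    then have "(real (card I2) + real (card Z) * real m ^ CARD('n)) * h ^ CARD('n) = real (card B) * h ^ CARD('n)"
      by simp
    then have "real (card I2) * h ^ CARD('n) + real (card Z) * (real m ^ CARD('n) * h ^ CARD('n)) = real (card B) * h ^ CARD('n)"
      by (simp only: distrib_right mult.assoc)
    moreover have "real m ^ CARD('n) * h ^ CARD('n) = H ^ CARD('n)"
      using m0 by (simp add: h_def flip: power_mult_distrib)
    ultimately have "real (card I2) * h ^ CARD('n) \<le> real (card Z) * (H + 2 * \<omega>) ^ CARD('n) - real (card Z) * H ^ CARD('n) + excess"
      using 1 by simp
    also have "real (card Z) * (H + 2 * \<omega>) ^ CARD('n) - real (card Z) * H ^ CARD('n) = real (card Z) * ((H + 2 * \<omega>) ^ CARD('n) - H ^ CARD('n))"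
      by (simp add: right_diff_distrib)
    also have "\<dots> \<le> real (card CH) * ((H + 2 * \<omega>) ^ CARD('n) - H ^ CARD('n))"
      using fin(6) CH H(1) \<omega>(1) by (intro mult_right_mono) (auto intro: card_mono power_mono)
    finally show ?thesis using \<omega>(3) by (simp add: cells_measure(2)[OF h fin(2)])
  qed
  have hn: "h ^ CARD('n) > 0" using h by simp
  define T1 where "T1 = cell_index h ` ball y0 R"
  have T1: "finite T1" unfolding T1_def by (rule finite_cell_index[OF h bounded_ball])
  \<comment> \<open>By volume, the cubes that meet the ball are at least as many as those of
    \<open>J\<close>. So there is room for \<open>I2\<close> even when the slots of
    \<open>I1\<close> occupy some of them.\<close>
  have card12: "card I1 + card I2 \<le> card T1"
  proof -
    have "(\<Union>z\<in>J. cell h z) \<subseteq> U" using cellJ K'(2) by blast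
    then have "real (card J) * h ^ CARD('n) \<le> measure lebesgue U"
      by (rule card_cells_le[OF h J(1) U_lmeasurable])
    also have "\<dots> \<le> measure lebesgue (ball y0 R)" by (rule R(2))
    also have "\<dots> \<le> real (card T1) * h ^ CARD('n)"
      by (rule card_cells_ge[OF h T1 lmeasurable_ball]) (unfold T1_def, rule subset_cells)
    finally have "card J \<le> card T1" using hn by simp
    moreover have "card J = card I1 + card I2"
      using I1(1) J(1) fin(1) by (simp add: I2_def card_Diff_subset card_mono)
    ultimately show ?thesis by simp
  qed
  have disj12: "I1 \<inter> I2 = {}" by (auto simp: I2_def)
  obtain f2 where f2: "\<And>z. z \<in> I1 \<Longrightarrow> f2 z = f1 z" "inj_on f2 (I1 \<union> I2)" "f2 ` I2 \<subseteq> T1"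
    by (rule extend_inj_on[OF fin(1,2) T1 I1(2) disj12 card12]) (rule that)
  have J12: "I1 \<union> I2 = J" using I1(1) by (auto simp: I2_def)
  have I123: "I1 \<union> I2 \<union> I3 = I" using J12 J(2) by (auto simp: I3_def)
  \<comment> \<open>The cubes of \<open>I\<close> lie in the ball of radius \<open>W + n\<close>
    around 0, so the ball of the same radius around \<open>y0\<close> meets at least as many
    cubes.\<close>
  define T2 where "T2 = cell_index h ` ball y0 (W + n)"
  have T2: "finite T2" unfolding T2_def by (rule finite_cell_index[OF h bounded_ball])
  have cardJ3: "card J + card I3 \<le> card T2"
  proof -
    have "(\<Union>z\<in>I. cell h z) \<subseteq> ball 0 (W + n)"
    proof clarify
      fix z x assume z: "z \<in> I" and x: "x \<in> cell h z"
      obtain x0 where x0: "x0 \<in> U" "x0 \<in> cell h z" using z by (auto simp: I_def cell_def)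
      have "norm (x - x0) \<le> n * h" using diam cl x x0(2) by blast
      moreover have "norm x0 < W" using x0(1) W(1) by auto
      moreover have "norm x \<le> norm x0 + norm (x - x0)" by (rule norm_triangle_sub)
      ultimately show "x \<in> ball 0 (W + n)" using nh'(3) \<epsilon>(2) n by simp
    qed
    then have "real (card I) * h ^ CARD('n) \<le> measure lebesgue (ball (0 :: real^'n) (W + n))"
      by (rule card_cells_le[OF h I lmeasurable_ball])
    also have "\<dots> = measure lebesgue (ball y0 (W + n))"
      using W(2) n content_ball_conv_unit_ball[of "W + n" y0] content_ball_conv_unit_ball[of "W + n" "0 :: real^'n"] by simp
    also have "\<dots> \<le> real (card T2) * h ^ CARD('n)"
      by (rule card_cells_ge[OF h T2 lmeasurable_ball]) (unfold T2_def, rule subset_cells)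
    finally have "card I \<le> card T2" using hn by simp
    moreover have "card I = card J + card I3"
      using J I by (simp add: I3_def card_Diff_subset card_mono)
    ultimately show ?thesis by simp
  qed
  have f2J: "inj_on f2 J" "J \<inter> I3 = {}" using f2(2) J12 by (auto simp: I3_def)
  obtain f where f: "\<And>z. z \<in> J \<Longrightarrow> f z = f2 z" "inj_on f (J \<union> I3)" "f ` I3 \<subseteq> T2"
    by (rule extend_inj_on[OF J(1) fin(3) T2 f2J cardJ3]) (rule that)
  show thesis
  proof (rule that[of h I1 I2 I3 f])
    show "finite (I1 \<union> I2 \<union> I3)" "cell_index h ` U = I1 \<union> I2 \<union> I3" using I by (simp_all add: I123) (simp add: I_def)
    show "inj_on f (I1 \<union> I2 \<union> I3)" using f(2) J12 by simp
    show "norm (u x - y) \<le> \<epsilon>" if z: "z \<in> I1" and x: "x \<in> cell h z" and y: "y \<in> shrunk_cell h 0 (f z)" for z x y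
    proof -
      have zJ: "z \<in> J" using z I1(1) by blast
      have fz: "f z \<in> Sub (lab z)" using f(1)[OF zJ] f2(1)[OF z] I1(3)[OF z] by simp
      have "p (f z) \<in> cell H (lab z)" using sub(1)[OF fz] p by blast
      moreover have "u (p z) \<in> cell H (lab z)" by (simp add: cell_def lab_def)
      ultimately have "norm (u (p z) - p (f z)) \<le> n * H"
        using cell_subset_closed[OF H(1)] closed_cell_diameter[of "u (p z)" H "lab z" "p (f z)"] by (auto simp: n_def)
      moreover have "norm (p (f z) - y) \<le> n * h" using diam cl p y by blast
      moreover have "norm (u x - u (p z)) < \<omega>" by (rule osc[OF zJ x])
      moreover have "norm (u x - y) \<le> norm (u x - u (p z)) + norm (u (p z) - p (f z)) + norm (p (f z) - y)"
        using norm_triangle_ineq[of "u x - u (p z)" "u (p z) - y"] norm_triangle_ineq[of "u (p z) - p (f z)" "p (f z) - y"] by simp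
      ultimately show ?thesis using H(2) nh'(3) \<omega>(2) \<epsilon>(1) by linarith
    qed
    show "norm (y0 - y) \<le> R + \<epsilon>" if z: "z \<in> I2" and y: "y \<in> shrunk_cell h 0 (f z)" for z y
    proof -
      have "f z \<in> T1" using f(1)[of z] f2(3) z by (auto simp: I2_def)
      then obtain b where b: "b \<in> ball y0 R" "b \<in> cell h (f z)" by (auto simp: T1_def cell_def)
      have "norm (b - y) \<le> n * h" using diam cl b(2) y by blast
      moreover have "norm (y0 - b) < R" using b(1) by (simp add: dist_norm)
      moreover have "norm (y0 - y) \<le> norm (y0 - b) + norm (b - y)" using norm_triangle_ineq[of "y0 - b" "b - y"] by simp
      ultimately show ?thesis using nh'(3) \<epsilon>(1) by linarith
    qed
    show "norm (y0 - y) \<le> W + real CARD('n) + 1" if z: "z \<in> I3" and y: "y \<in> shrunk_cell h 0 (f z)" for z y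
    proof -
      have "f z \<in> T2" using f(3) z by blast
      then obtain b where b: "b \<in> ball y0 (W + n)" "b \<in> cell h (f z)" by (auto simp: T2_def cell_def)
      have "norm (b - y) \<le> n * h" using diam cl b(2) y by blast
      moreover have "norm (y0 - b) < W + n" using b(1) by (simp add: dist_norm)
      moreover have "norm (y0 - y) \<le> norm (y0 - b) + norm (b - y)" using norm_triangle_ineq[of "y0 - b" "b - y"] by simp
      ultimately show ?thesis using nh'(3) \<epsilon> by (simp add: n_def)
    qed
    show "measure lebesgue (U \<inter> (\<Union>z\<in>I3. cell h z)) \<le> \<kappa>"
    proof -
      have "U \<inter> (\<Union>z\<in>I3. cell h z) \<subseteq> U - K" by (auto simp: I3_def J_def)
      moreover have "U \<inter> (\<Union>z\<in>I3. cell h z) \<in> sets lebesgue"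
        using U_lmeasurable cells_measure(1)[OF h fin(3)] by (intro sets.Int) auto
      ultimately have "measure lebesgue (U \<inter> (\<Union>z\<in>I3. cell h z)) \<le> measure lebesgue (U - K)"
        using K(3) by (intro measure_mono_fmeasurable)
      then show ?thesis using K(4) by simp
    qed
  qed (use h m2 in auto)
qed

end

section \<open>From the assignment of cubes to a diffeomorphism\<close>

context deformation
begin

text \<open>Four costs are added: \<epsilon> on the well placed cubes,
  \<open>d + R + \<epsilon>\<close> on a volume of at most \<open>excess + \<epsilon>\<close>, the
  bound \<open>D\<close> on a volume of at most \<open>\<epsilon> / D\<close> near the boundary, and
  \<open>Mb\<close> on the layers at the faces of the cubes.\<close>

lemma unimodular_approximation:
  fixes d R \<tau> :: real and y0 :: "real^'n"
  assumes card: "CARD('n) \<ge> 2" and d: "\<And>x. x \<in> U \<Longrightarrow> norm (u x - y0) \<le> d" "0 \<le> d"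
    and R: "R > 0" "measure lebesgue U \<le> measure lebesgue (ball y0 R)" and \<tau>: "\<tau> > 0"
  obtains \<Phi> where "unimodular_C1 \<Phi>" "(LINT x:U|lebesgue. norm (u x - \<Phi> x)) \<le> (d + R) * excess + \<tau>"
proof -
  let ?V = "measure lebesgue U" and ?n = "real CARD('n)"
  obtain W0 where W0: "\<And>x. x \<in> U \<Longrightarrow> norm x \<le> W0" using U(2) by (auto simp: bounded_iff)
  define W where "W = max W0 0 + 1"
  have W: "U \<subseteq> ball 0 W" "W > 0"
  proof
    fix x assume "x \<in> U"
    then show "x \<in> ball 0 W" using W0[of x] by (simp add: W_def max_def)
  qed (simp add: W_def max_def)
  \<comment> \<open>\<open>u\<close> stays within \<open>d\<close> of \<open>y0\<close>, and the
    slots of the boundary cubes within \<open>W + ?n + 1\<close> of it.\<close>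
  define D where "D = d + (W + ?n + 1)"
  have D: "D > 0" using d(2) W(2) by (simp add: D_def add_nonneg_pos)
  have ex0: "excess \<ge> 0" by (rule excess_le(1))
  \<comment> \<open>The total coefficient of \<epsilon> in the final sum, with \<epsilon> inside it
    replaced by 1.\<close>
  define S where "S = ?V + excess + d + R + 3"
  have S: "S > 0" using ex0 d(2) R(1) by (simp add: S_def add_nonneg_pos)
  define \<epsilon> where "\<epsilon> = min 1 (\<tau> / S)"
  have \<epsilon>: "\<epsilon> > 0" "\<epsilon> \<le> 1" "\<epsilon> * S \<le> \<tau>"
    using \<tau> S by (auto simp: \<epsilon>_def min_def field_simps)
  obtain h I1 I2 I3 f where h: "h > 0" and fin: "finite (I1 \<union> I2 \<union> I3)" and I: "cell_index h ` U = I1 \<union> I2 \<union> I3"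
    and inj: "inj_on f (I1 \<union> I2 \<union> I3)"
    and b1: "\<And>z x y. z \<in> I1 \<Longrightarrow> x \<in> cell h z \<Longrightarrow> y \<in> shrunk_cell h 0 (f z) \<Longrightarrow> norm (u x - y) \<le> \<epsilon>"
    and b2: "\<And>z y. z \<in> I2 \<Longrightarrow> y \<in> shrunk_cell h 0 (f z) \<Longrightarrow> norm (y0 - y) \<le> R + \<epsilon>"
    and b3: "\<And>z y. z \<in> I3 \<Longrightarrow> y \<in> shrunk_cell h 0 (f z) \<Longrightarrow> norm (y0 - y) \<le> W + ?n + 1"
    and m2: "measure lebesgue (\<Union>z\<in>I2. cell h z) \<le> excess + \<epsilon>"
    and m3: "measure lebesgue (U \<inter> (\<Union>z\<in>I3. cell h z)) \<le> \<epsilon> / D"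
    by (rule discrete_plan[OF R W \<epsilon>(1,2), of "\<epsilon> / D"]) (use \<epsilon>(1) D in simp, rule that)
  let ?I = "I1 \<union> I2 \<union> I3"
  have "reach ?I (\<lambda>z. z) f" by (rule reach_all[OF card fin _ inj]) (simp add: inj_on_def)
  from reach_realize[OF this fin h] obtain M where M: "\<And>\<delta>. \<delta> > 0 \<Longrightarrow> \<exists>\<Phi>. unimodular_C1 \<Phi> \<and> (\<forall>x. norm (\<Phi> x - x) \<le> M) \<and>
    (\<forall>z\<in>?I. \<forall>x\<in>shrunk_cell h \<delta> z. \<Phi> x = x + h *\<^sub>R (real_vec (f z) - real_vec z))" by blast
  define Mb where "Mb = d + norm y0 + W + \<bar>M\<bar>"
  have Mb: "Mb \<ge> 0" using d(2) W(2) by (simp add: Mb_def)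
  \<comment> \<open>\<open>Mb\<close> is already fixed, since the displacement bound
    \<open>M\<close> holds for every \<delta>; the volume of the layers tends to 0 with
    \<delta>.\<close>
  obtain \<delta> where \<delta>: "\<delta> > 0" "2 * \<delta> \<le> h" "Mb * (real (card ?I) * (h ^ CARD('n) - (h - 2 * \<delta>) ^ CARD('n))) \<le> \<epsilon>"
  proof -
    let ?g = "\<lambda>\<delta>. Mb * (real (card ?I) * (h ^ CARD('n) - (h - 2 * \<delta>) ^ CARD('n)))"
    have "isCont ?g 0" by (intro continuous_intros)
    then obtain s where s: "s > 0" "\<And>\<delta>. dist \<delta> 0 < s \<Longrightarrow> dist (?g \<delta>) (?g 0) < \<epsilon>"
      using \<epsilon>(1) unfolding continuous_at_eps_delta dist_norm by meson
    show thesis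
    proof (rule that[of "min (h / 2) (s / 2)"])
      let ?w = "min (h / 2) (s / 2)"
      show "?w > 0" using h s by simp
      have "dist ?w 0 < s" using s(1) h by (auto simp: dist_real_def min_def)
      from s(2)[OF this] show "?g ?w \<le> \<epsilon>" by (simp add: dist_real_def)
    qed simp
  qed
  obtain \<Phi> where \<Phi>: "unimodular_C1 \<Phi>" "\<And>x. norm (\<Phi> x - x) \<le> M"
    "\<And>z x. z \<in> ?I \<Longrightarrow> x \<in> shrunk_cell h \<delta> z \<Longrightarrow> \<Phi> x = x + h *\<^sub>R (real_vec (f z) - real_vec z)"
    using M[OF \<delta>(1)] by blast
  define Bad where "Bad = (\<Union>z\<in>?I. cell h z - shrunk_cell h \<delta> z)"
  have piece: "cell h z - shrunk_cell h \<delta> z \<in> lmeasurable"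
    "measure lebesgue (cell h z - shrunk_cell h \<delta> z) = h ^ CARD('n) - (h - 2 * \<delta>) ^ CARD('n)" for z :: "int^'n"
  proof -
    note c = cell_measure[OF h, of z] and s = shrunk_cell_measure[OF \<delta>(2), of z]
    show "cell h z - shrunk_cell h \<delta> z \<in> lmeasurable" using c(1) s(1) by (intro fmeasurable.Diff)
    show "measure lebesgue (cell h z - shrunk_cell h \<delta> z) = h ^ CARD('n) - (h - 2 * \<delta>) ^ CARD('n)"
      using measurable_measure_Diff[OF c(1) fmeasurableD[OF s(1)] shrunk_cell_subset_cell[OF h \<delta>(1)]] c(2) s(2) by simp
  qed
  have Bad: "Bad \<in> lmeasurable" "measure lebesgue Bad \<le> real (card ?I) * (h ^ CARD('n) - (h - 2 * \<delta>) ^ CARD('n))"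
  proof -
    show "Bad \<in> lmeasurable" unfolding Bad_def by (intro fmeasurable.finite_UN fin piece)
    have "measure lebesgue Bad \<le> (\<Sum>z\<in>?I. measure lebesgue (cell h z - shrunk_cell h \<delta> z))"
      unfolding Bad_def by (rule measure_UNION_le[OF fin fmeasurableD[OF piece(1)]])
    then show "measure lebesgue Bad \<le> real (card ?I) * (h ^ CARD('n) - (h - 2 * \<delta>) ^ CARD('n))"
      by (simp only: piece(2) sum_constant)
  qed
  define C2 where "C2 = (\<Union>z\<in>I2. cell h z)"
  define C3 where "C3 = U \<inter> (\<Union>z\<in>I3. cell h z)"
  have C2: "C2 \<in> lmeasurable" unfolding C2_def using fin by (intro cells_measure(1)[OF h]) simp
  have C3: "C3 \<in> lmeasurable"
    unfolding C3_def using fin cells_measure(1)[OF h, of I3]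
    by (intro fmeasurableI2[OF U_lmeasurable] sets.Int) (use U_lmeasurable in auto)
  define g where "g x = \<epsilon> * indicator U x + (d + R + \<epsilon>) * indicator C2 x + D * indicator C3 x + Mb * indicator Bad x" for x
  have bound: "norm (u x - \<Phi> x) \<le> g x" if x: "x \<in> U" for x
  proof -
    have gx: "\<epsilon> \<le> g x" "x \<in> C2 \<Longrightarrow> d + R + \<epsilon> \<le> g x" "x \<in> C3 \<Longrightarrow> D \<le> g x" "x \<in> Bad \<Longrightarrow> Mb \<le> g x"
      using x \<epsilon>(1) d(2) R(1) D Mb by (auto simp: g_def indicator_def)
    define z where "z = cell_index h x"
    have z: "z \<in> ?I" using x I by (auto simp: z_def)
    have xz: "x \<in> cell h z" by (simp add: cell_def z_def)
    show ?thesis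
    proof (cases "x \<in> shrunk_cell h \<delta> z")
      case True
      have "\<Phi> x \<in> shrunk_cell h \<delta> (f z)"
        unfolding \<Phi>(3)[OF z True] using True by (simp add: shrunk_cell_def real_vec_def algebra_simps)
      then have \<Phi>x: "\<Phi> x \<in> shrunk_cell h 0 (f z)" using shrunk_cell_mono[of 0 \<delta>] \<delta>(1) by (meson less_imp_le subsetD)
      have tri: "norm (u x - \<Phi> x) \<le> norm (u x - y0) + norm (y0 - \<Phi> x)"
        using norm_triangle_ineq[of "u x - y0" "y0 - \<Phi> x"] by simp
      consider "z \<in> I1" | "z \<in> I2" | "z \<in> I3" using z by blast
      then show ?thesis
      proof cases
        case 1
        then show ?thesis using b1[OF 1 xz \<Phi>x] gx(1) by linarith
      next
        case 2
        then have "x \<in> C2" using xz by (auto simp: C2_def)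
        then show ?thesis using b2[OF 2 \<Phi>x] tri d(1)[OF x] gx(2) by linarith
      next
        case 3
        then have "x \<in> C3" using xz x by (auto simp: C3_def)
        then show ?thesis using b3[OF 3 \<Phi>x] tri d(1)[OF x] gx(3) unfolding D_def by linarith
      qed
    next
      case False
      then have "x \<in> Bad" using xz z by (auto simp: Bad_def)
      have "norm (u x - \<Phi> x) \<le> norm (u x - y0) + norm y0 + norm x + norm (\<Phi> x - x)"
      proof -
        have "norm (u x - \<Phi> x) \<le> norm (u x - x) + norm (\<Phi> x - x)"
          using norm_triangle_ineq4[of "u x - x" "\<Phi> x - x"] by simp
        moreover have "norm (u x - x) \<le> norm (u x) + norm x" by (rule norm_triangle_ineq4)
        moreover have "norm (u x) \<le> norm y0 + norm (u x - y0)" by (rule norm_triangle_sub)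
        ultimately show ?thesis by linarith
      qed
      also have "\<dots> \<le> Mb"
      proof -
        have "norm x \<le> W" using W(1) x by (auto simp: subset_iff less_imp_le)
        moreover have "norm (\<Phi> x - x) \<le> \<bar>M\<bar>" using \<Phi>(2)[of x] by linarith
        ultimately show ?thesis using d(1)[OF x] unfolding Mb_def by linarith
      qed
      finally show ?thesis using gx(4)[OF \<open>x \<in> Bad\<close>] by linarith
    qed
  qed
  have int: "integrable lebesgue (\<lambda>x. c * indicator S x)" if "S \<in> lmeasurable" for c :: real and S :: "(real^'n) set"
    using that by (intro integrable_mult_right) (auto simp: fmeasurable_def)
  have ig: "integrable lebesgue g"
    unfolding g_def by (intro Bochner_Integration.integrable_add int U_lmeasurable C2 C3 Bad)
  have g0: "g x \<ge> 0" for x using \<epsilon>(1) d(2) R(1) D Mb by (simp add: g_def)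
  have "(LINT x:U|lebesgue. norm (u x - \<Phi> x)) \<le> (LINT x|lebesgue. g x)"
  proof -
    have "\<bar>LINT x|lebesgue. indicator U x *\<^sub>R norm (u x - \<Phi> x)\<bar> \<le> (LINT x|lebesgue. g x)"
      by (rule abs_integral_le_AE[OF ig AE_I2]) (use bound g0 in \<open>auto simp: indicator_def\<close>)
    then show ?thesis by (simp add: set_lebesgue_integral_def)
  qed
  also have "\<dots> = \<epsilon> * ?V + (d + R + \<epsilon>) * measure lebesgue C2 + D * measure lebesgue C3 + Mb * measure lebesgue Bad"
  proof -
    have val: "(LINT x|lebesgue. c * indicator S x) = c * measure lebesgue S" if "S \<in> lmeasurable" for c :: real and S :: "(real^'n) set"
      using that by simp
    show ?thesis
      unfolding g_def
      by (subst Bochner_Integration.integral_add, (intro Bochner_Integration.integrable_add int U_lmeasurable C2 C3 Bad)+)+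
        (simp only: val U_lmeasurable C2 C3 Bad)
  qed
  also have "\<dots> \<le> \<epsilon> * ?V + (d + R + \<epsilon>) * (excess + \<epsilon>) + \<epsilon> + \<epsilon>"
  proof (intro add_mono order_refl)
    show "(d + R + \<epsilon>) * measure lebesgue C2 \<le> (d + R + \<epsilon>) * (excess + \<epsilon>)"
      using m2 d(2) R(1) \<epsilon>(1) unfolding C2_def by (intro mult_left_mono) auto
    have "D * measure lebesgue C3 \<le> D * (\<epsilon> / D)"
      using m3 D unfolding C3_def by (intro mult_left_mono) auto
    then show "D * measure lebesgue C3 \<le> \<epsilon>" using D by simp
    have "Mb * measure lebesgue Bad \<le> Mb * (real (card ?I) * (h ^ CARD('n) - (h - 2 * \<delta>) ^ CARD('n)))"
      by (rule mult_left_mono[OF Bad(2) Mb])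
    then show "Mb * measure lebesgue Bad \<le> \<epsilon>" using \<delta>(3) by linarith
  qed
  also have "\<dots> = (d + R) * excess + \<epsilon> * (?V + excess + d + R + \<epsilon> + 2)"
    by (simp add: algebra_simps)
  also have "\<dots> \<le> (d + R) * excess + \<epsilon> * S"
    using \<epsilon> by (intro add_left_mono mult_left_mono) (auto simp: S_def)
  finally have "(LINT x:U|lebesgue. norm (u x - \<Phi> x)) \<le> (d + R) * excess + \<tau>" using \<epsilon>(3) by linarith
  then show thesis by (rule that[OF \<Phi>(1)])
qed

end

section \<open>The one-dimensional case\<close>

lemma Ck_diff: "Ck k f \<Longrightarrow> Ck k g \<Longrightarrow> Ck k (\<lambda>x. f x - g x)"
proof (induction k arbitrary: f g)
  case 0
  then show ?case by (simp add: continuous_on_diff)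
next
  case (Suc k)
  have "partial j (\<lambda>x. f x - g x) = (\<lambda>x. partial j f x - partial j g x)" for j
  proof
    fix x
    have "(f has_derivative frechet_derivative f (at x)) (at x)" "(g has_derivative frechet_derivative g (at x)) (at x)"
      using Suc.prems by (simp_all add: frechet_derivative_works[symmetric])
    from partial_eqI[OF has_derivative_diff[OF this], of j] show "partial j (\<lambda>x. f x - g x) x = partial j f x - partial j g x"
      by (simp add: partial_def)
  qed
  then show ?case using Suc by (simp add: differentiable_diff)
qed

text \<open>On the line, a difference of translates of the antiderivative of a bump is a test function; it
  equals the mass of the bump between the two centres.\<close>

lemma flat_exp_antiderivative:
  fixes \<eta> :: real
  assumes \<eta>: "\<eta> > 0"
  obtains B where "\<And>t. (B has_real_derivative flat_exp 0 (1 - t\<^sup>2 / \<eta>\<^sup>2)) (at t)"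
    "\<And>t. t \<le> - \<eta> \<Longrightarrow> B t = 0" "\<And>t. \<eta> \<le> t \<Longrightarrow> B t = (LINT s|lborel. flat_exp 0 (1 - s\<^sup>2 / \<eta>\<^sup>2))"
    "\<And>s t. s \<le> t \<Longrightarrow> B s \<le> B t"
proof -
  define \<beta> where "\<beta> t = flat_exp 0 (1 - t\<^sup>2 / \<eta>\<^sup>2)" for t
  have \<beta>c: "continuous_on S \<beta>" for S
    unfolding \<beta>_def by (intro continuous_on_compose2[OF continuous_on_flat_exp[of UNIV]] continuous_intros) (use \<eta> in auto)
  have \<beta>0: "\<beta> t = 0" if "\<eta> \<le> \<bar>t\<bar>" for t
  proof -
    have "\<eta>\<^sup>2 \<le> t\<^sup>2" using that \<eta> by (metis abs_of_pos power2_abs power_mono less_imp_le)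
    then show ?thesis using \<eta> by (simp add: \<beta>_def flat_exp_def)
  qed
  \<comment> \<open>Starting at \<open>- 2 * \<eta>\<close> makes every point from
    \<open>- \<eta>\<close> on an interior point of an interval of integration; to the left of
    \<open>- \<eta>\<close> the function is constant.\<close>
  define B where "B t = integral {- 2 * \<eta>..t} \<beta>" for t
  have B0: "B t = 0" if "t \<le> - \<eta>" for t
  proof -
    have "B t = integral {- 2 * \<eta>..t} (\<lambda>_. 0)"
      unfolding B_def using that \<eta> by (intro Henstock_Kurzweil_Integration.integral_cong \<beta>0) auto
    then show ?thesis by simp
  qed
  have dB: "(B has_real_derivative \<beta> t) (at t)" for t
  proof (cases "t < - \<eta>")
    case True
    have "((\<lambda>_. 0::real) has_real_derivative 0) (at t)" by simp
    then have "(B has_real_derivative 0) (at t)"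
      by (rule has_field_derivative_transform_within_open[where S="{..< - \<eta>}"]) (use True B0 in auto)
    then show ?thesis using \<beta>0[of t] True \<eta> by simp
  next
    case False
    have "(B has_real_derivative \<beta> t) (at t within {- 2 * \<eta>..t + 1})"
      unfolding B_def by (rule integral_has_real_derivative[OF \<beta>c]) (use False \<eta> in auto)
    moreover have "at t within {- 2 * \<eta>..t + 1} = at t"
      using False \<eta> by (intro at_within_interior) auto
    ultimately show ?thesis by simp
  qed
  have mono: "B s \<le> B t" if "s \<le> t" for s t
  proof (rule DERIV_nonneg_imp_nondecreasing[OF that])
    fix r
    have "0 \<le> \<beta> r" by (simp add: \<beta>_def flat_exp_nonneg)
    then show "\<exists>y. (B has_real_derivative y) (at r) \<and> 0 \<le> y" using dB by blast
  qed
  have const: "B t = B \<eta>" if "\<eta> \<le> t" for t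
  proof (rule antisym)
    show "B \<eta> \<le> B t" by (rule mono[OF that])
    show "B t \<le> B \<eta>"
    proof (rule DERIV_nonpos_imp_nonincreasing[OF that])
      fix s assume "\<eta> \<le> s"
      then have "\<beta> s = 0" using \<eta> by (intro \<beta>0) auto
      then show "\<exists>y. (B has_real_derivative y) (at s) \<and> y \<le> 0" using dB[of s] by auto
    qed
  qed
  have mass: "B \<eta> = (LINT s|lborel. \<beta> s)"
  proof -
    have i: "integrable lborel (\<lambda>x. indicator {- 2 * \<eta>..\<eta>} x *\<^sub>R \<beta> x)"
      by (rule borel_integrable_compact[OF _ \<beta>c]) auto
    then have "(LINT x:{- 2 * \<eta>..\<eta>}|lborel. \<beta> x) = integral {- 2 * \<eta>..\<eta>} \<beta>"
      by (intro set_borel_integral_eq_integral(2)) (simp add: set_integrable_def)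
    moreover have "(LINT x:{- 2 * \<eta>..\<eta>}|lborel. \<beta> x) = (LINT s|lborel. \<beta> s)"
      unfolding set_lebesgue_integral_def
    proof (rule Bochner_Integration.integral_cong)
      fix x
      show "indicator {- 2 * \<eta>..\<eta>} x *\<^sub>R \<beta> x = \<beta> x"
      proof (cases "x \<in> {- 2 * \<eta>..\<eta>}")
        case False
        then have "\<eta> \<le> \<bar>x\<bar>" using \<eta> by auto
        from \<beta>0[OF this] show ?thesis by simp
      qed simp
    qed simp
    ultimately show ?thesis by (simp add: B_def)
  qed
  show thesis
    by (rule that[of B]) (use dB B0 const mass mono in \<open>auto simp: \<beta>_def\<close>)
qed

context
  fixes i :: "'n::finite"
  assumes UNIV_i: "(UNIV :: 'n set) = {i}"
begin

lemma index_eq: "j = i"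
  using UNIV_i by auto

lemma all_index: "(\<forall>j. P j) \<longleftrightarrow> P i"
  using index_eq by metis

lemma vec1_eq_iff: "x = y \<longleftrightarrow> x $ i = y $ i" for x y :: "real^'n"
  using index_eq by (metis vec_eq_iff)

lemma inner1: "x \<bullet> y = x $ i * y $ i" for x y :: "real^'n"
  by (simp add: inner_vec_def UNIV_i)

lemma norm1: "norm x = \<bar>x $ i\<bar>" for x :: "real^'n"
  by (simp add: norm_eq_sqrt_inner inner1)

lemma det1: "det A = A $ i $ i" for A :: "real^'n^'n"
proof -
  have "det A = (\<Prod>j\<in>UNIV. A $ j $ j)"
    by (rule det_diagonal) (metis index_eq)
  then show ?thesis by (simp add: UNIV_i)
qed

lemma lborel_distr_line: "distr lborel borel (\<lambda>t. t *\<^sub>R axis i 1) = (lborel :: (real^'n) measure)"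
proof (rule lborel_eqI[symmetric])
  fix l u :: "real^'n" assume le: "\<And>b. b \<in> Basis \<Longrightarrow> l \<bullet> b \<le> u \<bullet> b"
  have le': "l $ i \<le> u $ i" using le[of "axis i 1"] by (simp add: inner_axis)
  have "(\<lambda>t. t *\<^sub>R axis i 1 :: real^'n) -` box l u = {l $ i<..<u $ i}"
    by (simp add: set_eq_iff mem_box_cart all_index)
  moreover have "(\<lambda>t. t *\<^sub>R axis i 1 :: real^'n) \<in> borel_measurable lborel"
    by (simp add: borel_measurable_continuous_onI continuous_intros)
  ultimately have "emeasure (distr lborel borel (\<lambda>t. t *\<^sub>R axis i 1)) (box l u) = ennreal (u $ i - l $ i)"
    using le' by (subst emeasure_distr) auto
  then show "emeasure (distr lborel borel (\<lambda>t. t *\<^sub>R axis i 1)) (box l u) = (\<Prod>b\<in>Basis. (u - l) \<bullet> b)"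
    by (simp add: prod_Basis_cart UNIV_i inner_axis)
qed simp

lemma bump_line: "bump c \<eta> y = flat_exp 0 (1 - (y $ i - c $ i)\<^sup>2 / \<eta>\<^sup>2)"
  by (simp add: bump_def inner1 power2_eq_square)

lemma bump_mass_line: "bump_mass TYPE('n) \<eta> = (LINT s|lborel. flat_exp 0 (1 - s\<^sup>2 / \<eta>\<^sup>2))"
proof -
  have m: "bump (0::real^'n) \<eta> \<in> borel_measurable borel"
    by (intro borel_measurable_continuous_onI continuous_on_bump)
  have "bump_mass TYPE('n) \<eta> = (LINT y|lborel. bump (0::real^'n) \<eta> y)"
    unfolding bump_mass_def by (rule integral_completion) (simp add: m)
  also have "\<dots> = (LINT y|distr lborel borel (\<lambda>t. t *\<^sub>R axis i 1). bump (0::real^'n) \<eta> y)"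
    by (simp add: lborel_distr_line)
  also have "\<dots> = (LINT s|lborel. bump (0::real^'n) \<eta> (s *\<^sub>R axis i 1))"
    by (rule integral_distr[OF _ m]) (simp add: borel_measurable_continuous_onI continuous_intros)
  finally show ?thesis by (simp add: bump_line)
qed

text \<open>Testing a weak derivative against this function compares smoothed values at
  \<open>x\<close> and \<open>y\<close>. The support lies between \<open>x - \<eta>\<close> and
  \<open>y + \<eta>\<close>, hence in \<open>U\<close> by convexity.\<close>

lemma plateau_test_function:
  fixes x y :: "real^'n"
  assumes U: "convex U" and \<eta>: "\<eta> > 0" and xy: "x $ i \<le> y $ i" and sub: "cball x \<eta> \<subseteq> U" "cball y \<eta> \<subseteq> U"
  obtains \<phi> where "\<phi> \<in> test_functions U" "\<And>z. partial i \<phi> z = bump x \<eta> z - bump y \<eta> z"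
    "\<And>z. 0 \<le> \<phi> z" "\<And>z. \<phi> z \<le> bump_mass TYPE('n) \<eta>" "\<And>z. (\<phi> has_derivative (\<lambda>v. v $ i * (bump x \<eta> z - bump y \<eta> z))) (at z)"
proof -
  obtain B where B: "\<And>t. (B has_real_derivative flat_exp 0 (1 - t\<^sup>2 / \<eta>\<^sup>2)) (at t)"
    "\<And>t. t \<le> - \<eta> \<Longrightarrow> B t = 0" "\<And>t. \<eta> \<le> t \<Longrightarrow> B t = (LINT s|lborel. flat_exp 0 (1 - s\<^sup>2 / \<eta>\<^sup>2))"
    "\<And>s t. s \<le> t \<Longrightarrow> B s \<le> B t"
    by (rule flat_exp_antiderivative[OF \<eta>]) (rule that)
  note B3 = B(3)[folded bump_mass_line]
  define \<phi> where "\<phi> z = B (z $ i - x $ i) - B (z $ i - y $ i)" for z :: "real^'n"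
  have dB: "((\<lambda>z. B (z $ i - c $ i)) has_derivative (\<lambda>v. v $ i * bump c \<eta> z)) (at z)" for c z :: "real^'n"
  proof -
    have "((\<lambda>z. z $ i - c $ i) has_derivative (\<lambda>v. v $ i)) (at z)"
      by (auto intro!: derivative_eq_intros bounded_linear.has_derivative[OF bounded_linear_vec_nth])
    from has_derivative_compose[OF this B(1)[THEN has_field_derivative_imp_has_derivative]]
    show ?thesis by (simp add: bump_line mult.commute)
  qed
  have d\<phi>: "(\<phi> has_derivative (\<lambda>v. v $ i * (bump x \<eta> z - bump y \<eta> z))) (at z)" for z
    unfolding \<phi>_def[abs_def] right_diff_distrib by (intro has_derivative_diff dB)
  have p: "partial i \<phi> z = bump x \<eta> z - bump y \<eta> z" for z
    using partial_eqI[OF d\<phi>, of i] by simp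
  have B0: "0 \<le> B t" "B t \<le> bump_mass TYPE('n) \<eta>" for t
  proof -
    show "0 \<le> B t" using B(2)[of "min t (- \<eta>)"] B(4)[of "min t (- \<eta>)" t] by simp
    show "B t \<le> bump_mass TYPE('n) \<eta>" using B3[of "max t \<eta>"] B(4)[of t "max t \<eta>"] by simp
  qed
  have Ck: "Ck k \<phi>" for k
  proof (cases k)
    case 0
    have "continuous_on UNIV \<phi>"
      using d\<phi> by (meson continuous_at_imp_continuous_on has_derivative_continuous)
    then show ?thesis using 0 by simp
  next
    case (Suc k')
    have "partial j \<phi> = (\<lambda>z. bump x \<eta> z - bump y \<eta> z)" for j
      using p index_eq[of j] by auto
    moreover have "\<phi> differentiable (at z)" for z using d\<phi> by (auto simp: differentiable_def)
    ultimately show ?thesis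
      using Suc by (simp add: Ck_diff bump_space_Ck[OF bump_in_bump_space])
  qed
  let ?K = "{z :: real^'n. x $ i - \<eta> \<le> z $ i \<and> z $ i \<le> y $ i + \<eta>}"
  have K: "?K = cbox (x - \<eta> *\<^sub>R axis i 1) (y + \<eta> *\<^sub>R axis i 1)"
    by (simp add: set_eq_iff mem_box_cart all_index)
  have "{z. \<phi> z \<noteq> 0} \<subseteq> ?K"
  proof
    fix z assume z: "z \<in> {z. \<phi> z \<noteq> 0}"
    show "z \<in> ?K"
    proof (rule ccontr)
      assume "z \<notin> ?K"
      then consider "z $ i < x $ i - \<eta>" | "y $ i + \<eta> < z $ i" by force
      then have "\<phi> z = 0"
      proof cases
        case 1
        then show ?thesis using B(2)[of "z $ i - x $ i"] B(2)[of "z $ i - y $ i"] xy by (simp add: \<phi>_def)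
      next
        case 2
        then show ?thesis using B3[of "z $ i - x $ i"] B3[of "z $ i - y $ i"] xy by (simp add: \<phi>_def)
      qed
      then show False using z by simp
    qed
  qed
  then have cl: "closure {z. \<phi> z \<noteq> 0} \<subseteq> ?K"
    unfolding K by (intro closure_minimal) auto
  have "?K \<subseteq> U"
  proof
    fix z assume z: "z \<in> ?K"
    let ?a = "x - \<eta> *\<^sub>R axis i 1" and ?b = "y + \<eta> *\<^sub>R axis i 1"
    define t where "t = (z $ i - ?a $ i) / (?b $ i - ?a $ i)"
    have ab: "?b $ i - ?a $ i > 0" using xy \<eta> by simp
    have t: "0 \<le> t" "t \<le> 1" using z ab by (auto simp: t_def divide_le_eq)
    have "?a \<in> U" "?b \<in> U" using sub \<eta> by (auto simp: subset_iff dist_norm)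
    then have "(1 - t) *\<^sub>R ?a + t *\<^sub>R ?b \<in> U" using U t by (intro convexD) auto
    moreover have "(1 - t) *\<^sub>R ?a + t *\<^sub>R ?b = z"
    proof -
      have "t * (?b $ i - ?a $ i) = z $ i - ?a $ i" using ab by (simp add: t_def)
      then show ?thesis unfolding vec1_eq_iff by (simp add: algebra_simps)
    qed
    ultimately show "z \<in> U" by simp
  qed
  then have "\<phi> \<in> test_functions U"
    using cl Ck bounded_subset[OF _ cl] unfolding K by (auto simp: test_functions_def compact_eq_bounded_closed)
  moreover have "0 \<le> \<phi> z" "\<phi> z \<le> bump_mass TYPE('n) \<eta>" for z
  proof -
    show "0 \<le> \<phi> z" using B(4)[of "z $ i - y $ i" "z $ i - x $ i"] xy by (simp add: \<phi>_def)
    show "\<phi> z \<le> bump_mass TYPE('n) \<eta>" using B0[of "z $ i - x $ i"] B0[of "z $ i - y $ i"] by (simp add: \<phi>_def)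
  qed
  ultimately show thesis using p d\<phi> that by blast
qed

end

section \<open>Deviation of a one-dimensional deformation from a translation\<close>

context deformation
begin

text \<open>On the line the determinant is the derivative itself. Tested against the plateau,
  \<open>u\<close> minus the identity has as its smoothed increment the integral of
  \<open>(1 - det (Du z)) * \<phi> z\<close>. The plateau is at most the bump mass, which
  cancels.\<close>

lemma line_increment_le:
  fixes i :: 'n
  assumes UNIV_i: "(UNIV :: 'n set) = {i}" and conv: "convex U" and xy: "x \<in> U" "y \<in> U" "x $ i \<le> y $ i"
  shows "\<bar>(u x $ i - x $ i) - (u y $ i - y $ i)\<bar> \<le> (LINT z:U|lebesgue. \<bar>1 - det (Du z)\<bar>)"
proof (rule field_le_epsilon)
  fix e :: real assume "e > 0"
  let ?E = "LINT z:U|lebesgue. \<bar>1 - det (Du z)\<bar>"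
  define w where "w z = u z $ i - z $ i" for z
  have wc: "continuous_on U w" unfolding w_def by (intro continuous_intros u_cont)
  have "\<exists>\<eta>>0. cball z \<eta> \<subseteq> U \<and> (\<forall>z'\<in>cball z \<eta>. \<bar>w z' - w z\<bar> \<le> e / 2)" if z: "z \<in> U" for z
    by (rule continuous_on_open_cball[OF U(1) wc z]) (use \<open>e > 0\<close> in simp)
  then obtain d1 d2 where d1: "d1 > 0" "cball x d1 \<subseteq> U" "\<And>z. z \<in> cball x d1 \<Longrightarrow> \<bar>w z - w x\<bar> \<le> e / 2"
    and d2: "d2 > 0" "cball y d2 \<subseteq> U" "\<And>z. z \<in> cball y d2 \<Longrightarrow> \<bar>w z - w y\<bar> \<le> e / 2"
    using xy(1,2) by metis
  define \<eta> where "\<eta> = min d1 d2"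
  have \<eta>: "\<eta> > 0" "cball x \<eta> \<subseteq> U" "cball y \<eta> \<subseteq> U" using d1 d2 by (auto simp: \<eta>_def)
  let ?Z = "bump_mass TYPE('n) \<eta>"
  have Z: "?Z > 0" by (rule bump_mass_pos[OF \<eta>(1)])
  obtain \<phi> where \<phi>: "\<phi> \<in> test_functions U" "\<And>z. partial i \<phi> z = bump x \<eta> z - bump y \<eta> z"
    "\<And>z. 0 \<le> \<phi> z" "\<And>z. \<phi> z \<le> ?Z" "\<And>z. (\<phi> has_derivative (\<lambda>v. v $ i * (bump x \<eta> z - bump y \<eta> z))) (at z)"
    by (rule plateau_test_function[OF UNIV_i conv \<eta>(1) xy(3) \<eta>(2,3)]) (rule that)
  have Um: "U \<in> sets lebesgue" using U_lmeasurable by auto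
  have \<phi>0: "\<phi> z = 0" if "z \<notin> U" for z
    using \<phi>(1) that closure_subset[of "{z. \<phi> z \<noteq> 0}"] by (auto simp: test_functions_def)
  have \<phi>c: "continuous_on UNIV \<phi>"
    using \<phi>(5) by (meson continuous_at_imp_continuous_on has_derivative_continuous)
  have b0: "bump c \<eta> z = 0" if "cball c \<eta> \<subseteq> U" "z \<notin> U" for c z
    using bump_outside[OF \<eta>(1)] that by blast
  have toU: "(LINT z|lebesgue_on U. h z) = (LINT z:U|lebesgue. h z)" for h :: "real^'n \<Rightarrow> real"
    using Um by (simp add: integral_restrict_space set_lebesgue_integral_def)
  have sm: "set_integrable lebesgue U (\<lambda>z. f z * bump c \<eta> z)" "(LINT z:U|lebesgue. f z * bump c \<eta> z) = smoothed f \<eta> c"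
    if f: "continuous_on U f" and c: "cball c \<eta> \<subseteq> U" for f c
  proof -
    have eq: "indicator U z *\<^sub>R (f z * bump c \<eta> z) = indicator (cball c \<eta>) z *\<^sub>R (f z * bump c \<eta> z)" for z
      using bump_outside[OF \<eta>(1), of z c] c by (auto simp: indicator_def simp del: mem_cball)
    have "set_integrable lebesgue (cball c \<eta>) (\<lambda>z. f z * bump c \<eta> z)"
      by (intro set_integrable_continuous_compact continuous_intros continuous_on_subset[OF f c] continuous_on_bump) auto
    then show "set_integrable lebesgue U (\<lambda>z. f z * bump c \<eta> z)" by (simp only: set_integrable_def eq)
    show "(LINT z:U|lebesgue. f z * bump c \<eta> z) = smoothed f \<eta> c"
      by (simp only: smoothed_def set_lebesgue_integral_def eq)
  qed
  have diff: "(LINT z:U|lebesgue. f z * partial i \<phi> z) = smoothed f \<eta> x - smoothed f \<eta> y" if f: "continuous_on U f" for f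
    unfolding \<phi>(2) right_diff_distrib using set_integral_diff(2)[OF sm(1)[OF f \<eta>(2)] sm(1)[OF f \<eta>(3)]] sm(2)[OF f] \<eta> by simp
  have cu: "continuous_on U (\<lambda>z. u z $ i)" and cz: "continuous_on U (\<lambda>z :: real^'n. z $ i)"
    by (intro continuous_intros u_cont)+
  have 1: "smoothed (\<lambda>z. u z $ i) \<eta> x - smoothed (\<lambda>z. u z $ i) \<eta> y = - (LINT z:U|lebesgue. det (Du z) * \<phi> z)"
    using Du \<phi>(1) unfolding has_weak_jacobian_def diff[OF cu, symmetric] det1[OF UNIV_i] toU[symmetric] by blast
  \<comment> \<open>The same identity for the coordinate function, whose derivative is 1; it follows
    because the derivative of \<open>z $ i * \<phi> z\<close> has integral 0.\<close>
  have 2: "smoothed (\<lambda>z. z $ i) \<eta> x - smoothed (\<lambda>z. z $ i) \<eta> y = - (LINT z:U|lebesgue. \<phi> z)"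
  proof -
    define F' where "F' z v = z $ i * (v $ i * (bump x \<eta> z - bump y \<eta> z)) + v $ i * \<phi> z" for z v :: "real^'n"
    have dF: "((\<lambda>z. z $ i * \<phi> z) has_derivative F' z) (at z)" for z
      unfolding F'_def
      by (intro has_derivative_mult \<phi>(5) bounded_linear_imp_has_derivative[OF bounded_linear_vec_nth])
    have F'e: "F' z (axis i 1) = z $ i * partial i \<phi> z + \<phi> z" for z by (simp add: F'_def \<phi>(2))
    obtain R where R: "U \<subseteq> cball 0 R" using U(2) by (auto simp: bounded_iff subset_iff)
    have "(LINT z|lborel. F' z (axis i 1)) = 0"
    proof (rule integral_directional_derivative_eq_0[OF dF, of _ R])
      show "continuous_on UNIV (\<lambda>z. F' z (axis i 1))"
        unfolding F'e \<phi>(2) by (intro continuous_intros continuous_on_bump \<phi>c)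
      fix z :: "real^'n" assume "z \<notin> cball 0 R"
      then have "z \<notin> U" using R by blast
      then show "z $ i * \<phi> z = 0" "F' z (axis i 1) = 0"
        using \<phi>0 b0[OF \<eta>(2)] b0[OF \<eta>(3)] by (simp_all add: F'e \<phi>(2))
    qed simp
    moreover have "(\<lambda>z. F' z (axis i 1)) \<in> borel_measurable borel"
      unfolding F'e \<phi>(2) by (intro borel_measurable_continuous_onI continuous_intros continuous_on_bump \<phi>c)
    ultimately have "0 = (LINT z|lebesgue. F' z (axis i 1))"
      by (subst integral_completion) auto
    also have "\<dots> = (LINT z:U|lebesgue. z $ i * partial i \<phi> z + \<phi> z)"
      unfolding set_lebesgue_integral_def F'e
      by (rule Bochner_Integration.integral_cong[OF refl])
        (use \<phi>0 b0[OF \<eta>(2)] b0[OF \<eta>(3)] in \<open>auto simp: indicator_def \<phi>(2)\<close>)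
    also have "\<dots> = (LINT z:U|lebesgue. z $ i * partial i \<phi> z) + (LINT z:U|lebesgue. \<phi> z)"
    proof (rule set_integral_add(2))
      show "set_integrable lebesgue U (\<lambda>z. z $ i * partial i \<phi> z)"
        unfolding \<phi>(2) right_diff_distrib by (intro set_integral_diff(1) sm(1)[OF cz] \<eta>)
      show "set_integrable lebesgue U \<phi>"
        by (rule set_integrable_subset[OF set_integrable_continuous_compact[of "closure U"]])
          (use U(2) Um closure_subset continuous_on_subset[OF \<phi>c] in \<open>auto simp: compact_closure\<close>)
    qed
    finally show ?thesis using diff[OF cz] by simp
  qed
  have \<phi>m: "\<phi> \<in> borel_measurable lebesgue"
    using \<phi>c by (intro measurable_completion) (simp add: borel_measurable_continuous_onI)
  have bdd: "set_integrable lebesgue U (\<lambda>z. g z * \<phi> z)" if g: "set_integrable lebesgue U g" for g :: "real^'n \<Rightarrow> real"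
  proof -
    have gm: "(\<lambda>z. indicator U z *\<^sub>R g z) \<in> borel_measurable lebesgue"
      using g unfolding set_integrable_def by (rule borel_measurable_integrable)
    have "integrable lebesgue (\<lambda>z. (indicator U z *\<^sub>R g z) * \<phi> z)"
    proof (rule Bochner_Integration.integrable_bound)
      show "integrable lebesgue (\<lambda>z. ?Z * (indicator U z *\<^sub>R g z))"
        using g unfolding set_integrable_def by (rule integrable_mult_right)
      show "AE z in lebesgue. norm ((indicator U z *\<^sub>R g z) * \<phi> z) \<le> norm (?Z * (indicator U z *\<^sub>R g z))"
      proof (rule AE_I2)
        fix z
        have "\<bar>\<phi> z\<bar> \<le> \<bar>?Z\<bar>" using \<phi>(3,4)[of z] by simp
        then show "norm ((indicator U z *\<^sub>R g z) * \<phi> z) \<le> norm (?Z * (indicator U z *\<^sub>R g z))"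
          unfolding real_norm_def abs_mult by (metis abs_ge_zero mult.commute mult_right_mono)
      qed
    qed (intro borel_measurable_times gm \<phi>m)
    then show ?thesis by (simp add: set_integrable_def mult.assoc)
  qed
  have i1: "set_integrable lebesgue U (\<lambda>z. 1 * \<phi> z)" by (rule bdd[OF const_set_integrable[OF U_lmeasurable]])
  have i2: "set_integrable lebesgue U (\<lambda>z. det (Du z) * \<phi> z)" by (rule bdd[OF det_set_integrable])
  have lin: "smoothed w \<eta> c = smoothed (\<lambda>z. u z $ i) \<eta> c - smoothed (\<lambda>z. z $ i) \<eta> c" if "cball c \<eta> \<subseteq> U" for c
    using set_integral_diff(2)[OF sm(1)[OF cu that] sm(1)[OF cz that]] sm(2)[OF cu that] sm(2)[OF cz that] sm(2)[OF wc that]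
    by (simp add: w_def left_diff_distrib)
  have "smoothed w \<eta> x - smoothed w \<eta> y = (LINT z:U|lebesgue. 1 * \<phi> z) - (LINT z:U|lebesgue. det (Du z) * \<phi> z)"
    using 1 2 lin[OF \<eta>(2)] lin[OF \<eta>(3)] by simp
  also have "\<dots> = (LINT z:U|lebesgue. (1 - det (Du z)) * \<phi> z)"
    unfolding left_diff_distrib by (rule set_integral_diff(2)[OF i1 i2, symmetric])
  also have "\<bar>\<dots>\<bar> \<le> (LINT z|lebesgue. ?Z * (indicator U z *\<^sub>R \<bar>1 - det (Du z)\<bar>))"
    unfolding set_lebesgue_integral_def
  proof (rule abs_integral_le_AE)
    show "integrable lebesgue (\<lambda>z. ?Z * (indicator U z *\<^sub>R \<bar>1 - det (Du z)\<bar>))"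
      using abs_one_minus_det_integrable unfolding set_integrable_def by (rule integrable_mult_right)
    show "AE z in lebesgue. \<bar>indicator U z *\<^sub>R ((1 - det (Du z)) * \<phi> z)\<bar> \<le> ?Z * (indicator U z *\<^sub>R \<bar>1 - det (Du z)\<bar>)"
    proof (rule AE_I2)
      fix z
      have "\<bar>1 - det (Du z)\<bar> * \<bar>\<phi> z\<bar> \<le> \<bar>1 - det (Du z)\<bar> * ?Z"
        using \<phi>(3,4)[of z] by (intro mult_left_mono) auto
      then show "\<bar>indicator U z *\<^sub>R ((1 - det (Du z)) * \<phi> z)\<bar> \<le> ?Z * (indicator U z *\<^sub>R \<bar>1 - det (Du z)\<bar>)"
        by (simp add: indicator_def abs_mult mult.commute)
    qed
  qed
  also have "\<dots> = ?Z * ?E" by (simp add: set_lebesgue_integral_def)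
  finally have 3: "\<bar>smoothed w \<eta> x - smoothed w \<eta> y\<bar> \<le> ?Z * ?E" .
  have 4: "\<bar>smoothed w \<eta> x - ?Z * w x\<bar> \<le> ?Z * (e / 2)"
    by (rule smoothed_close[OF \<eta>(1) continuous_on_subset[OF wc \<eta>(2)]]) (use d1 in \<open>auto simp: \<eta>_def\<close>)
  have 5: "\<bar>smoothed w \<eta> y - ?Z * w y\<bar> \<le> ?Z * (e / 2)"
    by (rule smoothed_close[OF \<eta>(1) continuous_on_subset[OF wc \<eta>(3)]]) (use d2 in \<open>auto simp: \<eta>_def\<close>)
  have "\<bar>?Z * w x - ?Z * w y\<bar> \<le> ?Z * ?E + ?Z * (e / 2) + ?Z * (e / 2)" using 3 4 5 by linarith
  moreover have "?Z * w x - ?Z * w y = ?Z * (w x - w y)" by (simp only: right_diff_distrib)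
  moreover have "?Z * ?E + ?Z * (e / 2) + ?Z * (e / 2) = ?Z * (?E + e)" by (simp add: algebra_simps)
  ultimately have "?Z * \<bar>w x - w y\<bar> \<le> ?Z * (?E + e)" using Z by (simp only: abs_mult abs_of_pos)
  then show "\<bar>(u x $ i - x $ i) - (u y $ i - y $ i)\<bar> \<le> ?E + e" using Z by (simp add: w_def)
qed

text \<open>Connectedness makes \<open>U\<close> convex, so the plateau between any two of its
  points is an admissible test function.\<close>

lemma line_translation:
  assumes card: "CARD('n) = 1" and conn: "connected U" and xy: "x \<in> U" "y \<in> U"
  shows "norm ((u x - x) - (u y - y)) \<le> (LINT z:U|lebesgue. \<bar>1 - det (Du z)\<bar>)"
proof -
  obtain i :: 'n where i: "(UNIV :: 'n set) = {i}" using card card_1_singletonE by blast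
  have "convex U" using conn card by (simp add: connected_convex_1_gen)
  then have "\<bar>(u x $ i - x $ i) - (u y $ i - y $ i)\<bar> \<le> (LINT z:U|lebesgue. \<bar>1 - det (Du z)\<bar>)"
    using line_increment_le[OF i _ xy] line_increment_le[OF i _ xy(2,1)] by (metis abs_minus_commute linear)
  then show ?thesis by (simp add: norm1[OF i])
qed

end

section \<open>Choice of the radius and the final estimate\<close>

theorem corollary2p8:
  fixes U :: "(real^'n) set"
    and u :: "real^'n \<Rightarrow> real^'n"
    and Du :: "real^'n \<Rightarrow> real^'n^'n"
    and d lam :: real
  assumes "open U" "bounded U" "connected U" "lipschitz_boundary U"
    and "u \<in> W1inf U" "has_weak_jacobian u Du U"
    and "essentially_injective U u"
    and "diameter (u ` U) \<le> d"
    and "0 < lam" "AE x in lebesgue_on U. lam \<le> det (Du x)"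
  shows "\<exists>S\<in>W1inf U. essentially_injective U S \<and> measure_preserving U S \<and>
    (LINT x|lebesgue_on U. norm (u x - S x))
      \<le> 10 * (d / lam powr (1 / CARD('n))) * (1 + 1 / lam)
          * (LINT x|lebesgue_on U. \<bar>1 - det (Du x)\<bar>)"
proof -
  interpret deformation U u Du lam
    by unfold_locales fact+
  let ?E = "LINT x|lebesgue_on U. \<bar>1 - det (Du x)\<bar>"
  define R where "R = d / lam powr (1 / CARD('n))"
  have E0: "?E \<ge> 0" using excess_le by linarith
  show ?thesis
  proof (cases "?E = 0")
    case True
    then show ?thesis
      using measure_preserving_u assms by (intro bexI[of _ u]) auto
  next
    case False
    then have E: "?E > 0" using E0 by linarith
    have ne: "U \<noteq> {}"
    proof
      assume "U = {}"
      then show False using False by (simp add: total_defect set_lebesgue_integral_def)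
    qed
    then obtain x0 where x0: "x0 \<in> U" by blast
    define y0 where "y0 = u x0"
    have bu: "bounded (u ` U)"
    proof -
      obtain C where "\<And>x. x \<in> U \<Longrightarrow> norm (u x) \<le> C" using u_bounded by blast
      then show ?thesis by (auto simp: bounded_iff)
    qed
    have dist: "norm (u x - y0) \<le> d" if "x \<in> U" for x
      using diameter_bounded_bound[OF bu, of "u x" y0] that x0 assms(8) by (simp add: y0_def dist_norm)
    have Upos: "measure lebesgue U > 0"
      using open_not_negligible[OF assms(1) ne] U_lmeasurable by (simp add: negligible_iff_measure0 zero_less_measure_iff)
    have UE: "lam * measure lebesgue U \<le> measure lebesgue (cball y0 d)"
      by (rule lam_measure_le) (use dist in \<open>auto simp: dist_norm norm_minus_commute\<close>)
    \<comment> \<open>Otherwise the image would lie in a null set, although its volume is at least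
      \<open>lam * measure lebesgue U\<close>.\<close>
    have d0: "d > 0"
    proof (rule ccontr)
      assume "\<not> d > 0"
      then have "measure lebesgue (cball y0 d) = 0" by simp
      then show False using UE mult_pos_pos[OF assms(9) Upos] by linarith
    qed
    have R: "R > 0" using d0 assms(9) by (simp add: R_def)
    have Rn: "R ^ CARD('n) = d ^ CARD('n) / lam"
    proof -
      have "(lam powr (1 / CARD('n))) ^ CARD('n) = lam"
        using assms(9) by (simp add: powr_realpow[symmetric] powr_powr)
      then show ?thesis by (simp add: R_def power_divide)
    qed
    have UR: "measure lebesgue U \<le> measure lebesgue (ball y0 R)"
    proof -
      have "measure lebesgue (cball y0 d) = d ^ CARD('n) * measure lborel (ball (0::real^'n) 1)"
        using d0 content_ball_conv_unit_ball[of d y0] by (simp add: content_cball_conv_ball)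
      then have "measure lebesgue U \<le> d ^ CARD('n) / lam * measure lborel (ball (0::real^'n) 1)"
        using UE assms(9) by (simp add: field_simps)
      also have "\<dots> = measure lebesgue (ball y0 R)"
        using R content_ball_conv_unit_ball[of R y0] by (simp add: Rn)
      finally show ?thesis .
    qed
    have final: ?thesis if \<Phi>: "unimodular_C1 \<Phi>"
      and le: "(LINT x:U|lebesgue. norm (u x - \<Phi> x)) \<le> 10 * R * (1 + 1 / lam) * ?E" for \<Phi>
    proof (rule bexI[of _ \<Phi>])
      show W: "\<Phi> \<in> W1inf U" by (rule unimodular_C1_W1inf[OF assms(1,2) \<Phi>])
      have "inj_on \<Phi> U" using \<Phi> by (auto simp: unimodular_C1_def bij_def intro: inj_on_subset)
      moreover have "continuous_on U \<Phi>" using W by (simp add: W1inf_def)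
      ultimately have "essentially_injective U \<Phi>" using essentially_injective_inj[OF assms(1) ne] by blast
      moreover have "measure_preserving U \<Phi>" by (rule unimodular_C1_measure_preserving[OF assms(1,2) \<Phi>])
      moreover have "(LINT x|lebesgue_on U. norm (u x - \<Phi> x)) = (LINT x:U|lebesgue. norm (u x - \<Phi> x))"
        using U_lmeasurable by (simp add: integral_restrict_space set_lebesgue_integral_def)
      ultimately show "essentially_injective U \<Phi> \<and> measure_preserving U \<Phi> \<and>
        (LINT x|lebesgue_on U. norm (u x - \<Phi> x)) \<le> 10 * (d / lam powr (1 / CARD('n))) * (1 + 1 / lam) * ?E"
        using le by (simp add: R_def)
    qed
    show ?thesis
    proof (cases "CARD('n) \<ge> 2")
      case True
      \<comment> \<open>This positive number serves as the permitted error \<tau> of the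
        approximation.\<close>
      have pos: "R * ?E > 0" using R E by simp
      obtain \<Phi> where \<Phi>: "unimodular_C1 \<Phi>" "(LINT x:U|lebesgue. norm (u x - \<Phi> x)) \<le> (d + R) * excess + R * ?E"
        by (rule unimodular_approximation[OF True dist less_imp_le[OF d0] R UR pos]) (assumption, rule that)
      \<comment> \<open>For \<open>lam < 1\<close> the power of \<open>lam\<close> is at most 1, so
        \<open>d \<le> R\<close>; for \<open>lam \<ge> 1\<close> the excess vanishes.\<close>
      have "(d + R) * excess \<le> 2 * R * ?E"
      proof (cases "lam \<ge> 1")
        case True
        then show ?thesis using excess_eq_0 pos by simp
      next
        case False
        then have "lam powr (1 / CARD('n)) \<le> 1" using assms(9) by (intro powr_le1) auto
        then have "d \<le> R" using d0 assms(9) by (simp add: R_def pos_le_divide_eq mult_left_le)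
        then show ?thesis using excess_le R d0 by (intro mult_mono) auto
      qed
      \<comment> \<open>Two units come from the displaced cubes and one from the permitted
        error.\<close>
      moreover have "3 * (R * ?E) \<le> 10 * (1 + 1 / lam) * (R * ?E)"
        using pos assms(9) by (intro mult_right_mono) auto
      ultimately have "(LINT x:U|lebesgue. norm (u x - \<Phi> x)) \<le> 10 * R * (1 + 1 / lam) * ?E"
        using \<Phi>(2) by (simp add: mult_ac)
      then show ?thesis by (rule final[OF \<Phi>(1)])
    next
      case False
      then have card: "CARD('n) = 1" using zero_less_card_finite[where 'a='n] by linarith
      \<comment> \<open>The translation that agrees with \<open>u\<close> at \<open>x0\<close>; on
        \<open>U\<close> it differs from \<open>u\<close> by at most \<open>?E\<close>.\<close>
      define c where "c = u x0 - x0"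
      have "\<bar>LINT x|lebesgue. indicator U x *\<^sub>R norm (u x - (x + c))\<bar> \<le> (LINT x|lebesgue. ?E * indicator U x)"
      proof (rule abs_integral_le_AE)
        show "integrable lebesgue (\<lambda>x. ?E * indicator U x)"
          using U_lmeasurable by (intro integrable_mult_right) (auto simp: fmeasurable_def)
        have "norm (u x - (x + c)) \<le> ?E" if "x \<in> U" for x
          using line_translation[OF card assms(3) that x0] by (simp add: c_def total_defect algebra_simps)
        then show "AE x in lebesgue. \<bar>indicator U x *\<^sub>R norm (u x - (x + c))\<bar> \<le> ?E * indicator U x"
          by (intro AE_I2) (auto simp: indicator_def)
      qed
      then have "(LINT x:U|lebesgue. norm (u x - (x + c))) \<le> ?E * measure lebesgue U"
        using U_lmeasurable by (simp add: set_lebesgue_integral_def)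
      \<comment> \<open>In dimension 1 the ball of radius \<open>R\<close> is an interval of length
        \<open>2 * R\<close>; the box around it has the same length.\<close>
      also have "measure lebesgue U \<le> 2 * R"
      proof -
        have "measure lebesgue (cball y0 R) \<le> measure lebesgue (cbox (y0 - R *\<^sub>R 1) (y0 + R *\<^sub>R 1))"
        proof (rule measure_mono_fmeasurable)
          show "cball y0 R \<subseteq> cbox (y0 - R *\<^sub>R 1) (y0 + R *\<^sub>R 1)"
          proof
            fix y assume "y \<in> cball y0 R"
            then have "\<bar>(y - y0) $ j\<bar> \<le> R" for j
              using component_le_norm_cart[of "y - y0" j] by (simp add: dist_norm norm_minus_commute)
            then show "y \<in> cbox (y0 - R *\<^sub>R 1) (y0 + R *\<^sub>R 1)" by (auto simp: mem_box_cart abs_le_iff algebra_simps)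
          qed
        qed auto
        also have "\<dots> = 2 * R"
        proof -
          have "cbox (y0 - R *\<^sub>R 1) (y0 + R *\<^sub>R 1) \<noteq> {}"
            using R by (auto simp: interval_eq_empty_cart not_less)
          then show ?thesis using card by (simp add: content_cbox_cart)
        qed
        finally show ?thesis using UR by (simp add: content_cball_conv_ball)
      qed
      also have "?E * (2 * R) \<le> 10 * R * (1 + 1 / lam) * ?E"
      proof -
        have "2 * (R * ?E) \<le> 10 * (1 + 1 / lam) * (R * ?E)"
          using R E assms(9) by (intro mult_right_mono) auto
        then show ?thesis by (simp add: mult_ac)
      qed
      finally have "(LINT x:U|lebesgue. norm (u x - (x + c))) \<le> 10 * R * (1 + 1 / lam) * ?E"
        using E by (simp add: mult_left_mono)
      then show ?thesis by (rule final[OF unimodular_C1_translation])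
    qed
  qed
qed

end
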